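(* Let $\mathcal{H}$ be a normalized complete Pick space. Then $\operatorname{Mult}(\mathcal{H}\odot\mathcal{H}) = \operatorname{Mult}(\mathcal{H})$ and $$\|\varphi\|_{\operatorname{Mult}(\mathcal{H}\odot\mathcal{H})} = \|\varphi\|_{\operatorname{Mult}(\mathcal{H})}$$ for all $\varphi\in\operatorname{Mult}(\mathcal{H})$.
   Context: All reproducing kernel Hilbert spaces (RKHS) consist of complex-valued functions on a set $X$ and are assumed separable. Normalized complete Pick space: an RKHS $\mathcal{H}$ on $X$ with kernel $K$ such that there is $z_0\in X$ with $K(z,z_0)=1$ for all $z\in X$, and $\mathcal{H}$ has the complete Pick property: for every finite $Y\subset X$ and all $M,N\in\mathbb{N}$, the restriction map from $N\times M$ matrices of multipliers of $\mathcal{H}$ to $N\times M$ matrices of multipliers of $\mathcal{H}|_Y$ (the RKHS on $Y$ with kernel $K|_{Y\times Y}$) maps the closed unit ball onto the closed unit ball, where matrices carry the operator norm of the induced multiplication operator. Equivalently (Agler--McCarthy, McCullough, Quiggin), there are $d\in\mathbb{N}\cup\{\infty\}$ and $b:X\to\mathbb{B}_d$ with $b(z_0)=0$ and $K(z,w)=\frac{1}{1-\langle b(z),b(w)\rangle}$ for all $z,w \in X$, where $\mathbb{B}_d$ is the open unit ball of $\mathbb{C}^d$ (of $\ell^2$ if $d=\infty$). Either description may be taken as the definition. Weak product space: $\mathcal{H}\odot\mathcal{H}$ is the space of functions on $X$ of the form $h=\sum_{n=1}^\infty f_n g_n$ (pointwise) with $f_n,g_n\in\mathcal{H}$ and $\sum_n\|f_n\|\|g_n\|<\infty$,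 with the norm $\|h\|_{\mathcal{H}\odot\mathcal{H}}=\inf\{\sum_n\|f_n\|\|g_n\| : h=\sum_n f_ng_n\}$; it is a Banach function space. For $\mathcal{B}=\mathcal{H}$ or $\mathcal{B}=\mathcal{H}\odot\mathcal{H}$, $\operatorname{Mult}(\mathcal{B})$ is the algebra of all functions $\varphi:X\to\mathbb{C}$ with $\varphi f\in\mathcal{B}$ for all $f\in\mathcal{B}$, with the operator norm of multiplication by $\varphi$ on $\mathcal{B}$. *)

theory Defs
  imports Complex_Main "HOL-Library.Extended_Nat" "HOL-Library.Extended_Nonnegative_Real"
begin

text \<open>
  The set \<open>X\<close> is the type \<open>'x\<close>. The inner product \<open>ip\<close> is only meaningful on \<open>H\<close>; its values
  outside \<open>H\<close> are never constrained or used. It is linear in the first argument.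
\<close>

definition ip_norm :: "(('x \<Rightarrow> complex) \<Rightarrow> ('x \<Rightarrow> complex) \<Rightarrow> complex) \<Rightarrow> ('x \<Rightarrow> complex) \<Rightarrow> real" where
  "ip_norm ip f = sqrt (Re (ip f f))"

locale separable_rkhs =
  fixes H :: "('x \<Rightarrow> complex) set"
    and ip :: "('x \<Rightarrow> complex) \<Rightarrow> ('x \<Rightarrow> complex) \<Rightarrow> complex"
    and K :: "'x \<Rightarrow> 'x \<Rightarrow> complex"
  assumes zero_mem: "(\<lambda>x. 0) \<in> H"
    and add_mem: "f \<in> H \<Longrightarrow> g \<in> H \<Longrightarrow> (\<lambda>x. f x + g x) \<in> H"
    and scale_mem: "f \<in> H \<Longrightarrow> (\<lambda>x. c * f x) \<in> H"
    and ip_add: "f \<in> H \<Longrightarrow> g \<in> H \<Longrightarrow> h \<in> H \<Longrightarrow> ip (\<lambda>x. f x + g x) h = ip f h + ip g h"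
    and ip_scale: "f \<in> H \<Longrightarrow> h \<in> H \<Longrightarrow> ip (\<lambda>x. c * f x) h = c * ip f h"
    and ip_cnj: "f \<in> H \<Longrightarrow> g \<in> H \<Longrightarrow> ip g f = cnj (ip f g)"
    and ip_nonneg: "f \<in> H \<Longrightarrow> Re (ip f f) \<ge> 0"
    and ip_definite: "f \<in> H \<Longrightarrow> ip f f = 0 \<Longrightarrow> f = (\<lambda>x. 0)"
    and complete:
      "(\<forall>n. F n \<in> H) \<Longrightarrow>
       (\<forall>e>0. \<exists>M::nat. \<forall>m\<ge>M. \<forall>n\<ge>M. ip_norm ip (\<lambda>x. F m x - F n x) < e) \<Longrightarrow>
       \<exists>f\<in>H. (\<lambda>n. ip_norm ip (\<lambda>x. F n x - f x)) \<longlonglongrightarrow> 0"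
    and separable:
      "\<exists>D. countable D \<and> D \<subseteq> H \<and> (\<forall>f\<in>H. \<forall>e>0. \<exists>g\<in>D. ip_norm ip (\<lambda>x. f x - g x) < e)"
    and kernel_mem: "(\<lambda>z. K z w) \<in> H"
    and reproducing: "f \<in> H \<Longrightarrow> f w = ip f (\<lambda>z. K z w)"

text \<open>
  For finite \<open>d\<close>, the space \<open>\<complex>\<^sup>d\<close> is embedded in \<open>\<ell>\<^sup>2\<close> as the sequences supported on
  the indices below \<open>d\<close>.
\<close>

definition unit_ball :: "enat \<Rightarrow> (nat \<Rightarrow> complex) set" where
  "unit_ball d = {v. (\<forall>n. d \<le> enat n \<longrightarrow> v n = 0) \<and>
     summable (\<lambda>n. (cmod (v n))\<^sup>2) \<and> (\<Sum>n. (cmod (v n))\<^sup>2) < 1}"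

definition l2_inner :: "(nat \<Rightarrow> complex) \<Rightarrow> (nat \<Rightarrow> complex) \<Rightarrow> complex" where
  "l2_inner v w = (\<Sum>n. v n * cnj (w n))"

text \<open>
  The complete Pick property is expressed through the Agler--McCarthy form of a normalized kernel.
\<close>

locale normalized_complete_pick_space = separable_rkhs +
  assumes normalized_pick_kernel:
    "\<exists>z0. (\<forall>z. K z z0 = 1) \<and>
       (\<exists>d. \<exists>b. (\<forall>z. b z \<in> unit_ball d) \<and> b z0 = (\<lambda>n. 0) \<and>
          (\<forall>z w. K z w = 1 / (1 - l2_inner (b z) (b w))))"

definition weak_product_rep ::
  "('x \<Rightarrow> complex) set \<Rightarrow> (('x \<Rightarrow> complex) \<Rightarrow> ('x \<Rightarrow> complex) \<Rightarrow> complex) \<Rightarrow> ('x \<Rightarrow> complex) \<Rightarrow>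
   (nat \<Rightarrow> 'x \<Rightarrow> complex) \<Rightarrow> (nat \<Rightarrow> 'x \<Rightarrow> complex) \<Rightarrow> bool" where
  "weak_product_rep H ip h f g \<longleftrightarrow>
     (\<forall>n. f n \<in> H) \<and> (\<forall>n. g n \<in> H) \<and>
     summable (\<lambda>n. ip_norm ip (f n) * ip_norm ip (g n)) \<and>
     (\<forall>x. (\<lambda>n. f n x * g n x) sums h x)"

definition weak_product ::
  "('x \<Rightarrow> complex) set \<Rightarrow> (('x \<Rightarrow> complex) \<Rightarrow> ('x \<Rightarrow> complex) \<Rightarrow> complex) \<Rightarrow> ('x \<Rightarrow> complex) set" where
  "weak_product H ip = {h. \<exists>f g. weak_product_rep H ip h f g}"

definition weak_product_norm ::
  "('x \<Rightarrow> complex) set \<Rightarrow> (('x \<Rightarrow> complex) \<Rightarrow> ('x \<Rightarrow> complex) \<Rightarrow> complex) \<Rightarrow> ('x \<Rightarrow> complex) \<Rightarrow> real" where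
  "weak_product_norm H ip h =
     Inf {(\<Sum>n. ip_norm ip (f n) * ip_norm ip (g n)) | f g. weak_product_rep H ip h f g}"

definition Mult :: "('x \<Rightarrow> complex) set \<Rightarrow> ('x \<Rightarrow> complex) set" where
  "Mult B = {\<phi>. \<forall>f\<in>B. (\<lambda>x. \<phi> x * f x) \<in> B}"

text \<open>
  The operator norm of multiplication by \<open>\<phi>\<close> on the space \<open>B\<close> with norm \<open>N\<close>. It takes values in
  \<^typ>\<open>ennreal\<close> so that the supremum is meaningful without a boundedness hypothesis.
\<close>

definition mult_norm ::
  "('x \<Rightarrow> complex) set \<Rightarrow> (('x \<Rightarrow> complex) \<Rightarrow> real) \<Rightarrow> ('x \<Rightarrow> complex) \<Rightarrow> ennreal" where
  "mult_norm B N \<phi> = (SUP f\<in>{f\<in>B. N f \<le> 1}. ennreal (N (\<lambda>x. \<phi> x * f x)))"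

end

theory Submission
  imports Defs "HOL-Analysis.Analysis"
begin

text \<open>Norm bounds for multipliers are tested on finite sets of points, where the reproducing kernel becomes a
  positive definite matrix. Given a multiplier \<open>\<phi>\<close> of the weak product, minimize the norm of the
  diagonal block over the positive semidefinite \<open>2 \<times> 2\<close> block matrices whose off-diagonal block has diagonal \<open>\<phi>\<close>.
  A small perturbation makes the norming vector \<open>F\<close> of a minimizer unique and zero free, by a backward
  shift argument, so that the first order condition may be compared with a factorization of \<open>\<phi> F\<^sup>2\<close>.
  It follows that \<open>\<phi>\<close> is a sum of products of the entries of two columns of multipliers
  whose norms are controlled by the norm of \<open>\<phi>\<close> on the weak product. Such a sum is a multiplier of
  \<open>H\<close> with the same bound, because a contractive column of multipliers is also a contractive row.
  This column-row property is proved by adding one point at a time: a Moebius map moves the value of the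
  column at the new point to \<open>0\<close>, and there the Pick property reduces it to the remaining
  points, using that every vector of functions factors through a contractive column and a single
  function; the latter is again an extremal problem. A gliding hump argument gives boundedness of the
  multiplication operators.\<close>

section \<open>Forms of finite kernels\<close>

text \<open>The weak product norm yields, for each single F, a factorization of
  \<open>\<phi>\<close> times the square of F, hence a matrix that is good at this F but depends on
  it. A bound for multipliers needs one matrix that is good for all F at once. This exchange of
  quantifiers is not an instance of a minimax theorem, because the form is convex and not concave in
  F. Uniqueness of the norming vector replaces concavity: the maximum over F becomes differentiable
  in the matrix, so at a minimizer it suffices to compare matrices at one F. That F has to be zero
  free because the factors are divided by it to obtain a competitor.

  The induction over points is not circular. The factorization of vectors of functions is proved on
  every finite set without the column-row property, and adding a point uses it only on the points
  already present.\<close>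

definition kform :: "('x \<Rightarrow> 'x \<Rightarrow> complex) \<Rightarrow> 'x set \<Rightarrow> ('x \<Rightarrow> complex) \<Rightarrow> ('x \<Rightarrow> complex) \<Rightarrow> complex" where
  "kform k Y g h = (\<Sum>z\<in>Y. \<Sum>w\<in>Y. k z w * g z * cnj (h w))"

definition kquad :: "('x \<Rightarrow> 'x \<Rightarrow> complex) \<Rightarrow> 'x set \<Rightarrow> ('x \<Rightarrow> complex) \<Rightarrow> real" where
  "kquad k Y h = Re (kform k Y h h)"

definition kapply :: "('x \<Rightarrow> 'x \<Rightarrow> complex) \<Rightarrow> 'x set \<Rightarrow> ('x \<Rightarrow> complex) \<Rightarrow> 'x \<Rightarrow> complex" where
  "kapply k Y g z = (\<Sum>w\<in>Y. k z w * cnj (g w))"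

lemma kform_add_left: "kform k Y (\<lambda>z. f z + g z) h = kform k Y f h + kform k Y g h"
  by (simp add: kform_def algebra_simps sum.distrib)

lemma kform_add_right: "kform k Y h (\<lambda>z. f z + g z) = kform k Y h f + kform k Y h g"
  by (simp add: kform_def algebra_simps sum.distrib)

lemma kform_scale_left: "kform k Y (\<lambda>z. c * g z) h = c * kform k Y g h"
  by (simp add: kform_def algebra_simps sum_distrib_left)

lemma kform_scale_right: "kform k Y g (\<lambda>z. c * h z) = cnj c * kform k Y g h"
  by (simp add: kform_def algebra_simps sum_distrib_left)

lemma kform_cong:
  assumes "\<And>z. z \<in> Y \<Longrightarrow> g z = g' z" "\<And>z. z \<in> Y \<Longrightarrow> h z = h' z"
    and "\<And>z w. z \<in> Y \<Longrightarrow> w \<in> Y \<Longrightarrow> k z w = k' z w"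
  shows "kform k Y g h = kform k' Y g' h'"
  unfolding kform_def using assms by (intro sum.cong refl) auto

lemma kquad_cong:
  assumes "\<And>z. z \<in> Y \<Longrightarrow> h z = h' z"
  shows "kquad k Y h = kquad k Y h'"
  unfolding kquad_def using kform_cong[of Y h h' h h' k k] assms by simp

lemma kapply_cong:
  assumes "\<And>z. z \<in> Y \<Longrightarrow> h z = h' z"
  shows "kapply k Y h z = kapply k Y h' z"
  unfolding kapply_def using assms by (intro sum.cong refl) auto

lemma kform_kapply: "kform k Y g h = (\<Sum>z\<in>Y. g z * kapply k Y h z)"
  by (simp add: kform_def kapply_def sum_distrib_left algebra_simps)

lemma kform_kernel_add: "kform (\<lambda>z w. k z w + k' z w) Y g h = kform k Y g h + kform k' Y g h"
  by (simp add: kform_def algebra_simps sum.distrib)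

lemma kquad_kernel_add: "kquad (\<lambda>z w. k z w + k' z w) Y h = kquad k Y h + kquad k' Y h"
  by (simp add: kquad_def kform_kernel_add)

lemma kform_schur: "kform (\<lambda>z w. k z w * (v z * cnj (v w))) Y g h
    = kform k Y (\<lambda>z. v z * g z) (\<lambda>z. v z * h z)"
  by (simp add: kform_def algebra_simps)

lemma kquad_schur: "kquad (\<lambda>z w. k z w * (v z * cnj (v w))) Y h = kquad k Y (\<lambda>z. v z * h z)"
  by (simp add: kquad_def kform_schur)

lemma kquad_schur_sum:
  "kquad (\<lambda>z w. k z w * (\<Sum>j\<in>I. v j z * cnj (v j w))) Y h = (\<Sum>j\<in>I. kquad k Y (\<lambda>z. v j z * h z))"
proof -
  have "kform (\<lambda>z w. k z w * (\<Sum>j\<in>I. v j z * cnj (v j w))) Y h h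
      = (\<Sum>z\<in>Y. \<Sum>w\<in>Y. \<Sum>j\<in>I. k z w * (v j z * h z) * cnj (v j w * h w))"
    by (simp add: kform_def sum_distrib_left sum_distrib_right algebra_simps)
  also have "\<dots> = (\<Sum>j\<in>I. \<Sum>z\<in>Y. \<Sum>w\<in>Y. k z w * (v j z * h z) * cnj (v j w * h w))"
    by (subst sum.swap[where A=I]) (simp add: sum.swap[where A=I])
  finally show ?thesis by (simp add: kquad_def kform_def)
qed

lemma kform_rank_one: "kform (\<lambda>z w. u z * cnj (u w)) Y g h = (\<Sum>z\<in>Y. u z * g z) * cnj (\<Sum>z\<in>Y. u z * h z)"
  by (simp add: kform_def sum_product algebra_simps)

lemma kquad_rank_one: "kquad (\<lambda>z w. u z * cnj (u w)) Y h = (cmod (\<Sum>z\<in>Y. u z * h z))\<^sup>2"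
  unfolding kquad_def kform_rank_one complex_norm_square[symmetric] by (rule Re_complex_of_real)

lemma kquad_scale: "kquad k Y (\<lambda>z. c * h z) = (cmod c)\<^sup>2 * kquad k Y h"
proof -
  have "kform k Y (\<lambda>z. c * h z) (\<lambda>z. c * h z) = (c * cnj c) * kform k Y h h"
    by (simp add: kform_scale_left kform_scale_right)
  also have "c * cnj c = of_real ((cmod c)\<^sup>2)" by (rule complex_norm_square[symmetric])
  finally show ?thesis by (simp add: kquad_def)
qed

lemma kform_supp:
  assumes "finite Y" "Y' \<subseteq> Y" "\<And>z. z \<in> Y - Y' \<Longrightarrow> g z = 0" "\<And>z. z \<in> Y - Y' \<Longrightarrow> h z = 0"
  shows "kform k Y g h = kform k Y' g h"
proof -
  have "kform k Y g h = (\<Sum>z\<in>Y'. \<Sum>w\<in>Y. k z w * g z * cnj (h w))"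
    unfolding kform_def using assms by (intro sum.mono_neutral_right) auto
  also have "\<dots> = kform k Y' g h"
    unfolding kform_def using assms by (intro sum.cong refl sum.mono_neutral_right) auto
  finally show ?thesis .
qed

lemma kform_extend:
  assumes "finite Y" "Y' \<subseteq> Y"
  shows "kform k Y' g h = kform k Y (\<lambda>z. if z \<in> Y' then g z else 0) (\<lambda>z. if z \<in> Y' then h z else 0)"
proof -
  have "kform k Y (\<lambda>z. if z \<in> Y' then g z else 0) (\<lambda>z. if z \<in> Y' then h z else 0)
    = kform k Y' (\<lambda>z. if z \<in> Y' then g z else 0) (\<lambda>z. if z \<in> Y' then h z else 0)"
    by (rule kform_supp) (use assms in auto)
  also have "\<dots> = kform k Y' g h" by (rule kform_cong) auto
  finally show ?thesis ..
qed

lemma kapply_delta: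
  assumes "finite Y" "p \<in> Y"
  shows "kapply k Y (\<lambda>w. if w = p then c else 0) z = k z p * cnj c"
proof -
  have "kapply k Y (\<lambda>w. if w = p then c else 0) z = (\<Sum>w\<in>Y. if w = p then k z p * cnj c else 0)"
    unfolding kapply_def by (intro sum.cong) auto
  then show ?thesis using assms by simp
qed

lemma kform_delta_right:
  assumes "finite Y" "p \<in> Y"
  shows "kform k Y h (\<lambda>w. if w = p then 1 else 0) = (\<Sum>z\<in>Y. k z p * h z)"
  unfolding kform_kapply kapply_delta[OF assms] by (simp add: mult.commute)

lemma sum_delta_mult:
  fixes f :: "'x \<Rightarrow> complex"
  assumes "finite Y" "p \<in> Y"
  shows "(\<Sum>z\<in>Y. f z * (if z = p then c else 0)) = f p * c"
proof -
  have "(\<Sum>z\<in>Y. f z * (if z = p then c else 0)) = (\<Sum>z\<in>Y. if z = p then f p * c else 0)"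
    by (intro sum.cong) auto
  then show ?thesis using assms by simp
qed

lemma kform_delta:
  assumes "finite Y" "p \<in> Y" "q \<in> Y"
  shows "kform k Y (\<lambda>w. if w = q then 1 else 0) (\<lambda>w. if w = p then 1 else 0) = k q p"
  using sum_delta_mult[of Y q "\<lambda>z. k z p" 1] assms by (simp add: kform_delta_right)

text \<open>The expression is a quadratic in \<open>t\<close> whose minimum is at
  \<open>- cnj c / B\<close>. Allowing \<open>B = 0\<close> makes Cauchy-Schwarz available for
  semidefinite forms with null vectors.\<close>

lemma discriminant_bound:
  fixes c :: complex
  assumes "\<And>t::complex. 0 \<le> A + 2 * Re (t * c) + (cmod t)\<^sup>2 * B" and A: "0 \<le> A" and B: "0 \<le> B"
  shows "(cmod c)\<^sup>2 \<le> A * B"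
proof (cases "B = 0")
  case True
  show ?thesis
  proof (cases "c = 0")
    case False
    define s where "s = (A + 1) / (cmod c)\<^sup>2"
    have "0 \<le> A + 2 * Re (complex_of_real (-s) * cnj c * c)" using assms(1)[of "of_real (-s) * cnj c"] True by simp
    moreover have "complex_of_real (-s) * cnj c * c = of_real (-(A+1))"
    proof -
      have "cnj c * c = of_real ((cmod c)\<^sup>2)" by (metis complex_norm_square mult.commute)
      then have "complex_of_real (-s) * cnj c * c = of_real (-s * (cmod c)\<^sup>2)" by (simp add: mult.assoc)
      also have "-s * (cmod c)\<^sup>2 = -(A+1)" using False by (simp add: s_def)
      finally show ?thesis .
    qed
    ultimately have "0 \<le> A + 2 * (-(A+1))" by (metis Re_complex_of_real)
    then show ?thesis using A by simp
  qed (use True in simp)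
next
  case False
  then have B: "B > 0" using B by simp
  have "cnj c * c = of_real ((cmod c)\<^sup>2)" by (metis complex_norm_square mult.commute)
  then have "complex_of_real (-1/B) * cnj c * c = of_real (- (cmod c)\<^sup>2 / B)" by (simp add: mult.assoc)
  then have 1: "Re (complex_of_real (-1/B) * cnj c * c) = - (cmod c)\<^sup>2 / B" using Re_complex_of_real by presburger
  have 2: "(cmod (complex_of_real (-1/B) * cnj c))\<^sup>2 * B = (cmod c)\<^sup>2 / B"
    using B by (simp add: norm_mult norm_divide power_divide power2_eq_square)
  have "0 \<le> A + 2 * (- (cmod c)\<^sup>2 / B) + (cmod c)\<^sup>2 / B"
    using assms(1)[of "of_real (-1/B) * cnj c"] unfolding 1 2 .
  then have "(cmod c)\<^sup>2 / B \<le> A" by (simp add: field_simps)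
  then show ?thesis using B by (simp add: field_simps)
qed

section \<open>Positive semidefinite matrices indexed by a finite set of points\<close>

locale pos_kernel =
  fixes k :: "'x \<Rightarrow> 'x \<Rightarrow> complex" and Y :: "'x set"
  assumes fin: "finite Y"
    and herm: "z \<in> Y \<Longrightarrow> w \<in> Y \<Longrightarrow> k w z = cnj (k z w)"
    and nonneg: "0 \<le> kquad k Y h"
begin

lemma kform_cnj: "kform k Y h g = cnj (kform k Y g h)"
proof -
  have "cnj (kform k Y g h) = (\<Sum>z\<in>Y. \<Sum>w\<in>Y. k w z * cnj (g z) * h w)"
    unfolding kform_def cnj_sum by (intro sum.cong refl) (simp add: herm[symmetric])
  also have "\<dots> = kform k Y h g"
    unfolding kform_def by (subst sum.swap) (simp add: algebra_simps)
  finally show ?thesis ..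
qed

lemma kform_self: "kform k Y h h = of_real (kquad k Y h)"
  using kform_cnj[of h h] by (simp add: kquad_def complex_eq_iff)

lemma kquad_add_scale:
  "kquad k Y (\<lambda>z. f z + c * g z) = kquad k Y f + 2 * Re (cnj c * kform k Y f g) + (cmod c)\<^sup>2 * kquad k Y g"
proof -
  have "kform k Y (\<lambda>z. f z + c * g z) (\<lambda>z. f z + c * g z) =
    kform k Y f f + cnj c * kform k Y f g + cnj (cnj c * kform k Y f g) + kform k Y (\<lambda>z. c * g z) (\<lambda>z. c * g z)"
    using kform_cnj[of f g]
    by (simp add: kform_add_left kform_add_right kform_scale_left kform_scale_right)
  then have "Re (kform k Y (\<lambda>z. f z + c * g z) (\<lambda>z. f z + c * g z)) =
    Re (kform k Y f f) + 2 * Re (cnj c * kform k Y f g) + Re (kform k Y (\<lambda>z. c * g z) (\<lambda>z. c * g z))"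
    by simp
  then show ?thesis using kquad_scale[of k Y c g] unfolding kquad_def by simp
qed

lemma kform_cauchy: "(cmod (kform k Y f g))\<^sup>2 \<le> kquad k Y f * kquad k Y g"
proof (rule discriminant_bound)
  fix t :: complex
  show "0 \<le> kquad k Y f + 2 * Re (t * kform k Y f g) + (cmod t)\<^sup>2 * kquad k Y g"
    using nonneg[of "\<lambda>z. f z + cnj t * g z"] kquad_add_scale[of f "cnj t" g] by simp
qed (use nonneg in auto)

lemma kquad_parallelogram:
  "kquad k Y (\<lambda>z. f z + g z) + kquad k Y (\<lambda>z. f z - g z) = 2 * kquad k Y f + 2 * kquad k Y g"
  using kquad_add_scale[of f 1 g] kquad_add_scale[of f "-1" g] by simp

text \<open>The pair \<open>(g, h)\<close> undergoes a hyperbolic rotation, which preserves the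
  indefinite form on the right. Applied to the graph of a column it becomes a Moebius map, see
  \<open>col_contr_moebius\<close>.\<close>

lemma kquad_hyperbolic:
  assumes "cmod a < 1" and s: "s = sqrt (1 - (cmod a)\<^sup>2)"
  shows "kquad k Y (\<lambda>z. (g z + cnj a * h z) / of_real s) - kquad k Y (\<lambda>z. (h z + a * g z) / of_real s)
    = kquad k Y g - kquad k Y h"
proof -
  have lt: "(cmod a)\<^sup>2 < 1" using assms(1) by (simp add: power_less_one_iff abs_square_less_1)
  have sp: "s\<^sup>2 = 1 - (cmod a)\<^sup>2" "s > 0" using lt s by auto
  have sc: "kquad k Y (\<lambda>z. f z / of_real s) = kquad k Y f / s\<^sup>2" for f
    using kquad_scale[of k Y "1 / of_real s" f] sp by (simp add: norm_divide power_divide)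
  have "Re (a * kform k Y g h) = Re (cnj a * kform k Y h g)"
    using kform_cnj[of h g] by simp
  then have "kquad k Y (\<lambda>z. g z + cnj a * h z) - kquad k Y (\<lambda>z. h z + a * g z)
    = s\<^sup>2 * (kquad k Y g - kquad k Y h)"
    using kquad_add_scale[of g "cnj a" h] kquad_add_scale[of h a g] unfolding sp(1) by (simp add: algebra_simps)
  then show ?thesis using sp(2) unfolding sc by (simp add: diff_divide_distrib[symmetric])
qed

lemma diag_nonneg: "p \<in> Y \<Longrightarrow> 0 \<le> Re (k p p)"
  using nonneg[of "\<lambda>z. if z = p then 1 else 0"] fin by (simp add: kquad_def kform_delta)

lemma entry_bound:
  assumes "z \<in> Y" "w \<in> Y"
  shows "(cmod (k z w))\<^sup>2 \<le> Re (k z z) * Re (k w w)"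
  using kform_cauchy[of "\<lambda>v. if v = z then 1 else 0" "\<lambda>v. if v = w then 1 else 0"]
    kform_delta[OF fin assms(2,1), of k] kform_delta[OF fin assms(1,1), of k] kform_delta[OF fin assms(2,2), of k]
  by (simp add: kquad_def)

lemma entry_le:
  assumes "\<And>z. z \<in> Y \<Longrightarrow> Re (k z z) \<le> \<mu>" and zw: "z \<in> Y" "w \<in> Y"
  shows "cmod (k z w) \<le> \<mu>"
proof (rule power2_le_imp_le)
  show \<mu>: "0 \<le> \<mu>" using assms(1)[OF zw(1)] diag_nonneg[OF zw(1)] by simp
  have "Re (k z z) * Re (k w w) \<le> \<mu> * \<mu>"
    using assms zw diag_nonneg \<mu> by (intro mult_mono) auto
  then show "(cmod (k z w))\<^sup>2 \<le> \<mu>\<^sup>2" using entry_bound[OF zw] by (simp add: power2_eq_square)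
qed

lemma subset: "Y' \<subseteq> Y \<Longrightarrow> pos_kernel k Y'"
proof
  assume Y': "Y' \<subseteq> Y"
  show "finite Y'" using Y' fin finite_subset by blast
  show "\<And>z w. z \<in> Y' \<Longrightarrow> w \<in> Y' \<Longrightarrow> k w z = cnj (k z w)" using herm Y' by blast
  show "0 \<le> kquad k Y' h" for h
    unfolding kquad_def kform_extend[OF fin Y'] using nonneg by (simp add: kquad_def)
qed

end

lemma kform_insert:
  assumes "finite Y" "p \<notin> Y"
  shows "kform k (insert p Y) g h = k p p * g p * cnj (h p) + g p * kapply k Y h p
      + (\<Sum>z\<in>Y. k z p * g z) * cnj (h p) + kform k Y g h"
  using assms by (simp add: kform_def kapply_def sum.distrib sum_distrib_left sum_distrib_right algebra_simps)

lemma kapply_insert: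
  assumes "finite Y" "p \<notin> Y"
  shows "kapply k (insert p Y) h z = k z p * cnj (h p) + kapply k Y h z"
  using assms by (simp add: kapply_def)

lemma pos_kernel_insert_subset: "pos_kernel k (insert p Y) \<Longrightarrow> pos_kernel k Y"
  using pos_kernel.subset by blast

text \<open>The hypothesis says that the functional annihilates the null vectors of the kernel; it is
  vacuous for a strictly positive kernel.\<close>

lemma kapply_solvable:
  assumes "finite Y" and "pos_kernel k Y"
    and "\<And>h. kquad k Y h = 0 \<Longrightarrow> (\<Sum>z\<in>Y. f z * h z) = 0"
  shows "\<exists>g. \<forall>z\<in>Y. kapply k Y g z = f z"
  using assms
proof (induction Y arbitrary: f rule: finite_induct)
  case (insert p Y)
  interpret P: pos_kernel k "insert p Y" by fact
  interpret Y: pos_kernel k Y by (rule pos_kernel_insert_subset) fact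
  have ext: "kform k (insert p Y) (\<lambda>z. if z \<in> Y then h z else 0) (\<lambda>z. if z \<in> Y then h' z else 0) = kform k Y h h'" for h h'
    using insert.hyps by (intro kform_extend[symmetric]) auto
  have H: "(\<Sum>z\<in>Y. f' z * h z) = 0"
    if "\<And>h. kquad k (insert p Y) h = 0 \<Longrightarrow> (\<Sum>z\<in>insert p Y. f' z * h z) = 0" "kquad k Y h = 0" for f' h
  proof -
    have "(\<Sum>z\<in>insert p Y. f' z * (if z \<in> Y then h z else 0)) = 0"
      using ext[of h h] that by (simp add: kquad_def)
    moreover have "(\<Sum>z\<in>insert p Y. f' z * (if z \<in> Y then h z else 0)) = (\<Sum>z\<in>Y. f' z * h z)"
      using insert.hyps by (auto intro!: sum.cong)
    ultimately show ?thesis by simp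
  qed
  have "(\<Sum>z\<in>insert p Y. k z p * h z) = 0" if "kquad k (insert p Y) h = 0" for h
  proof -
    let ?d = "\<lambda>z. if z = p then 1 else 0 :: complex"
    have "kform k (insert p Y) h ?d = 0" using P.kform_cauchy[of h ?d] that by simp
    moreover have "kform k (insert p Y) h ?d = (\<Sum>z\<in>insert p Y. k z p * h z)"
      using insert.hyps by (intro kform_delta_right) auto
    ultimately show ?thesis by simp
  qed
  from H[OF this] obtain y where y: "\<And>z. z \<in> Y \<Longrightarrow> kapply k Y y z = k z p"
    using insert.IH[OF Y.pos_kernel_axioms, of "\<lambda>z. k z p"] by blast
  from H[OF insert.prems(2)] obtain x where x: "\<And>z. z \<in> Y \<Longrightarrow> kapply k Y x z = f z"
    using insert.IH[OF Y.pos_kernel_axioms, of f] by blast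
  \<comment> \<open>The Schur complement of the new point: \<open>n\<close> is sent to
    \<open>d\<close> times the point mass at \<open>p\<close>.\<close>
  define d where "d = k p p - kapply k Y y p"
  define n where "n z = (if z = p then 1 else - y z)" for z
  have kn: "kapply k (insert p Y) n z = (if z = p then d else 0)" if "z \<in> insert p Y" for z
  proof -
    have "kapply k Y n z = kapply k Y (\<lambda>z. - y z) z" using insert.hyps by (intro kapply_cong) (auto simp: n_def)
    also have "\<dots> = - kapply k Y y z" by (simp add: kapply_def sum_negf)
    finally show ?thesis using that insert.hyps y
      by (auto simp: kapply_insert d_def n_def)
  qed
  have kap_lin: "kapply k (insert p Y) (\<lambda>z. u z + t * v z) z = kapply k (insert p Y) u z + cnj t * kapply k (insert p Y) v z" for u v t z
    by (simp only: kapply_def sum_distrib_left sum.distrib[symmetric]) (simp add: algebra_simps)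
  define x' where "x' z = (if z = p then 0 else x z)" for z
  have kx: "kapply k (insert p Y) x' z = kapply k Y x z" for z
  proof -
    have "kapply k Y x' z = kapply k Y x z" using insert.hyps by (intro kapply_cong) (auto simp: x'_def)
    then show ?thesis using insert.hyps by (simp add: kapply_insert x'_def)
  qed
  show ?case
  proof (cases "d = 0")
    case False
    define t where "t = cnj ((f p - kapply k Y x p) / d)"
    have "kapply k (insert p Y) (\<lambda>z. x' z + t * n z) z = f z" if "z \<in> insert p Y" for z
      using that False x kn[OF that] by (auto simp: kap_lin kx t_def simp del: complex_cnj_divide complex_cnj_diff)
    then show ?thesis by blast
  next
    case True
    \<comment> \<open>Now \<open>n\<close> is a null vector, and the hypothesis on \<open>f\<close>
      applied to it says that the solution on \<open>Y\<close> already takes the value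
      \<open>f p\<close> at \<open>p\<close>.\<close>
    have "kform k (insert p Y) n n = 0"
      unfolding kform_kapply using kn True by (intro sum.neutral) auto
    then have "kquad k (insert p Y) n = 0" by (simp add: kquad_def)
    then have 1: "(\<Sum>z\<in>insert p Y. f z * n z) = 0" using insert.prems(2) by blast
    have "kform k (insert p Y) x' n = 0" unfolding kform_kapply using kn True by (intro sum.neutral) auto
    then have "kform k (insert p Y) n x' = 0" using P.kform_cnj[of n x'] by simp
    then have "(\<Sum>z\<in>insert p Y. n z * kapply k Y x z) = 0" unfolding kform_kapply kx .
    moreover have "(\<Sum>z\<in>Y. n z * kapply k Y x z) = (\<Sum>z\<in>Y. f z * n z)"
      by (intro sum.cong refl) (simp add: x)
    ultimately have "n p * kapply k Y x p + (\<Sum>z\<in>Y. f z * n z) = f p * n p + (\<Sum>z\<in>Y. f z * n z)"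
      using 1 insert.hyps by simp
    then have "kapply k Y x p = f p" unfolding add_right_cancel by (simp add: n_def)
    then have "\<forall>z\<in>insert p Y. kapply k (insert p Y) x' z = f z" using kx x by auto
    then show ?thesis by blast
  qed
qed simp

text \<open>Cholesky elimination of one point at a time: a nonzero diagonal entry splits off the
  rank one kernel built from its column, and a zero one has a vanishing row by
  \<open>entry_bound\<close>.\<close>

lemma pos_kernel_gram:
  assumes "finite Y" and "pos_kernel k Y"
  shows "\<exists>(m::nat) v. \<forall>z\<in>Y. \<forall>w\<in>Y. k z w = (\<Sum>j<m. v j z * cnj (v j w))"
  using assms
proof (induction Y arbitrary: k rule: finite_induct)
  case (insert p Y)
  interpret P: pos_kernel k "insert p Y" by fact
  interpret Y: pos_kernel k Y by (rule pos_kernel_insert_subset) fact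
  have pp: "k p p = of_real (Re (k p p))" using P.herm[of p p] by (simp add: complex_eq_iff)
  have pp0: "0 \<le> Re (k p p)" by (rule P.diag_nonneg) simp
  show ?case
  proof (cases "Re (k p p) = 0")
    case True
    have zp: "k z p = 0" if "z \<in> insert p Y" for z
      using P.entry_bound[OF that insertI1] True by simp
    then have pz: "k p z = 0" if "z \<in> insert p Y" for z using P.herm[of z p] that by simp
    from insert.IH[OF Y.pos_kernel_axioms] obtain m :: nat and v where
      v: "\<And>z w. z \<in> Y \<Longrightarrow> w \<in> Y \<Longrightarrow> k z w = (\<Sum>j<m. v j z * cnj (v j w))" by blast
    have "k z w = (\<Sum>j<m. (if z = p then 0 else v j z) * cnj (if w = p then 0 else v j w))"
      if "z \<in> insert p Y" "w \<in> insert p Y" for z w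
    proof (cases "z = p \<or> w = p")
      case True
      then show ?thesis using that zp pz by auto
    next
      case False
      then show ?thesis using that v by auto
    qed
    then show ?thesis
      by (intro exI[of _ m] exI[of _ "\<lambda>j z. if z = p then 0 else v j z"]) blast
  next
    case False
    define r where "r = sqrt (Re (k p p))"
    have r: "r > 0" "r\<^sup>2 = Re (k p p)" using False pp0 by (auto simp: r_def)
    then have rr: "of_real r * of_real r = k p p" using pp by (metis of_real_mult power2_eq_square)
    define u where "u z = k z p / of_real r" for z
    define k' where "k' z w = k z w - u z * cnj (u w)" for z w
    have kk: "k z w = u z * cnj (u w) + k' z w" for z w by (simp add: k'_def)
    have up: "u z * cnj (u p) = k z p" for z
    proof -
      have "cnj (k p p) = k p p" using P.herm[of p p] by simp
      then have "u z * cnj (u p) = k z p * k p p / (of_real r * of_real r)" by (simp add: u_def)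
      also have "\<dots> = k z p" using r rr by (metis nonzero_mult_div_cancel_right mult_eq_0_iff of_real_eq_0_iff less_irrefl)
      finally show ?thesis .
    qed
    have k'p: "k' z p = 0" for z using up by (simp add: k'_def)
    have herm': "k' w z = cnj (k' z w)" if "z \<in> insert p Y" "w \<in> insert p Y" for z w
      using P.herm[OF that] by (simp add: k'_def)
    have k'q: "k' p z = 0" if "z \<in> insert p Y" for z using herm'[of z p] that k'p by simp
    have up0: "u p \<noteq> 0" using up[of p] False by auto
    have "pos_kernel k' Y"
    proof
      fix h
      \<comment> \<open>The value at \<open>p\<close> is chosen to annihilate the rank one part, so
        that \<open>k\<close> at \<open>h'\<close> equals the remainder \<open>k'\<close> at
        \<open>h\<close>.\<close>
      define h' where "h' z = (if z = p then - (\<Sum>z\<in>Y. u z * h z) / u p else h z)" for z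
      have hY: "(\<Sum>z\<in>Y. u z * h' z) = (\<Sum>z\<in>Y. u z * h z)" using insert.hyps by (intro sum.cong) (auto simp: h'_def)
      then have "(\<Sum>z\<in>insert p Y. u z * h' z) = 0"
        using insert.hyps up0 by (simp add: hY) (simp add: h'_def)
      then have "kquad (\<lambda>z w. u z * cnj (u w)) (insert p Y) h' = 0" unfolding kquad_rank_one by simp
      then have "kquad k (insert p Y) h' = kquad k' (insert p Y) h'"
        using kquad_kernel_add[of "\<lambda>z w. u z * cnj (u w)" k' "insert p Y" h'] by (simp add: kk[symmetric])
      also have "\<dots> = kquad k' Y h'"
      proof -
        have "kapply k' Y h' p = 0" unfolding kapply_def using k'q by (intro sum.neutral) auto
        then show ?thesis using insert.hyps k'p by (simp add: kquad_def kform_insert)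
      qed
      also have "\<dots> = kquad k' Y h" using insert.hyps by (intro kquad_cong) (auto simp: h'_def)
      finally show "0 \<le> kquad k' Y h" using P.nonneg[of h'] by simp
    next
      show "finite Y" by fact
      show "k' w z = cnj (k' z w)" if "z \<in> Y" "w \<in> Y" for z w using that by (intro herm') auto
    qed
    from insert.IH[OF this] obtain m :: nat and v where
      v: "\<And>z w. z \<in> Y \<Longrightarrow> w \<in> Y \<Longrightarrow> k' z w = (\<Sum>j<m. v j z * cnj (v j w))" by blast
    define v' where "v' j z = (if j = m then u z else if z = p then 0 else v j z)" for j z
    have "k z w = (\<Sum>j<Suc m. v' j z * cnj (v' j w))"
      if "z \<in> insert p Y" "w \<in> insert p Y" for z w
    proof -
      have "(\<Sum>j<m. v' j z * cnj (v' j w)) = k' z w"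
      proof (cases "z = p \<or> w = p")
        case True
        then show ?thesis using that k'p k'q by (auto simp: v'_def)
      next
        case False
        then have "k' z w = (\<Sum>j<m. v j z * cnj (v j w))" using that v by blast
        then show ?thesis using False by (simp add: v'_def)
      qed
      moreover have "v' m = u" by (auto simp: v'_def)
      ultimately show ?thesis unfolding kk[of z w] by simp
    qed
    then show ?thesis by blast
  qed
qed simp

section \<open>Contractive columns and rows of multipliers\<close>

text \<open>On the span of the kernel functions the quadratic form of \<open>k\<close> is the squared norm and multipliers
  act by their adjoints, which turns the column with entries \<open>\<phi> i\<close> into a row.\<close>

definition col_contr :: "('x \<Rightarrow> 'x \<Rightarrow> complex) \<Rightarrow> 'x set \<Rightarrow> nat \<Rightarrow> (nat \<Rightarrow> 'x \<Rightarrow> complex) \<Rightarrow> bool" where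
  "col_contr k Y N \<phi> \<longleftrightarrow> (\<forall>g. kquad k Y (\<lambda>z. \<Sum>i<N. \<phi> i z * g i z) \<le> (\<Sum>i<N. kquad k Y (g i)))"

definition row_contr :: "('x \<Rightarrow> 'x \<Rightarrow> complex) \<Rightarrow> 'x set \<Rightarrow> nat \<Rightarrow> (nat \<Rightarrow> 'x \<Rightarrow> complex) \<Rightarrow> bool" where
  "row_contr k Y N \<phi> \<longleftrightarrow> (\<forall>g. (\<Sum>i<N. kquad k Y (\<lambda>z. \<phi> i z * g z)) \<le> kquad k Y g)"

lemma col_contrD:
  "col_contr k Y N \<phi> \<Longrightarrow> kquad k Y (\<lambda>z. \<Sum>i<N. \<phi> i z * g i z) \<le> (\<Sum>i<N. kquad k Y (g i))"
  by (simp add: col_contr_def)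

lemma row_contrD:
  "row_contr k Y N \<phi> \<Longrightarrow> (\<Sum>i<N. kquad k Y (\<lambda>z. \<phi> i z * g z)) \<le> kquad k Y g"
  by (simp add: row_contr_def)

definition column_row :: "('x \<Rightarrow> 'x \<Rightarrow> complex) \<Rightarrow> 'x set \<Rightarrow> bool" where
  "column_row k Y \<longleftrightarrow> (\<forall>N \<phi>. col_contr k Y N \<phi> \<longrightarrow> row_contr k Y N \<phi>)"

text \<open>Dual form of writing a vector of functions as \<open>y i\<close> times one function:
  acting on the coefficients \<open>f i\<close>, the column \<open>y\<close> loses almost nothing of
  the total norm. The factor \<rho> leaves room for the strict inequality in
  \<open>dominating_function\<close>.\<close>

definition approx_factorization :: "('x \<Rightarrow> 'x \<Rightarrow> complex) \<Rightarrow> 'x set \<Rightarrow> bool" where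
  "approx_factorization k Y \<longleftrightarrow> (\<forall>N f \<rho>. 0 < \<rho> \<longrightarrow> \<rho> < 1 \<longrightarrow>
     (\<exists>y. col_contr k Y N y \<and> \<rho> * (\<Sum>i<N. kquad k Y (f i)) \<le> kquad k Y (\<lambda>z. \<Sum>i<N. y i z * f i z)))"

text \<open>Commutativity of multipliers is the point. The factorization is applied to the vectors
  \<open>\<phi> i z * g z\<close>; then \<open>\<phi> i\<close> and \<open>y i\<close> change
  places, the hypothesis is used for the vectors \<open>y i z * g z\<close>, and the row bound for
  \<open>y\<close> sums over \<open>i\<close>.\<close>

lemma row_contr_relative:
  assumes crp: "column_row k Y" and fact: "approx_factorization k Y"
    and col: "\<And>g. kquad k Y (\<lambda>z. \<Sum>i<N. \<phi> i z * g i z) \<le> (\<Sum>i<N. \<Sum>j<m. kquad k Y (\<lambda>z. c j z * g i z))"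
  shows "(\<Sum>i<(N::nat). kquad k Y (\<lambda>z. \<phi> i z * g z)) \<le> (\<Sum>j<(m::nat). kquad k Y (\<lambda>z. c j z * g z))"
proof (rule field_le_mult_one_interval)
  fix \<rho> :: real assume "0 < \<rho>" "\<rho> < 1"
  then obtain y where y: "col_contr k Y N y"
    and le: "\<rho> * (\<Sum>i<N. kquad k Y (\<lambda>z. \<phi> i z * g z)) \<le> kquad k Y (\<lambda>z. \<Sum>i<N. y i z * (\<phi> i z * g z))"
    using fact[unfolded approx_factorization_def, rule_format, of \<rho> N "\<lambda>i z. \<phi> i z * g z"] by blast
  have row: "row_contr k Y N y" using crp y by (simp add: column_row_def)
  note le
  also have "kquad k Y (\<lambda>z. \<Sum>i<N. y i z * (\<phi> i z * g z)) = kquad k Y (\<lambda>z. \<Sum>i<N. \<phi> i z * (y i z * g z))"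
    by (simp add: algebra_simps)
  also have "\<dots> \<le> (\<Sum>i<N. \<Sum>j<m. kquad k Y (\<lambda>z. c j z * (y i z * g z)))" by (rule col)
  also have "\<dots> = (\<Sum>j<m. \<Sum>i<N. kquad k Y (\<lambda>z. y i z * (c j z * g z)))"
    by (subst sum.swap) (simp add: algebra_simps)
  also have "\<dots> \<le> (\<Sum>j<m. kquad k Y (\<lambda>z. c j z * g z))"
    by (intro sum_mono row_contrD[OF row])
  finally show "\<rho> * (\<Sum>i<N. kquad k Y (\<lambda>z. \<phi> i z * g z)) \<le> (\<Sum>j<m. kquad k Y (\<lambda>z. c j z * g z))" .
qed

text \<open>The automorphism of the unit ball that carries the point with \<open>i0\<close>-th
  coordinate \<alpha> and other coordinates 0 to the origin. Treating one coordinate at a time needs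
  only a disc parameter and preserves zeros in the other coordinates.\<close>

definition moebius :: "nat \<Rightarrow> complex \<Rightarrow> (nat \<Rightarrow> 'x \<Rightarrow> complex) \<Rightarrow> nat \<Rightarrow> 'x \<Rightarrow> complex" where
  "moebius i0 \<alpha> \<phi> i z =
     (if i = i0 then \<phi> i z - \<alpha> else of_real (sqrt (1 - (cmod \<alpha>)\<^sup>2)) * \<phi> i z) / (1 - cnj \<alpha> * \<phi> i0 z)"

context pos_kernel
begin

text \<open>If \<open>h\<close> is the image of \<open>g\<close> under the new column, then the
  rotated pair is the \<open>i0\<close>-th input of the old column and its image; the remaining
  inputs are unchanged. Hence \<open>kquad_hyperbolic\<close> carries the contractive estimate from
  one column to the other.\<close>

lemma col_contr_moebius:
  assumes i0: "i0 < N" and a: "cmod \<alpha> < 1" and D: "\<And>z. z \<in> Y \<Longrightarrow> 1 - cnj \<alpha> * \<phi> i0 z \<noteq> 0"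
    and col: "col_contr k Y N \<phi>"
  shows "col_contr k Y N (moebius i0 \<alpha> \<phi>)"
  unfolding col_contr_def
proof
  fix g
  define s where "s = sqrt (1 - (cmod \<alpha>)\<^sup>2)"
  have "(cmod \<alpha>)\<^sup>2 < 1" using a by (simp add: power_less_one_iff abs_square_less_1)
  then have s0: "s > 0" by (simp add: s_def)
  define h where "h z = (\<Sum>i<N. moebius i0 \<alpha> \<phi> i z * g i z)" for z
  define g' where "g' i = (if i = i0 then (\<lambda>z. (g i0 z + cnj \<alpha> * h z) / of_real s) else g i)" for i
  have rm: "(\<Sum>i<N. F i) = F i0 + (\<Sum>i\<in>{..<N}-{i0}. F i)" for F :: "nat \<Rightarrow> 'b::comm_monoid_add"
    using i0 by (intro sum.remove) auto
  have key: "(\<Sum>i<N. \<phi> i z * g' i z) = (h z + \<alpha> * g i0 z) / of_real s" if z: "z \<in> Y" for z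
  proof -
    define D where "D = 1 - cnj \<alpha> * \<phi> i0 z"
    have D0: "D \<noteq> 0" using D[OF z] by (simp add: D_def)
    define G where "G = (\<Sum>i\<in>{..<N}-{i0}. \<phi> i z * g i z)"
    have "h z = (\<phi> i0 z - \<alpha>) / D * g i0 z + (\<Sum>i\<in>{..<N}-{i0}. of_real s * \<phi> i z / D * g i z)"
      unfolding h_def rm by (simp add: moebius_def D_def s_def)
    also have "(\<Sum>i\<in>{..<N}-{i0}. of_real s * \<phi> i z / D * g i z) = of_real s / D * G"
      unfolding G_def sum_distrib_left by (simp add: algebra_simps)
    finally have "h z * D = (\<phi> i0 z - \<alpha>) * g i0 z + of_real s * G" using D0 by (simp add: field_simps)
    then have 1: "h z + \<alpha> * g i0 z = \<phi> i0 z * (g i0 z + cnj \<alpha> * h z) + of_real s * G"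
      by (simp add: D_def algebra_simps)
    have "(\<Sum>i<N. \<phi> i z * g' i z) = \<phi> i0 z * ((g i0 z + cnj \<alpha> * h z) / of_real s) + G"
      unfolding rm G_def by (simp add: g'_def)
    then show ?thesis unfolding 1 using s0 by (simp add: field_simps)
  qed
  have "kquad k Y (\<lambda>z. (h z + \<alpha> * g i0 z) / of_real s) = kquad k Y (\<lambda>z. \<Sum>i<N. \<phi> i z * g' i z)"
    by (rule kquad_cong) (simp add: key)
  also have "\<dots> \<le> (\<Sum>i<N. kquad k Y (g' i))" by (rule col_contrD[OF col])
  also have "\<dots> = kquad k Y (\<lambda>z. (g i0 z + cnj \<alpha> * h z) / of_real s) + (\<Sum>i\<in>{..<N}-{i0}. kquad k Y (g i))"
    unfolding rm by (simp add: g'_def)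
  finally have "kquad k Y h \<le> kquad k Y (g i0) + (\<Sum>i\<in>{..<N}-{i0}. kquad k Y (g i))"
    using kquad_hyperbolic[OF a s_def, of "g i0" h] by simp
  then show "kquad k Y (\<lambda>z. \<Sum>i<N. moebius i0 \<alpha> \<phi> i z * g i z) \<le> (\<Sum>i<N. kquad k Y (g i))"
    unfolding rm[of "\<lambda>i. kquad k Y (g i)"] by (simp add: h_def[abs_def])
qed

text \<open>A row is tested on a single vector, which can absorb the Moebius denominator:
  \<open>g'\<close> is \<open>g\<close> times the denominator over \<open>s\<close>. The hyperbolic
  identity with parameter \<open>- \<alpha>\<close> compares the \<open>i0\<close>-th terms.\<close>

lemma row_contr_moebius:
  assumes i0: "i0 < N" and a: "cmod \<alpha> < 1" and D: "\<And>z. z \<in> Y \<Longrightarrow> 1 - cnj \<alpha> * \<phi> i0 z \<noteq> 0"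
    and row: "row_contr k Y N (moebius i0 \<alpha> \<phi>)"
  shows "row_contr k Y N \<phi>"
  unfolding row_contr_def
proof
  fix g
  define s where "s = sqrt (1 - (cmod \<alpha>)\<^sup>2)"
  have "(cmod \<alpha>)\<^sup>2 < 1" using a by (simp add: power_less_one_iff abs_square_less_1)
  then have s0: "s > 0" by (simp add: s_def)
  have rm: "(\<Sum>i<N. F i) = F i0 + (\<Sum>i\<in>{..<N}-{i0}. F i)" for F :: "nat \<Rightarrow> real"
    using i0 by (intro sum.remove) auto
  define g' where "g' z = (g z + cnj (-\<alpha>) * (\<phi> i0 z * g z)) / of_real s" for z
  have g': "g' z = (1 - cnj \<alpha> * \<phi> i0 z) * g z / of_real s" for z by (simp add: g'_def algebra_simps)
  have 1: "kquad k Y (\<lambda>z. moebius i0 \<alpha> \<phi> i0 z * g' z) = kquad k Y (\<lambda>z. (\<phi> i0 z * g z + (-\<alpha>) * g z) / of_real s)"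
    using D s0 by (intro kquad_cong) (simp add: moebius_def g' field_simps)
  have 2: "kquad k Y (\<lambda>z. moebius i0 \<alpha> \<phi> i z * g' z) = kquad k Y (\<lambda>z. \<phi> i z * g z)" if "i \<noteq> i0" for i
    using D s0 that by (intro kquad_cong) (simp add: moebius_def g' s_def[symmetric] field_simps)
  have "(\<Sum>i<N. kquad k Y (\<lambda>z. moebius i0 \<alpha> \<phi> i z * g' z)) \<le> kquad k Y g'"
    by (rule row_contrD[OF row])
  then have "kquad k Y (\<lambda>z. (\<phi> i0 z * g z + (-\<alpha>) * g z) / of_real s)
      + (\<Sum>i\<in>{..<N}-{i0}. kquad k Y (\<lambda>z. \<phi> i z * g z)) \<le> kquad k Y (\<lambda>z. (g z + cnj (-\<alpha>) * (\<phi> i0 z * g z)) / of_real s)"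
    unfolding rm 1 using 2 by (simp add: g'_def[abs_def])
  then show "(\<Sum>i<N. kquad k Y (\<lambda>z. \<phi> i z * g z)) \<le> kquad k Y g"
    using kquad_hyperbolic[of "-\<alpha>" s g "\<lambda>z. \<phi> i0 z * g z"] a unfolding rm by (simp add: s_def)
qed

end

text \<open>For each base point \<open>p\<close> the matrix
  \<open>1 - k z p * k p w / (k p p * k z w)\<close> is the Gram matrix of \<open>b\<close>; this is
  the McCullough-Quiggin condition. Every point may serve as base, since points are added in turn
  and the backward shift removes zeros at arbitrary points.\<close>

locale pick_kernel = pos_kernel +
  assumes nonzero: "z \<in> Y \<Longrightarrow> w \<in> Y \<Longrightarrow> k z w \<noteq> 0"
    and pick: "p \<in> Y \<Longrightarrow> \<exists>(m::nat) b. \<forall>z\<in>Y. \<forall>w\<in>Y.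
      k z w = k z p * k p w / k p p + k z w * (\<Sum>j<m. b j z * cnj (b j w))"
begin

lemma diag: "p \<in> Y \<Longrightarrow> k p p = of_real (Re (k p p))" "p \<in> Y \<Longrightarrow> 0 < Re (k p p)"
proof -
  assume p: "p \<in> Y"
  show "k p p = of_real (Re (k p p))" using herm[OF p p] by (simp add: complex_eq_iff)
  then show "0 < Re (k p p)" using nonzero[OF p p] diag_nonneg[OF p] by (metis of_real_0 order_le_less)
qed

lemma pick_subset: "Y' \<subseteq> Y \<Longrightarrow> pick_kernel k Y'"
proof -
  assume Y': "Y' \<subseteq> Y"
  interpret Y': pos_kernel k Y' by (rule subset[OF Y'])
  show ?thesis
  proof
    show "k z w \<noteq> 0" if "z \<in> Y'" "w \<in> Y'" for z w using nonzero that Y' by blast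
    show "\<exists>(m::nat) b. \<forall>z\<in>Y'. \<forall>w\<in>Y'. k z w = k z p * k p w / k p p + k z w * (\<Sum>j<m. b j z * cnj (b j w))"
      if "p \<in> Y'" for p
      using pick[of p] that Y' by (meson subsetD)
  qed
qed

text \<open>The first summand of the form is the component along the kernel function of
  \<open>p\<close>. What is left is the kernel of the functions vanishing at \<open>p\<close>, which
  is \<open>k\<close> times the Gram matrix of \<open>b\<close>. On the diagonal the identity
  determines the size of \<open>b\<close>.\<close>

lemma pick_decomposition:
  assumes p: "p \<in> Y"
  shows "\<exists>(m::nat) b.
    (\<forall>z\<in>Y. \<forall>w\<in>Y. k z w = k z p * k p w / k p p + k z w * (\<Sum>j<m. b j z * cnj (b j w))) \<and>
    (\<forall>h. kquad k Y h = (cmod (\<Sum>z\<in>Y. k z p * h z))\<^sup>2 / Re (k p p) + (\<Sum>j<m. kquad k Y (\<lambda>z. b j z * h z))) \<and>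
    (\<forall>j<m. b j p = 0) \<and> (\<forall>z\<in>Y. (\<Sum>j<m. (cmod (b j z))\<^sup>2) < 1)"
proof -
  obtain m :: nat and b where b: "\<And>z w. z \<in> Y \<Longrightarrow> w \<in> Y \<Longrightarrow>
      k z w = k z p * k p w / k p p + k z w * (\<Sum>j<m. b j z * cnj (b j w))"
    using pick[OF p] by blast
  define r where "r = sqrt (Re (k p p))"
  have r: "r > 0" "r\<^sup>2 = Re (k p p)" using diag[OF p] by (auto simp: r_def)
  have rr: "complex_of_real r * of_real r = k p p" using diag(1)[OF p] r by (metis of_real_mult power2_eq_square)
  have nsum: "(\<Sum>j<m. b j z * cnj (b j z)) = of_real (\<Sum>j<m. (cmod (b j z))\<^sup>2)" for z
    unfolding of_real_sum complex_norm_square ..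
  have quad: "kquad k Y h = (cmod (\<Sum>z\<in>Y. k z p * h z))\<^sup>2 / Re (k p p) + (\<Sum>j<m. kquad k Y (\<lambda>z. b j z * h z))" for h
  proof -
    have "kform k Y h h = kform (\<lambda>z w. (k z p / of_real r) * cnj (k w p / of_real r) + k z w * (\<Sum>j<m. b j z * cnj (b j w))) Y h h"
    proof (intro kform_cong refl)
      fix z w assume zw: "z \<in> Y" "w \<in> Y"
      have "k p w = cnj (k w p)" using herm[of w p] zw p by simp
      then have "k z p * k p w / k p p = (k z p / of_real r) * cnj (k w p / of_real r)"
        unfolding rr[symmetric] by simp
      with b[OF zw] show "k z w = (k z p / of_real r) * cnj (k w p / of_real r) + k z w * (\<Sum>j<m. b j z * cnj (b j w))"
        by simp
    qed
    then have "kquad k Y h = kquad (\<lambda>z w. (k z p / of_real r) * cnj (k w p / of_real r) + k z w * (\<Sum>j<m. b j z * cnj (b j w))) Y h"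
      by (simp only: kquad_def)
    also have "\<dots> = (cmod (\<Sum>z\<in>Y. (k z p / of_real r) * h z))\<^sup>2 + (\<Sum>j<m. kquad k Y (\<lambda>z. b j z * h z))"
      by (simp only: kquad_kernel_add kquad_rank_one kquad_schur_sum)
    also have "(\<Sum>z\<in>Y. (k z p / of_real r) * h z) = (\<Sum>z\<in>Y. k z p * h z) / of_real r"
      by (simp add: sum_divide_distrib)
    also have "(cmod ((\<Sum>z\<in>Y. k z p * h z) / of_real r))\<^sup>2 = (cmod (\<Sum>z\<in>Y. k z p * h z))\<^sup>2 / Re (k p p)"
      using r by (simp add: norm_divide power_divide)
    finally show ?thesis .
  qed
  have bp: "b j p = 0" if "j < m" for j
  proof -
    have "(\<Sum>j<m. b j p * cnj (b j p)) = 0" using b[OF p p] nonzero[OF p p] by simp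
    then have "(\<Sum>j<m. (cmod (b j p))\<^sup>2) = 0" unfolding nsum using of_real_eq_0_iff by blast
    then show ?thesis using that by (simp add: sum_nonneg_eq_0_iff)
  qed
  have lt: "(\<Sum>j<m. (cmod (b j z))\<^sup>2) < 1" if z: "z \<in> Y" for z
  proof -
    let ?s = "\<Sum>j<m. (cmod (b j z))\<^sup>2"
    have "k p z = cnj (k z p)" using herm[of z p] z p by simp
    then have "k z z = of_real ((cmod (k z p))\<^sup>2) / k p p + k z z * of_real ?s"
      using b[OF z z] unfolding nsum complex_norm_square by (simp only:)
    then have "complex_of_real (Re (k z z)) = of_real ((cmod (k z p))\<^sup>2 / Re (k p p) + Re (k z z) * ?s)"
      using diag(1)[OF z] diag(1)[OF p] by (metis of_real_add of_real_divide of_real_mult)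
    then have "Re (k z z) * (1 - ?s) = (cmod (k z p))\<^sup>2 / Re (k p p)"
      unfolding of_real_eq_iff by (simp add: algebra_simps)
    also have "\<dots> > 0" using diag(2)[OF p] nonzero[OF z p] by simp
    finally show ?thesis using diag(2)[OF z] by (simp add: zero_less_mult_iff)
  qed
  show ?thesis using b quad bp lt by blast
qed

end

lemma kquad_single:
  assumes "finite Y" "p \<in> Y"
  shows "kquad k Y (\<lambda>z. c z * (if z = p then d else 0)) = (cmod (c p * d))\<^sup>2 * Re (k p p)"
proof -
  have "kquad k Y (\<lambda>z. c z * (if z = p then d else 0)) = kquad k Y (\<lambda>z. (c p * d) * (if z = p then 1 else 0))"
    by (rule kquad_cong) auto
  also have "\<dots> = (cmod (c p * d))\<^sup>2 * kquad k Y (\<lambda>z. if z = p then 1 else 0)" by (rule kquad_scale)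
  finally show ?thesis using assms by (simp add: kquad_def kform_delta)
qed

context pick_kernel
begin

text \<open>Testing on point masses at \<open>p\<close> with coefficients
  \<open>cnj (\<phi> i p)\<close> gives \<open>A\<^sup>2 \<le> A\<close> for the sum
  \<open>A\<close> of the squares.\<close>

lemma col_contr_at_point:
  assumes col: "col_contr k Y N \<phi>" and p: "p \<in> Y"
  shows "(\<Sum>i<N. (cmod (\<phi> i p))\<^sup>2) \<le> 1"
proof -
  define A where "A = (\<Sum>i<N. (cmod (\<phi> i p))\<^sup>2)"
  have "kquad k Y (\<lambda>z. \<Sum>i<N. \<phi> i z * (cnj (\<phi> i p) * (if z = p then 1 else 0)))
      \<le> (\<Sum>i<N. kquad k Y (\<lambda>z. cnj (\<phi> i p) * (if z = p then 1 else 0)))"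
    by (rule col_contrD[OF col])
  also have "(\<lambda>z. \<Sum>i<N. \<phi> i z * (cnj (\<phi> i p) * (if z = p then 1 else 0)))
     = (\<lambda>z. of_real A * (if z = p then 1 else 0))"
    unfolding A_def of_real_sum complex_norm_square sum_distrib_right
    by (rule ext) (auto intro!: sum.cong simp: mult.assoc)
  finally have "A\<^sup>2 * Re (k p p) \<le> A * Re (k p p)"
    unfolding kquad_single[OF fin p] by (simp add: A_def[symmetric] sum_distrib_right[symmetric])
  then have "A\<^sup>2 \<le> A" using diag[OF p] by simp
  then have le: "A * A \<le> A" by (simp add: power2_eq_square)
  have "A \<le> 1"
  proof (rule ccontr)
    assume "\<not> A \<le> 1"
    then have "A * 1 < A * A" by (intro mult_strict_left_mono) auto
    with le show False by simp
  qed
  then show ?thesis by (simp add: A_def)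
qed

end

text \<open>A column vanishing at \<open>p\<close> does not see the values of its arguments there.
  They are chosen to cancel the first term of the decomposition at \<open>p\<close>; what remains is
  a column estimate on \<open>Y\<close> relative to \<open>b\<close>, the situation of
  \<open>row_contr_relative\<close>.\<close>

lemma row_contr_of_vanishing:
  assumes "pick_kernel k (insert p Y)" "p \<notin> Y"
    and crp: "column_row k Y" and fact: "approx_factorization k Y"
    and col: "col_contr k (insert p Y) N \<phi>" and van: "\<And>i. i < N \<Longrightarrow> \<phi> i p = 0"
  shows "row_contr k (insert p Y) N \<phi>"
proof -
  interpret P: pick_kernel k "insert p Y" by fact
  have fY: "finite Y" using P.fin by simp
  have red: "kquad k (insert p Y) h = kquad k Y h" if "h p = 0" for h
    unfolding kquad_def by (subst kform_supp[OF P.fin, of Y h h k]) (use that in auto)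
  obtain m :: nat and b where
    quad: "\<And>h. kquad k (insert p Y) h = (cmod (\<Sum>z\<in>insert p Y. k z p * h z))\<^sup>2 / Re (k p p)
        + (\<Sum>j<m. kquad k (insert p Y) (\<lambda>z. b j z * h z))"
    and bp: "\<And>j. j < m \<Longrightarrow> b j p = 0"
    using P.pick_decomposition[OF insertI1] by blast
  have quad': "kquad k (insert p Y) h = (cmod (\<Sum>z\<in>insert p Y. k z p * h z))\<^sup>2 / Re (k p p)
        + (\<Sum>j<m. kquad k Y (\<lambda>z. b j z * h z))" for h
  proof -
    have "(\<Sum>j<m. kquad k (insert p Y) (\<lambda>z. b j z * h z)) = (\<Sum>j<m. kquad k Y (\<lambda>z. b j z * h z))"
      using bp by (intro sum.cong refl red) auto
    then show ?thesis using quad[of h] by metis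
  qed
  have *: "kquad k Y (\<lambda>z. \<Sum>i<N. \<phi> i z * g i z) \<le> (\<Sum>i<N. \<Sum>j<m. kquad k Y (\<lambda>z. b j z * g i z))" for g
  proof -
    define g' where "g' i z = (if z = p then - (\<Sum>z\<in>Y. k z p * g i z) / k p p else g i z)" for i z
    have "(\<Sum>z\<in>Y. k z p * g' i z) = (\<Sum>z\<in>Y. k z p * g i z)" for i
      using assms(2) by (intro sum.cong) (auto simp: g'_def)
    then have "(\<Sum>z\<in>insert p Y. k z p * g' i z) = k p p * g' i p + (\<Sum>z\<in>Y. k z p * g i z)" for i
      using fY assms(2) by simp
    then have z: "(\<Sum>z\<in>insert p Y. k z p * g' i z) = 0" for i
      using P.nonzero[of p p] by (simp add: g'_def)
    have "kquad k Y (\<lambda>z. \<Sum>i<N. \<phi> i z * g i z) = kquad k Y (\<lambda>z. \<Sum>i<N. \<phi> i z * g' i z)"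
      using assms(2) by (intro kquad_cong sum.cong) (auto simp: g'_def)
    also have "\<dots> = kquad k (insert p Y) (\<lambda>z. \<Sum>i<N. \<phi> i z * g' i z)" using van by (subst red) auto
    also have "\<dots> \<le> (\<Sum>i<N. kquad k (insert p Y) (g' i))" by (rule col_contrD[OF col])
    also have "\<dots> = (\<Sum>i<N. \<Sum>j<m. kquad k Y (\<lambda>z. b j z * g' i z))" unfolding quad' z by simp
    also have "\<dots> = (\<Sum>i<N. \<Sum>j<m. kquad k Y (\<lambda>z. b j z * g i z))"
      using assms(2) by (intro kquad_cong sum.cong refl) (auto simp: g'_def)
    finally show ?thesis .
  qed
  show ?thesis unfolding row_contr_def
  proof
    fix g
    have "(\<Sum>i<N. kquad k (insert p Y) (\<lambda>z. \<phi> i z * g z)) = (\<Sum>i<N. kquad k Y (\<lambda>z. \<phi> i z * g z))"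
      using van by (intro sum.cong refl red) auto
    also have "\<dots> \<le> (\<Sum>j<m. kquad k Y (\<lambda>z. b j z * g z))"
      by (rule row_contr_relative[OF crp fact *])
    also have "\<dots> \<le> kquad k (insert p Y) g" unfolding quad'[of g] using P.diag(2)[of p] by simp
    finally show "(\<Sum>i<N. kquad k (insert p Y) (\<lambda>z. \<phi> i z * g z)) \<le> kquad k (insert p Y) g" .
  qed
qed

text \<open>Each Moebius map makes one more value at \<open>p\<close> vanish and rescales the others
  by a common factor. Strictness at \<open>p\<close> keeps \<alpha> in the open disc and is itself
  preserved.\<close>

lemma row_contr_of_strict:
  assumes "pick_kernel k (insert p Y)" "p \<notin> Y"
    and crp: "column_row k Y" and fact: "approx_factorization k Y"
    and "col_contr k (insert p Y) N \<phi>" and "(\<Sum>i<N. (cmod (\<phi> i p))\<^sup>2) < 1"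
    and "card {i. i < N \<and> \<phi> i p \<noteq> 0} = n"
  shows "row_contr k (insert p Y) N \<phi>"
  using assms(5-)
proof (induction n arbitrary: \<phi>)
  case 0
  then have "\<phi> i p = 0" if "i < N" for i using that by auto
  with row_contr_of_vanishing[OF assms(1,2) crp fact 0(1)] show ?case by blast
next
  case (Suc n)
  interpret P: pick_kernel k "insert p Y" by fact
  from Suc.prems(3) obtain i0 where i0: "i0 < N" "\<phi> i0 p \<noteq> 0"
    by (metis (mono_tags, lifting) Collect_empty_eq card.empty nat.distinct(1))
  define \<alpha> where "\<alpha> = \<phi> i0 p"
  have rm: "(\<Sum>i<N. F i) = F i0 + (\<Sum>i\<in>{..<N}-{i0}. F i)" for F :: "nat \<Rightarrow> real"
    using i0 by (intro sum.remove) auto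
  have n0: "0 \<le> (\<Sum>i\<in>{..<N}-{i0}. (cmod (\<phi> i z))\<^sup>2)" for z by (intro sum_nonneg) auto
  have a2: "(cmod \<alpha>)\<^sup>2 < 1" using Suc.prems(2) n0[of p] unfolding rm \<alpha>_def by linarith
  then have a: "cmod \<alpha> < 1" by (simp add: abs_square_less_1)
  have D: "1 - cnj \<alpha> * \<phi> i0 z \<noteq> 0" if "z \<in> insert p Y" for z
  proof
    assume "1 - cnj \<alpha> * \<phi> i0 z = 0"
    then have "cmod (cnj \<alpha> * \<phi> i0 z) = 1" by simp
    moreover have "(cmod (\<phi> i0 z))\<^sup>2 \<le> 1"
      using P.col_contr_at_point[OF Suc.prems(1) that] n0[of z] unfolding rm by linarith
    then have "cmod (\<phi> i0 z) \<le> 1" by (simp add: abs_square_le_1)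
    then have "cmod \<alpha> * cmod (\<phi> i0 z) \<le> cmod \<alpha>" by (simp add: mult_left_le)
    ultimately show False using a by (simp add: norm_mult)
  qed
  let ?t = "moebius i0 \<alpha> \<phi>"
  have col: "col_contr k (insert p Y) N ?t"
    by (intro P.col_contr_moebius i0(1) a D Suc.prems(1))
  have Dp: "1 - cnj \<alpha> * \<phi> i0 p = of_real (1 - (cmod \<alpha>)\<^sup>2)"
    unfolding \<alpha>_def of_real_diff complex_norm_square by (simp add: mult.commute)
  have tp: "?t i p = (if i = i0 then 0 else \<phi> i p / of_real (sqrt (1 - (cmod \<alpha>)\<^sup>2)))" for i
  proof -
    define s where "s = sqrt (1 - (cmod \<alpha>)\<^sup>2)"
    have s: "s > 0" "1 - (cmod \<alpha>)\<^sup>2 = s * s" using a2 by (auto simp: s_def)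
    show ?thesis unfolding moebius_def Dp s_def[symmetric] s(2) using s(1) by (simp add: \<alpha>_def)
  qed
  have "(\<Sum>i<N. (cmod (?t i p))\<^sup>2) = (\<Sum>i\<in>{..<N}-{i0}. (cmod (\<phi> i p))\<^sup>2 / (1 - (cmod \<alpha>)\<^sup>2))"
    unfolding rm tp using a2 by (simp add: norm_divide power_divide)
  also have "\<dots> = (\<Sum>i\<in>{..<N}-{i0}. (cmod (\<phi> i p))\<^sup>2) / (1 - (cmod \<alpha>)\<^sup>2)"
    by (simp add: sum_divide_distrib)
  also have "\<dots> < 1" using Suc.prems(2) a2 unfolding rm \<alpha>_def by (simp add: field_simps)
  finally have strict: "(\<Sum>i<N. (cmod (?t i p))\<^sup>2) < 1" .
  have "{i. i < N \<and> ?t i p \<noteq> 0} = {i. i < N \<and> \<phi> i p \<noteq> 0} - {i0}"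
    using a2 by (auto simp: tp)
  then have "card {i. i < N \<and> ?t i p \<noteq> 0} = n" using Suc.prems(3) i0 by simp
  from Suc.IH[OF col strict this] show ?case
    by (intro P.row_contr_moebius[of i0 N \<alpha> \<phi>] i0(1) a D)
qed

lemma column_row_insert:
  assumes "pick_kernel k (insert p Y)" "p \<notin> Y"
    and crp: "column_row k Y" and fact: "approx_factorization k Y"
  shows "column_row k (insert p Y)"
  unfolding column_row_def
proof (intro allI impI)
  fix N \<phi> assume col: "col_contr k (insert p Y) N \<phi>"
  interpret P: pick_kernel k "insert p Y" by fact
  show "row_contr k (insert p Y) N \<phi>"
    unfolding row_contr_def
  proof (intro allI, rule field_le_mult_one_interval)
    fix g and \<rho> :: real assume \<rho>: "0 < \<rho>" "\<rho> < 1"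
    \<comment> \<open>Shrinking the column by the square root of \<rho> makes its value at
      \<open>p\<close> strictly shorter than 1 and multiplies the quadratic forms by \<rho>.\<close>
    define r where "r = complex_of_real (sqrt \<rho>)"
    have r2: "(cmod r)\<^sup>2 = \<rho>" using \<rho> by (simp add: r_def)
    have "col_contr k (insert p Y) N (\<lambda>i z. r * \<phi> i z)"
      unfolding col_contr_def
    proof
      fix g
      have "kquad k (insert p Y) (\<lambda>z. \<Sum>i<N. r * \<phi> i z * g i z) = kquad k (insert p Y) (\<lambda>z. r * (\<Sum>i<N. \<phi> i z * g i z))"
        by (simp add: sum_distrib_left mult.assoc)
      also have "\<dots> = \<rho> * kquad k (insert p Y) (\<lambda>z. (\<Sum>i<N. \<phi> i z * g i z))" unfolding kquad_scale r2 ..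
      also have "\<dots> \<le> kquad k (insert p Y) (\<lambda>z. (\<Sum>i<N. \<phi> i z * g i z))"
        using \<rho> P.nonneg[of "\<lambda>z. (\<Sum>i<N. \<phi> i z * g i z)"] by (simp add: mult_left_le_one_le)
      also have "\<dots> \<le> (\<Sum>i<N. kquad k (insert p Y) (g i))" by (rule col_contrD[OF col])
      finally show "kquad k (insert p Y) (\<lambda>z. \<Sum>i<N. r * \<phi> i z * g i z) \<le> (\<Sum>i<N. kquad k (insert p Y) (g i))" .
    qed
    moreover have "(\<Sum>i<N. (cmod (r * \<phi> i p))\<^sup>2) < 1"
    proof -
      have "(\<Sum>i<N. (cmod (r * \<phi> i p))\<^sup>2) = \<rho> * (\<Sum>i<N. (cmod (\<phi> i p))\<^sup>2)"
        unfolding norm_mult power_mult_distrib r2 sum_distrib_left ..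
      also have "\<dots> \<le> \<rho> * 1" using P.col_contr_at_point[OF col, of p] \<rho> by (intro mult_left_mono) auto
      finally show ?thesis using \<rho> by simp
    qed
    ultimately have "row_contr k (insert p Y) N (\<lambda>i z. r * \<phi> i z)"
      using row_contr_of_strict[OF assms] by blast
    then have "(\<Sum>i<N. kquad k (insert p Y) (\<lambda>z. r * \<phi> i z * g z)) \<le> kquad k (insert p Y) g"
      unfolding row_contr_def by blast
    then show "\<rho> * (\<Sum>i<N. kquad k (insert p Y) (\<lambda>z. \<phi> i z * g z)) \<le> kquad k (insert p Y) g"
      unfolding sum_distrib_left r2[symmetric] kquad_scale[symmetric] by (simp add: mult.assoc)
  qed
qed

lemma column_row_if_factorization:
  assumes "pick_kernel k Y" and "\<And>Z. Z \<subseteq> Y \<Longrightarrow> approx_factorization k Z"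
  shows "column_row k Y"
proof -
  have "finite Y" using assms(1) by (simp add: pick_kernel_def pos_kernel_def)
  then show ?thesis using assms
  proof (induction Y rule: finite_induct)
    case empty
    show ?case by (simp add: column_row_def row_contr_def kquad_def kform_def)
  next
    case (insert p Y)
    then have "pick_kernel k Y" using pick_kernel.pick_subset by blast
    then have "column_row k Y" using insert by blast
    then show ?case using insert by (intro column_row_insert) auto
  qed
qed

section \<open>Dual kernels and the backward shift\<close>

locale pd_kernel = pos_kernel +
  assumes definite: "kquad k Y h = 0 \<Longrightarrow> z \<in> Y \<Longrightarrow> h z = 0"

lemma kform_zero_left: "(\<And>z. z \<in> Y \<Longrightarrow> g z = 0) \<Longrightarrow> kform k Y g h = 0"
  by (simp add: kform_def)

lemma kform_dual:
  assumes "\<And>z. z \<in> Y \<Longrightarrow> kapply k Y (kapply J Y f) z = f z"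
  shows "kform J Y f f = kform k Y (kapply J Y f) (kapply J Y f)"
  unfolding kform_kapply by (intro sum.cong refl) (simp add: assms mult.commute)

text \<open>The quadratic form of \<open>J\<close> is the squared norm in the space with kernel \<open>k\<close> on \<open>Y\<close>.\<close>

locale dual_kernels = k: pd_kernel k Y + J: pd_kernel J Y
  for k J :: "'x \<Rightarrow> 'x \<Rightarrow> complex" and Y +
  assumes k_J: "z \<in> Y \<Longrightarrow> kapply k Y (kapply J Y f) z = f z"
    and J_k: "z \<in> Y \<Longrightarrow> kapply J Y (kapply k Y f) z = f z"
begin

lemma dual_quad: "kquad J Y f = kquad k Y (kapply J Y f)"
  unfolding kquad_def by (subst kform_dual[OF k_J]) simp_all

lemma dual_quad_apply: "kquad J Y (kapply k Y g) = kquad k Y g"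
  unfolding kquad_def by (subst kform_dual[OF J_k, of g]) simp_all

lemma pairing: "(cmod (\<Sum>z\<in>Y. f z * h z))\<^sup>2 \<le> kquad J Y f * kquad k Y h"
proof -
  have "(\<Sum>z\<in>Y. f z * h z) = (\<Sum>z\<in>Y. h z * kapply k Y (kapply J Y f) z)"
    by (intro sum.cong refl) (simp add: k_J mult.commute)
  also have "\<dots> = kform k Y h (kapply J Y f)" by (rule kform_kapply[symmetric])
  finally show ?thesis using k.kform_cauchy[of h "kapply J Y f"] by (simp add: dual_quad mult.commute)
qed

lemma pairing_le: "cmod (\<Sum>z\<in>Y. f z * h z) \<le> (kquad J Y f + kquad k Y h) / 2"
proof (rule power2_le_imp_le)
  have "kquad J Y f * kquad k Y h \<le> ((kquad J Y f + kquad k Y h) / 2)\<^sup>2"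
    using zero_le_power2[of "kquad J Y f - kquad k Y h"] by (simp add: power2_eq_square field_simps)
  then show "(cmod (\<Sum>z\<in>Y. f z * h z))\<^sup>2 \<le> ((kquad J Y f + kquad k Y h) / 2)\<^sup>2"
    using pairing[of f h] by linarith
qed (use J.nonneg[of f] k.nonneg[of h] in simp)

lemma point_bound:
  assumes "z \<in> Y"
  shows "(cmod (f z))\<^sup>2 \<le> Re (k z z) * kquad J Y f"
  using pairing[of f "\<lambda>w. if w = z then 1 else 0"] sum_delta_mult[OF k.fin assms, of f 1]
    kquad_single[OF k.fin assms, of k "\<lambda>_. 1" 1]
  by (simp add: mult.commute)

text \<open>The hypothesis is contractivity on functions, the conclusion that of the adjoint.
  Pairing \<open>h\<close> with its own function \<open>F\<close> gives its squared norm;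
  \<open>pairing_le\<close> bounds this by half of itself plus half of the right-hand side.\<close>

lemma col_contr_if_dual:
  assumes "\<And>g. (\<Sum>i<N. kquad J Y (\<lambda>z. y i z * g z)) \<le> kquad J Y g"
  shows "col_contr k Y N y"
  unfolding col_contr_def
proof
  fix g
  define h where "h z = (\<Sum>i<N. y i z * g i z)" for z
  define F where "F = kapply k Y h"
  have "complex_of_real (kquad k Y h) = (\<Sum>z\<in>Y. h z * F z)"
    unfolding F_def kform_kapply[symmetric] by (rule k.kform_self[symmetric])
  also have "\<dots> = (\<Sum>i<N. \<Sum>z\<in>Y. (y i z * F z) * g i z)"
    unfolding h_def sum_distrib_right by (subst sum.swap) (simp add: algebra_simps)
  finally have "kquad k Y h = cmod (\<Sum>i<N. \<Sum>z\<in>Y. (y i z * F z) * g i z)"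
    using k.nonneg[of h] by (metis norm_of_real abs_of_nonneg)
  also have "\<dots> \<le> (\<Sum>i<N. cmod (\<Sum>z\<in>Y. (y i z * F z) * g i z))" by (rule norm_sum)
  also have "\<dots> \<le> (\<Sum>i<N. (kquad J Y (\<lambda>z. y i z * F z) + kquad k Y (g i)) / 2)"
    by (intro sum_mono pairing_le)
  also have "\<dots> = ((\<Sum>i<N. kquad J Y (\<lambda>z. y i z * F z)) + (\<Sum>i<N. kquad k Y (g i))) / 2"
    by (simp add: sum_divide_distrib[symmetric] sum.distrib)
  also have "\<dots> \<le> (kquad k Y h + (\<Sum>i<N. kquad k Y (g i))) / 2"
    using assms[of F] unfolding F_def dual_quad_apply by simp
  finally show "kquad k Y (\<lambda>z. \<Sum>i<N. y i z * g i z) \<le> (\<Sum>i<N. kquad k Y (g i))"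
    by (simp add: h_def[abs_def])
qed

end

text \<open>The vectors \<open>j w\<close> solve for the point masses, so \<open>J\<close> is the
  inverse of \<open>k\<close> up to conjugation. The identity \<open>jj\<close> exhibits the entries
  of \<open>J\<close> as values of the form of \<open>k\<close>, which makes \<open>J\<close>
  hermitian.\<close>

lemma (in pd_kernel) dual_exists: "\<exists>J. dual_kernels k J Y"
proof -
  have sol: "\<exists>g. \<forall>z\<in>Y. kapply k Y g z = f z" for f
    using kapply_solvable[OF fin pos_kernel_axioms, of f] definite by (simp add: sum.neutral)
  have "\<forall>w. \<exists>g. \<forall>z\<in>Y. kapply k Y g z = (if z = w then 1 else 0)" by (intro allI sol)
  from choice[OF this] obtain j where
    j: "\<And>w z. z \<in> Y \<Longrightarrow> kapply k Y (j w) z = (if z = w then 1 else 0)"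
    by blast
  define J where "J z w = j w z" for z w
  have kJ: "kapply k Y (kapply J Y f) z = f z" if z: "z \<in> Y" for f z
  proof -
    have "kapply k Y (kapply J Y f) z = (\<Sum>v\<in>Y. \<Sum>w\<in>Y. k z v * cnj (j w v) * f w)"
      unfolding kapply_def J_def by (simp add: sum_distrib_left mult.assoc)
    also have "\<dots> = (\<Sum>w\<in>Y. f w * kapply k Y (j w) z)"
      unfolding kapply_def by (subst sum.swap) (simp add: sum_distrib_left algebra_simps)
    also have "\<dots> = (\<Sum>w\<in>Y. f w * (if w = z then 1 else 0))"
      using z by (intro sum.cong refl) (auto simp: j)
    also have "\<dots> = f z" using sum_delta_mult[OF fin z, of f 1] by simp
    finally show ?thesis .
  qed
  have jj: "kform k Y (j z) (j w) = j z w" if "w \<in> Y" for z w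
  proof -
    have "kform k Y (j z) (j w) = (\<Sum>v\<in>Y. j z v * (if v = w then 1 else 0))"
      unfolding kform_kapply by (intro sum.cong refl) (simp add: j)
    then show ?thesis using sum_delta_mult[OF fin that, of "j z" 1] by simp
  qed
  have quad: "kform J Y f f = kform k Y (kapply J Y f) (kapply J Y f)" for f
    by (rule kform_dual[OF kJ])
  have "pd_kernel J Y"
  proof
    show "finite Y" by (rule fin)
    show "J w z = cnj (J z w)" if "z \<in> Y" "w \<in> Y" for z w
      using kform_cnj[of "j z" "j w"] jj that by (simp add: J_def)
    show "0 \<le> kquad J Y h" for h using nonneg[of "kapply J Y h"] by (simp add: kquad_def quad)
    show "h z = 0" if "kquad J Y h = 0" "z \<in> Y" for h z
    proof -
      have "kquad k Y (kapply J Y h) = 0" using that by (simp add: kquad_def quad)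
      then have "kapply J Y h w = 0" if "w \<in> Y" for w using definite that by blast
      then have "kapply k Y (kapply J Y h) z = 0" by (simp add: kapply_def[of k])
      then show ?thesis using kJ that by simp
    qed
  qed
  moreover have "kapply J Y (kapply k Y g) z = g z" if z: "z \<in> Y" for g z
  proof -
    define d where "d w = kapply J Y (kapply k Y g) w + (-1) * g w" for w
    have "kapply k Y d w = 0" if "w \<in> Y" for w
    proof -
      have "kapply k Y d w = kapply k Y (kapply J Y (kapply k Y g)) w - kapply k Y g w"
        unfolding kapply_def[of k Y d] kapply_def[of k Y g w] kapply_def[of k Y "kapply J Y (kapply k Y g)" w] d_def
        by (simp add: algebra_simps sum_subtractf)
      then show ?thesis using kJ that by simp
    qed
    then have "kquad k Y d = 0" by (simp add: kquad_def kform_kapply)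
    then have "d z = 0" using definite z by blast
    then show ?thesis by (simp add: d_def)
  qed
  ultimately have "dual_kernels k J Y"
    using kJ pd_kernel_axioms by (simp add: dual_kernels_def dual_kernels_axioms_def)
  then show ?thesis by blast
qed

locale dual_pick = dual_kernels k J Y + P: pick_kernel k Y
  for k J :: "'x \<Rightarrow> 'x \<Rightarrow> complex" and Y
begin

text \<open>With \<open>b\<close> from the decomposition at \<open>q\<close>, multiplication by the
  row \<open>b\<close> reaches every function vanishing at \<open>q\<close>. Its adjoint supplies
  \<open>g\<close>, and it preserves the norm of such \<open>f\<close> because the evaluation term
  in the decomposition is \<open>f q\<close> up to conjugation.\<close>

lemma backward_shift:
  assumes q: "q \<in> Y"
  shows "\<exists>(m::nat) b. (\<forall>z\<in>Y. (\<Sum>j<m. (cmod (b j z))\<^sup>2) < 1) \<and>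
    (\<forall>h. kquad J Y (\<lambda>z. \<Sum>j<m. b j z * h j z) \<le> (\<Sum>j<m. kquad J Y (h j))) \<and>
    (\<forall>f. f q = 0 \<longrightarrow> (\<exists>g. (\<forall>z\<in>Y. f z = (\<Sum>j<m. b j z * g j z)) \<and> (\<Sum>j<m. kquad J Y (g j)) = kquad J Y f))"
proof -
  obtain m :: nat and b where
    dec: "\<And>z w. z \<in> Y \<Longrightarrow> w \<in> Y \<Longrightarrow> k z w = k z q * k q w / k q q + k z w * (\<Sum>j<m. b j z * cnj (b j w))"
    and quad: "\<And>h. kquad k Y h = (cmod (\<Sum>z\<in>Y. k z q * h z))\<^sup>2 / Re (k q q) + (\<Sum>j<m. kquad k Y (\<lambda>z. b j z * h z))"
    and lt: "\<And>z. z \<in> Y \<Longrightarrow> (\<Sum>j<m. (cmod (b j z))\<^sup>2) < 1"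
    using P.pick_decomposition[OF q] by blast
  \<comment> \<open>With \<open>k\<close> and \<open>J\<close> exchanged, \<open>col_contr\<close>
    is a statement about functions: the row \<open>b\<close> is contractive.\<close>
  interpret S: dual_kernels J k Y
    by unfold_locales (use J_k k_J in auto)
  have "col_contr J Y m b"
  proof (rule S.col_contr_if_dual)
    show "(\<Sum>j<m. kquad k Y (\<lambda>z. b j z * a z)) \<le> kquad k Y a" for a
      unfolding quad[of a] using P.diag(2)[OF q] by simp
  qed
  then have row: "kquad J Y (\<lambda>z. \<Sum>j<m. b j z * h j z) \<le> (\<Sum>j<m. kquad J Y (h j))" for h
    by (rule col_contrD)
  have shift: "\<exists>g. (\<forall>z\<in>Y. f z = (\<Sum>j<m. b j z * g j z)) \<and> (\<Sum>j<m. kquad J Y (g j)) = kquad J Y f"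
    if fq: "f q = 0" for f
  proof -
    define a where "a = kapply J Y f"
    define g where "g j = kapply k Y (\<lambda>z. b j z * a z)" for j
    have fa: "f z = (\<Sum>w\<in>Y. k z w * cnj (a w))" if "z \<in> Y" for z
      using k_J[OF that, of f] by (simp add: a_def kapply_def[of k])
    have "f z = (\<Sum>j<m. b j z * g j z)" if z: "z \<in> Y" for z
    proof -
      have "(\<Sum>j<m. b j z * g j z) = (\<Sum>w\<in>Y. (k z w * (\<Sum>j<m. b j z * cnj (b j w))) * cnj (a w))"
        unfolding g_def kapply_def sum_distrib_left sum_distrib_right
        by (subst sum.swap) (simp add: algebra_simps)
      also have "\<dots> = (\<Sum>w\<in>Y. k z w * cnj (a w) - k z q / k q q * (k q w * cnj (a w)))"
      proof (intro sum.cong refl)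
        fix w assume w: "w \<in> Y"
        have eq: "k z w * (\<Sum>j<m. b j z * cnj (b j w)) = k z w - k z q * k q w / k q q"
          using dec[OF z w] by (metis add_diff_cancel_left')
        show "(k z w * (\<Sum>j<m. b j z * cnj (b j w))) * cnj (a w) = k z w * cnj (a w) - k z q / k q q * (k q w * cnj (a w))"
          unfolding eq by (simp add: left_diff_distrib)
      qed
      also have "\<dots> = f z - k z q / k q q * f q"
        unfolding sum_subtractf sum_distrib_left[symmetric] fa[OF z] fa[OF q] ..
      finally show ?thesis using fq by simp
    qed
    moreover have "(\<Sum>j<m. kquad J Y (g j)) = kquad J Y f"
    proof -
      have "cnj (\<Sum>z\<in>Y. k z q * a z) = f q"
        unfolding fa[OF q] cnj_sum using k.herm q by (intro sum.cong refl) (metis complex_cnj_mult)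
      then have "(\<Sum>z\<in>Y. k z q * a z) = 0" using fq by (metis complex_cnj_zero_iff)
      then show ?thesis using quad[of a] by (simp add: g_def dual_quad_apply dual_quad[of f] a_def)
    qed
    ultimately show ?thesis by blast
  qed
  show ?thesis using row lt shift by blast
qed

end

lemma cmod_sum_mult_sq_le:
  "(cmod (\<Sum>j\<in>I. b j * g j))\<^sup>2 \<le> (\<Sum>j\<in>I. (cmod (b j))\<^sup>2) * (\<Sum>j\<in>I. (cmod (g j))\<^sup>2)"
proof -
  have "cmod (\<Sum>j\<in>I. b j * g j) \<le> (\<Sum>j\<in>I. cmod (b j) * cmod (g j))"
    by (rule order_trans[OF norm_sum]) (simp add: norm_mult)
  then have "(cmod (\<Sum>j\<in>I. b j * g j))\<^sup>2 \<le> (\<Sum>j\<in>I. cmod (b j) * cmod (g j))\<^sup>2" by (intro power_mono) auto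
  then show ?thesis using Cauchy_Schwarz_ineq_sum[of "\<lambda>j. cmod (b j)" "\<lambda>j. cmod (g j)" I] by (rule order_trans)
qed

text \<open>The form of the extremal problem below. Its null vectors play the role of outer
  functions.\<close>

locale extremal_form = dual_pick k J Y
  for k J :: "'x \<Rightarrow> 'x \<Rightarrow> complex" and Y +
  fixes N :: nat and p :: "nat \<Rightarrow> 'x \<Rightarrow> complex" and \<mu> \<epsilon> :: real and x0 :: 'x
  assumes x0: "x0 \<in> Y" and eps: "\<epsilon> > 0"
    and pos: "\<And>f. (\<Sum>n<N. kquad J Y (\<lambda>z. p n z * f z)) + \<epsilon> * (cmod (f x0))\<^sup>2 \<le> \<mu> * kquad J Y f"
begin

definition \<Phi> :: "('x \<Rightarrow> complex) \<Rightarrow> real" where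
  "\<Phi> f = \<mu> * kquad J Y f - (\<Sum>n<N. kquad J Y (\<lambda>z. p n z * f z)) - \<epsilon> * (cmod (f x0))\<^sup>2"

lemma \<Phi>_nonneg: "0 \<le> \<Phi> f"
  using pos[of f] by (simp add: \<Phi>_def)

lemma \<Phi>_parallelogram: "\<Phi> (\<lambda>z. f z + g z) + \<Phi> (\<lambda>z. f z - g z) = 2 * \<Phi> f + 2 * \<Phi> g"
proof -
  have 1: "kquad J Y (\<lambda>z. p n z * (f z + g z)) + kquad J Y (\<lambda>z. p n z * (f z - g z))
    = 2 * kquad J Y (\<lambda>z. p n z * f z) + 2 * kquad J Y (\<lambda>z. p n z * g z)" for n
    using J.kquad_parallelogram[of "\<lambda>z. p n z * f z" "\<lambda>z. p n z * g z"] by (simp add: algebra_simps)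
  have 2: "(\<Sum>n<N. kquad J Y (\<lambda>z. p n z * (f z + g z))) + (\<Sum>n<N. kquad J Y (\<lambda>z. p n z * (f z - g z)))
    = 2 * (\<Sum>n<N. kquad J Y (\<lambda>z. p n z * f z)) + 2 * (\<Sum>n<N. kquad J Y (\<lambda>z. p n z * g z))"
    unfolding sum.distrib[symmetric] 1 by (simp add: sum_distrib_left sum.distrib)
  have 3: "(cmod (f x0 + g x0))\<^sup>2 + (cmod (f x0 - g x0))\<^sup>2 = 2 * (cmod (f x0))\<^sup>2 + 2 * (cmod (g x0))\<^sup>2"
    unfolding cmod_power2 by (simp add: power2_eq_square algebra_simps)
  have "\<Phi> (\<lambda>z. f z + g z) + \<Phi> (\<lambda>z. f z - g z) =
    \<mu> * (kquad J Y (\<lambda>z. f z + g z) + kquad J Y (\<lambda>z. f z - g z))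
    - ((\<Sum>n<N. kquad J Y (\<lambda>z. p n z * (f z + g z))) + (\<Sum>n<N. kquad J Y (\<lambda>z. p n z * (f z - g z))))
    - \<epsilon> * ((cmod (f x0 + g x0))\<^sup>2 + (cmod (f x0 - g x0))\<^sup>2)"
    by (simp add: \<Phi>_def algebra_simps)
  then show ?thesis unfolding 2 3 J.kquad_parallelogram by (simp add: \<Phi>_def algebra_simps)
qed

lemma \<Phi>_scale: "\<Phi> (\<lambda>z. c * f z) = (cmod c)\<^sup>2 * \<Phi> f"
proof -
  have "kquad J Y (\<lambda>z. p n z * (c * f z)) = (cmod c)\<^sup>2 * kquad J Y (\<lambda>z. p n z * f z)" for n
    using kquad_scale[of J Y c "\<lambda>z. p n z * f z"] by (simp add: algebra_simps)
  then show ?thesis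
    by (simp add: \<Phi>_def kquad_scale sum_distrib_left[symmetric] norm_mult power_mult_distrib algebra_simps)
qed

lemma \<Phi>_null_add:
  assumes "\<Phi> f = 0" "\<Phi> g = 0"
  shows "\<Phi> (\<lambda>z. f z + c * g z) = 0"
  using \<Phi>_parallelogram[of f "\<lambda>z. c * g z"] \<Phi>_scale[of c g] assms
    \<Phi>_nonneg[of "\<lambda>z. f z + c * g z"] \<Phi>_nonneg[of "\<lambda>z. f z - c * g z"] by simp

text \<open>Passing from \<open>f\<close> to its shift \<open>g\<close> keeps the total norm and,
  since the contractive row \<open>b\<close> commutes with the \<open>p n\<close>, does not decrease
  the sum over \<open>n\<close>. The perturbation strictly gains because the row is strictly
  contractive at \<open>x0\<close>. A null vector therefore has only null shifts, and these vanish
  at \<open>x0\<close>.\<close>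

lemma null_shift:
  assumes b: "\<And>z. z \<in> Y \<Longrightarrow> (\<Sum>j<m. (cmod (b j z))\<^sup>2) < 1"
    and row: "\<And>h. kquad J Y (\<lambda>z. \<Sum>j<m. b j z * h j z) \<le> (\<Sum>j<m. kquad J Y (h j))"
    and f: "\<Phi> f = 0" "\<And>z. z \<in> Y \<Longrightarrow> f z = (\<Sum>j<m. b j z * g j z)" "(\<Sum>j<m. kquad J Y (g j)) = kquad J Y f"
    and j: "j < (m::nat)"
  shows "\<Phi> (g j) = 0" "g j x0 = 0"
proof -
  define \<beta> where "\<beta> = (\<Sum>j<m. (cmod (b j x0))\<^sup>2)"
  have \<beta>: "\<beta> < 1" using b[OF x0] by (simp add: \<beta>_def)
  define s where "s = (\<Sum>j<m. (cmod (g j x0))\<^sup>2)"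
  have s0: "0 \<le> s" by (simp add: s_def sum_nonneg)
  have 1: "(cmod (f x0))\<^sup>2 \<le> \<beta> * s"
    unfolding f(2)[OF x0] \<beta>_def s_def by (rule cmod_sum_mult_sq_le)
  have "(\<Sum>n<N. kquad J Y (\<lambda>z. p n z * f z)) \<le> (\<Sum>n<N. \<Sum>j<m. kquad J Y (\<lambda>z. p n z * g j z))"
  proof (intro sum_mono)
    fix n
    have "kquad J Y (\<lambda>z. p n z * f z) = kquad J Y (\<lambda>z. \<Sum>j<m. b j z * (p n z * g j z))"
      by (rule kquad_cong) (simp add: f(2) sum_distrib_left algebra_simps)
    also have "\<dots> \<le> (\<Sum>j<m. kquad J Y (\<lambda>z. p n z * g j z))" by (rule row)
    finally show "kquad J Y (\<lambda>z. p n z * f z) \<le> (\<Sum>j<m. kquad J Y (\<lambda>z. p n z * g j z))" .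
  qed
  also have "\<dots> = (\<Sum>j<m. \<Sum>n<N. kquad J Y (\<lambda>z. p n z * g j z))" by (rule sum.swap)
  finally have 2: "(\<Sum>n<N. kquad J Y (\<lambda>z. p n z * f z)) \<le> (\<Sum>j<m. \<Sum>n<N. kquad J Y (\<lambda>z. p n z * g j z))" .
  have "(\<Sum>j<m. \<Phi> (g j)) = \<mu> * kquad J Y f - (\<Sum>j<m. \<Sum>n<N. kquad J Y (\<lambda>z. p n z * g j z)) - \<epsilon> * s"
    unfolding \<Phi>_def sum_subtractf f(3)[symmetric] s_def by (simp add: sum_distrib_left)
  also have "\<dots> \<le> \<epsilon> * (cmod (f x0))\<^sup>2 - \<epsilon> * s" using f(1) 2 by (simp add: \<Phi>_def)
  also have "\<dots> \<le> \<epsilon> * (\<beta> * s) - \<epsilon> * s" using 1 eps by simp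
  finally have le: "(\<Sum>j<m. \<Phi> (g j)) + \<epsilon> * ((1 - \<beta>) * s) \<le> 0" by (simp add: algebra_simps)
  have nn: "0 \<le> (\<Sum>j<m. \<Phi> (g j))" "0 \<le> \<epsilon> * ((1 - \<beta>) * s)"
    using \<Phi>_nonneg eps \<beta> s0 by (auto intro!: sum_nonneg)
  have "(\<Sum>j<m. \<Phi> (g j)) = 0" using le nn by linarith
  then show "\<Phi> (g j) = 0" using \<Phi>_nonneg j by (simp add: sum_nonneg_eq_0_iff)
  have "\<epsilon> * ((1 - \<beta>) * s) = 0" using le nn by linarith
  then have "s = 0" using eps \<beta> by simp
  then show "g j x0 = 0" using j unfolding s_def by (simp add: sum_nonneg_eq_0_iff)
qed

text \<open>The shift at \<open>x0\<close> can be repeated, because by \<open>null_shift\<close> its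
  pieces are again null and vanish at \<open>x0\<close>. Each repetition gains a factor \<beta>
  below 1 in the value at \<open>z\<close>, while the total norm stays the same.\<close>

lemma null_vanishing_at_base:
  assumes "\<Phi> f = 0" "f x0 = 0" and z: "z \<in> Y"
  shows "f z = 0"
proof -
  obtain m :: nat and b where b: "\<And>z. z \<in> Y \<Longrightarrow> (\<Sum>j<m. (cmod (b j z))\<^sup>2) < 1"
    and row: "\<And>h. kquad J Y (\<lambda>z. \<Sum>j<m. b j z * h j z) \<le> (\<Sum>j<m. kquad J Y (h j))"
    and shift: "\<And>f. f x0 = 0 \<Longrightarrow> \<exists>g. (\<forall>z\<in>Y. f z = (\<Sum>j<m. b j z * g j z)) \<and> (\<Sum>j<m. kquad J Y (g j)) = kquad J Y f"
    using backward_shift[OF x0] by blast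
  define \<beta> where "\<beta> = (\<Sum>j<m. (cmod (b j z))\<^sup>2)"
  have \<beta>: "0 \<le> \<beta>" "\<beta> < 1" using b[OF z] by (auto simp: \<beta>_def sum_nonneg)
  have bound: "(cmod (f z))\<^sup>2 \<le> \<beta> ^ n * (Re (k z z) * kquad J Y f)" if "\<Phi> f = 0" "f x0 = 0" for n f
    using that
  proof (induction n arbitrary: f)
    case 0
    then show ?case using point_bound[OF z] by simp
  next
    case (Suc n)
    obtain g where g: "\<And>z. z \<in> Y \<Longrightarrow> f z = (\<Sum>j<m. b j z * g j z)"
      and gs: "(\<Sum>j<m. kquad J Y (g j)) = kquad J Y f"
      using shift[of f] Suc.prems(2) by blast
    have gj: "\<Phi> (g j) = 0" "g j x0 = 0" if "j < m" for j
      using null_shift[OF b row Suc.prems(1) g gs that] by blast+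
    have "(cmod (f z))\<^sup>2 \<le> \<beta> * (\<Sum>j<m. (cmod (g j z))\<^sup>2)"
      unfolding g[OF z] \<beta>_def by (rule cmod_sum_mult_sq_le)
    also have "\<dots> \<le> \<beta> * (\<Sum>j<m. \<beta> ^ n * (Re (k z z) * kquad J Y (g j)))"
      using Suc.IH gj \<beta> by (intro mult_left_mono sum_mono) auto
    also have "\<dots> = \<beta> ^ Suc n * (Re (k z z) * kquad J Y f)"
      unfolding gs[symmetric] by (simp add: sum_distrib_left algebra_simps)
    finally show ?case .
  qed
  have "(\<lambda>n. \<beta> ^ n * (Re (k z z) * kquad J Y f)) \<longlonglongrightarrow> 0 * (Re (k z z) * kquad J Y f)"
    by (intro tendsto_mult_right LIMSEQ_power_zero) (use \<beta> in simp)
  then have "(cmod (f z))\<^sup>2 \<le> 0" using bound[OF assms(1,2)] by (intro LIMSEQ_le_const) auto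
  then show ?thesis by simp
qed

lemma null_vanishing:
  assumes "\<Phi> f = 0" "f q = 0" "q \<in> Y" "z \<in> Y"
  shows "f z = 0"
proof -
  obtain m :: nat and b where b: "\<And>z. z \<in> Y \<Longrightarrow> (\<Sum>j<m. (cmod (b j z))\<^sup>2) < 1"
    and row: "\<And>h. kquad J Y (\<lambda>z. \<Sum>j<m. b j z * h j z) \<le> (\<Sum>j<m. kquad J Y (h j))"
    and shift: "\<And>f. f q = 0 \<Longrightarrow> \<exists>g. (\<forall>z\<in>Y. f z = (\<Sum>j<m. b j z * g j z)) \<and> (\<Sum>j<m. kquad J Y (g j)) = kquad J Y f"
    using backward_shift[OF assms(3)] by blast
  obtain g where g: "\<And>z. z \<in> Y \<Longrightarrow> f z = (\<Sum>j<m. b j z * g j z)"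
    and gs: "(\<Sum>j<m. kquad J Y (g j)) = kquad J Y f"
    using shift[of f] assms(2) by blast
  have "g j z = 0" if "j < m" for j
    using null_shift[OF b row assms(1) g gs that] null_vanishing_at_base assms(4) by blast
  then show ?thesis using g[OF assms(4)] by simp
qed

lemma null_unique:
  assumes F: "\<Phi> F = 0" "kquad J Y F = 1" and G: "\<Phi> G = 0" "kquad J Y G = 1"
  shows "\<exists>c. cmod c = 1 \<and> (\<forall>z\<in>Y. G z = c * F z)"
proof -
  have F0: "F x0 \<noteq> 0"
  proof
    assume "F x0 = 0"
    then have "\<And>z. z \<in> Y \<Longrightarrow> F z = 0" using null_vanishing_at_base F by blast
    then have "kform J Y F F = 0" by (rule kform_zero_left)
    then show False using F(2) by (simp add: kquad_def)
  qed
  define c where "c = G x0 / F x0"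
  have "G z + (-c) * F z = 0" if "z \<in> Y" for z
    using null_vanishing_at_base[OF \<Phi>_null_add[OF G(1) F(1), of "-c"] _ that] F0 by (simp add: c_def)
  then have eq: "G z = c * F z" if "z \<in> Y" for z using that by (simp add: eq_neg_iff_add_eq_0)
  have "1 = kquad J Y (\<lambda>z. c * F z)" using G(2) kquad_cong[of Y G "\<lambda>z. c * F z" J] eq by simp
  also have "\<dots> = (cmod c)\<^sup>2" using F(2) by (simp add: kquad_scale)
  finally have "cmod c = 1" using power2_eq_iff_nonneg[of "cmod c" 1] by simp
  then show ?thesis using eq by blast
qed

end

section \<open>The extremal problem\<close>

text \<open>Functions are indexed by a whole type, possibly infinite, although the data live on
  finite sets. Compactness of boxes is then Tychonoff's theorem for pointwise convergence.\<close>

lemma compact_box: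
  fixes R :: "'a \<Rightarrow> real"
  shows "compact {f :: 'a \<Rightarrow> complex. \<forall>x. cmod (f x) \<le> R x}"
proof -
  have "compactin (product_topology (\<lambda>x. euclidean) UNIV) (PiE UNIV (\<lambda>x. cball (0::complex) (R x)))"
    by (subst compactin_PiE) auto
  moreover have "PiE UNIV (\<lambda>x. cball (0::complex) (R x)) = {f. \<forall>x. cmod (f x) \<le> R x}"
    by (auto simp: PiE_UNIV_domain)
  ultimately show ?thesis by (simp add: euclidean_product_topology)
qed

lemma continuous_on_coordinate: "continuous_on S (\<lambda>f :: 'a \<Rightarrow> complex. f z)"
  by (rule continuous_on_product_then_coordinatewise) (rule continuous_on_id)

lemma continuous_on_kquad: "continuous_on S (kquad k Y)"
  unfolding kquad_def[abs_def] kform_def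
  by (intro continuous_intros continuous_on_coordinate)

text \<open>If \<open>P\<close> is the Gram matrix of the \<open>p n\<close>, the form of
  \<open>hadamard J P\<close> at \<open>F\<close> is the sum of the squared norms of the functions
  \<open>p n z * F z\<close>. These sums thus depend linearly on \<open>P\<close>, which makes the
  extremal problem convex.\<close>

definition hadamard :: "('x \<Rightarrow> 'x \<Rightarrow> complex) \<Rightarrow> ('x \<Rightarrow> 'x \<Rightarrow> complex) \<Rightarrow> 'x \<Rightarrow> 'x \<Rightarrow> complex" where
  "hadamard k P z w = k z w * P z w"

lemma kquad_hadamard_gram:
  assumes "\<And>z w. z \<in> Y \<Longrightarrow> w \<in> Y \<Longrightarrow> P z w = (\<Sum>n\<in>I. p n z * cnj (p n w))"
  shows "kquad (hadamard k P) Y F = (\<Sum>n\<in>I. kquad k Y (\<lambda>z. p n z * F z))"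
proof -
  have "kquad (hadamard k P) Y F = kquad (\<lambda>z w. k z w * (\<Sum>n\<in>I. p n z * cnj (p n w))) Y F"
    unfolding kquad_def by (rule arg_cong[where f=Re], rule kform_cong) (auto simp: hadamard_def assms)
  then show ?thesis by (simp add: kquad_schur_sum)
qed

lemma kquad_hadamard_lin:
  "kquad (hadamard k (\<lambda>z w. complex_of_real s * P z w + complex_of_real t * Q z w)) Y F
    = s * kquad (hadamard k P) Y F + t * kquad (hadamard k Q) Y F"
proof -
  have "kform (hadamard k (\<lambda>z w. of_real s * P z w + of_real t * Q z w)) Y F F
    = of_real s * kform (hadamard k P) Y F F + of_real t * kform (hadamard k Q) Y F F"
    by (simp add: kform_def hadamard_def sum_distrib_left algebra_simps sum.distrib)
  then show ?thesis by (simp add: kquad_def)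
qed

text \<open>A matrix is represented by the family \<open>P\<close> of its entries and possibly further data; \<open>e z w\<close> is the
  index of the entry at \<open>(z, w)\<close>.\<close>

locale extremal_problem = dual_pick k J Y
  for k J :: "'x \<Rightarrow> 'x \<Rightarrow> complex" and Y +
  fixes \<P> :: "('z \<Rightarrow> complex) set" and e :: "'x \<Rightarrow> 'x \<Rightarrow> 'z"
    and L :: "'x \<Rightarrow> 'x \<Rightarrow> complex" and \<epsilon> \<kappa> :: real and x0 :: 'x
  assumes x0: "x0 \<in> Y" and eps: "\<epsilon> > 0" and kappa: "\<kappa> < 1"
    and nonempty: "\<P> \<noteq> {}" and closed: "closed \<P>"
    and convex: "P \<in> \<P> \<Longrightarrow> Q \<in> \<P> \<Longrightarrow> 0 \<le> t \<Longrightarrow> t \<le> 1 \<Longrightarrow>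
      (\<lambda>x. complex_of_real (1 - t) * P x + complex_of_real t * Q x) \<in> \<P>"
    and psd: "P \<in> \<P> \<Longrightarrow> pos_kernel (\<lambda>z w. P (e z w)) Y"
    and bounded: "P \<in> \<P> \<Longrightarrow> (\<And>z. z \<in> Y \<Longrightarrow> Re (P (e z z)) \<le> \<mu>) \<Longrightarrow> cmod (P x) \<le> \<mu>"
    and coercive: "P \<in> \<P> \<Longrightarrow>
      (\<And>F. kquad (hadamard J (\<lambda>z w. P (e z w))) Y F + \<epsilon> * (cmod (F x0))\<^sup>2 \<le> \<mu> * kquad J Y F) \<Longrightarrow>
      Re (\<Sum>z\<in>Y. \<Sum>w\<in>Y. L z w * P (e z w)) \<le> \<kappa> * \<mu>"
begin

definition B :: "('z \<Rightarrow> complex) \<Rightarrow> ('x \<Rightarrow> complex) \<Rightarrow> real" where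
  "B P F = kquad (hadamard J (\<lambda>z w. P (e z w))) Y F"

definition lfun :: "('z \<Rightarrow> complex) \<Rightarrow> real" where
  "lfun P = Re (\<Sum>z\<in>Y. \<Sum>w\<in>Y. L z w * P (e z w))"

definition \<Psi> :: "real \<Rightarrow> ('z \<Rightarrow> complex) \<Rightarrow> ('x \<Rightarrow> complex) \<Rightarrow> real" where
  "\<Psi> \<mu> P F = \<mu> * kquad J Y F - B P F - \<epsilon> * (cmod (F x0))\<^sup>2"

definition sphere :: "('x \<Rightarrow> complex) set" where
  "sphere = {F. (\<forall>x. x \<notin> Y \<longrightarrow> F x = 0) \<and> kquad J Y F = 1}"

lemma lfun_lin: "lfun (\<lambda>x. complex_of_real s * P x + complex_of_real t * Q x) = s * lfun P + t * lfun Q"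
proof -
  have "(\<Sum>z\<in>Y. \<Sum>w\<in>Y. L z w * (complex_of_real s * P (e z w) + complex_of_real t * Q (e z w)))
     = of_real s * (\<Sum>z\<in>Y. \<Sum>w\<in>Y. L z w * P (e z w)) + of_real t * (\<Sum>z\<in>Y. \<Sum>w\<in>Y. L z w * Q (e z w))"
    by (simp add: sum_distrib_left algebra_simps sum.distrib)
  then show ?thesis by (simp add: lfun_def)
qed

lemma gram:
  assumes "P \<in> \<P>"
  shows "\<exists>(N::nat) p. (\<forall>z\<in>Y. \<forall>w\<in>Y. P (e z w) = (\<Sum>n<N. p n z * cnj (p n w)))
    \<and> (\<forall>F. B P F = (\<Sum>n<N. kquad J Y (\<lambda>z. p n z * F z)))"
proof -
  obtain N :: nat and p where p: "\<And>z w. z \<in> Y \<Longrightarrow> w \<in> Y \<Longrightarrow> P (e z w) = (\<Sum>n<N. p n z * cnj (p n w))"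
    using pos_kernel_gram[OF k.fin psd[OF assms]] by blast
  then show ?thesis unfolding B_def using kquad_hadamard_gram[of Y "\<lambda>z w. P (e z w)" p "{..<N}" J] by blast
qed

lemma B_nonneg: "P \<in> \<P> \<Longrightarrow> 0 \<le> B P F"
  using gram[of P] by (auto intro!: sum_nonneg J.nonneg)

lemma \<Psi>_scale: "\<Psi> \<mu> P (\<lambda>z. c * F z) = (cmod c)\<^sup>2 * \<Psi> \<mu> P F"
  unfolding \<Psi>_def B_def kquad_scale norm_mult power_mult_distrib by (simp add: algebra_simps)

lemma \<Psi>_cong: "(\<And>z. z \<in> Y \<Longrightarrow> F z = G z) \<Longrightarrow> \<Psi> \<mu> P F = \<Psi> \<mu> P G"
  unfolding \<Psi>_def B_def using x0 kquad_cong[of Y F G] by simp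

lemma \<Psi>_normalize:
  assumes "\<exists>z\<in>Y. F z \<noteq> 0"
  shows "\<exists>G\<in>sphere. \<Psi> \<mu> P F = kquad J Y F * \<Psi> \<mu> P G"
proof -
  define q where "q = kquad J Y F"
  have q: "q > 0" using assms J.nonneg[of F] J.definite[of F] by (auto simp: q_def order_le_less)
  define G where "G z = (if z \<in> Y then of_real (1 / sqrt q) * F z else 0)" for z
  have "kquad J Y G = kquad J Y (\<lambda>z. of_real (1 / sqrt q) * F z)" by (rule kquad_cong) (simp add: G_def)
  also have "\<dots> = 1" using q unfolding kquad_scale q_def[symmetric] by (simp add: norm_divide power_divide)
  finally have "G \<in> sphere" by (simp add: sphere_def G_def)
  moreover have "\<Psi> \<mu> P F = \<Psi> \<mu> P (\<lambda>z. of_real (sqrt q) * G z)"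
    using q by (intro \<Psi>_cong) (simp add: G_def)
  then have "\<Psi> \<mu> P F = q * \<Psi> \<mu> P G" using q unfolding \<Psi>_scale by simp
  ultimately show ?thesis unfolding q_def by blast
qed

lemma \<Psi>_nonneg_iff: "(\<forall>F. 0 \<le> \<Psi> \<mu> P F) \<longleftrightarrow> (\<forall>F\<in>sphere. 0 \<le> \<Psi> \<mu> P F)"
proof (intro iffI allI)
  fix F assume *: "\<forall>F\<in>sphere. 0 \<le> \<Psi> \<mu> P F"
  show "0 \<le> \<Psi> \<mu> P F"
  proof (cases "\<exists>z\<in>Y. F z \<noteq> 0")
    case True
    then show ?thesis using \<Psi>_normalize[OF True, of \<mu> P] * J.nonneg[of F] by fastforce
  next
    case False
    then have "\<Psi> \<mu> P F = \<Psi> \<mu> P (\<lambda>z. 0 * F z)" by (intro \<Psi>_cong) auto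
    then show ?thesis unfolding \<Psi>_scale by simp
  qed
qed auto

lemma sphere_nonempty: "sphere \<noteq> {}"
  using \<Psi>_normalize[of "\<lambda>_. 1"] x0 by auto

lemma compact_sphere: "compact sphere"
proof -
  define R where "R x = (if x \<in> Y then sqrt (Re (k x x)) else 0)" for x
  have "closed {F. kquad J Y F = 1}"
    by (intro closed_Collect_eq continuous_on_kquad continuous_intros)
  then have "compact ({F. \<forall>x. cmod (F x) \<le> R x} \<inter> {F. kquad J Y F = 1})"
    by (intro compact_Int_closed compact_box)
  moreover have "{F. \<forall>x. cmod (F x) \<le> R x} \<inter> {F. kquad J Y F = 1} = sphere"
  proof (intro equalityI subsetI)
    fix F assume F: "F \<in> {F. \<forall>x. cmod (F x) \<le> R x} \<inter> {F. kquad J Y F = 1}"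
    have "F x = 0" if "x \<notin> Y" for x
    proof -
      have "cmod (F x) \<le> R x" using F by blast
      then show ?thesis using that by (simp add: R_def)
    qed
    then show "F \<in> sphere" using F by (simp add: sphere_def)
  next
    fix F assume F: "F \<in> sphere"
    have "cmod (F x) \<le> R x" for x
      using F point_bound[of x F] by (auto simp: R_def sphere_def intro: real_le_rsqrt)
    then show "F \<in> {F. \<forall>x. cmod (F x) \<le> R x} \<inter> {F. kquad J Y F = 1}" using F by (simp add: sphere_def)
  qed
  ultimately show ?thesis by simp
qed

lemma continuous_\<Psi>: "continuous_on S (\<Psi> \<mu> P)"
  unfolding \<Psi>_def[abs_def] B_def
  by (intro continuous_intros continuous_on_kquad continuous_on_coordinate)

lemma admissible_exists: "\<exists>\<mu>. \<forall>F. 0 \<le> \<Psi> \<mu> P F"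
proof -
  have "continuous_on sphere (\<Psi> 0 P)" by (rule continuous_\<Psi>)
  then obtain G where G: "\<And>F. F \<in> sphere \<Longrightarrow> \<Psi> 0 P G \<le> \<Psi> 0 P F"
    using continuous_attains_inf[OF compact_sphere sphere_nonempty] by blast
  have "0 \<le> \<Psi> (- \<Psi> 0 P G) P F" if "F \<in> sphere" for F
    using G[OF that] that by (simp add: \<Psi>_def sphere_def)
  then show ?thesis using \<Psi>_nonneg_iff by blast
qed

lemma admissible_bounds:
  assumes P: "P \<in> \<P>" and adm: "\<And>F. 0 \<le> \<Psi> \<mu> P F"
  shows "0 \<le> \<mu>" "cmod (P x) \<le> \<mu>"
proof -
  have Jd: "Re (J z z) > 0" if "z \<in> Y" for z
  proof -
    have eq: "kquad J Y (\<lambda>w. if w = z then 1 else 0) = Re (J z z)"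
      using kquad_single[OF k.fin that, of J "\<lambda>_. 1" 1] by simp
    have "kquad J Y (\<lambda>w. if w = z then 1 else 0) \<noteq> 0"
      using J.definite[of "\<lambda>w. if w = z then 1 else 0" z] that by auto
    then show ?thesis using J.nonneg[of "\<lambda>w. if w = z then 1 else 0"] unfolding eq by simp
  qed
  show \<mu>: "0 \<le> \<mu>"
  proof -
    obtain F where F: "F \<in> sphere" using sphere_nonempty by blast
    have "0 \<le> \<Psi> \<mu> P F" by (rule adm)
    then have "B P F + \<epsilon> * (cmod (F x0))\<^sup>2 \<le> \<mu>" using F by (simp add: \<Psi>_def sphere_def)
    moreover have "0 \<le> \<epsilon> * (cmod (F x0))\<^sup>2" using eps by simp
    ultimately show ?thesis using B_nonneg[OF P, of F] by linarith
  qed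
  interpret Pk: pos_kernel "\<lambda>z w. P (e z w)" Y by (rule psd[OF P])
  have Pd: "Re (P (e z z)) \<le> \<mu>" if z: "z \<in> Y" for z
  proof -
    let ?F = "\<lambda>w. if w = z then 1 else 0 :: complex"
    have Pr: "P (e z z) = of_real (Re (P (e z z)))"
      using Pk.herm[OF z z] by (simp add: complex_eq_iff)
    have "0 \<le> \<Psi> \<mu> P ?F" by (rule adm)
    then have "B P ?F \<le> \<mu> * kquad J Y ?F" using eps unfolding \<Psi>_def
      by (smt (verit) mult_nonneg_nonneg zero_le_power2)
    moreover have "kquad J Y ?F = Re (J z z)" using kquad_single[OF k.fin z, of J "\<lambda>_. 1" 1] by simp
    moreover have "B P ?F = Re (J z z * P (e z z))"
      using kquad_single[OF k.fin z, of "hadamard J (\<lambda>z w. P (e z w))" "\<lambda>_. 1" 1] by (simp add: B_def hadamard_def)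
    moreover have "Re (J z z * P (e z z)) = Re (J z z) * Re (P (e z z))" by (subst Pr) simp
    ultimately have "Re (J z z) * Re (P (e z z)) \<le> Re (J z z) * \<mu>" by (simp only: mult.commute)
    then show ?thesis using Jd[OF z] by simp
  qed
  show "cmod (P x) \<le> \<mu>" by (rule bounded[OF P Pd])
qed

text \<open>For a given matrix the least admissible \<mu> is its perturbed norm. Coercivity with
  \<open>\<kappa> < 1\<close> prevents the linear term from outweighing it: where the objective is
  at most \<open>c\<close>, \<mu> is at most \<open>C\<close>, and \<open>admissible_bounds\<close>
  then bounds all data of \<open>P\<close>.\<close>

lemma minimizer:
  "\<exists>\<mu> P. P \<in> \<P> \<and> (\<forall>F. 0 \<le> \<Psi> \<mu> P F) \<and>
    (\<forall>\<mu>' P'. P' \<in> \<P> \<longrightarrow> (\<forall>F. 0 \<le> \<Psi> \<mu>' P' F) \<longrightarrow> \<mu> - lfun P \<le> \<mu>' - lfun P')"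
proof -
  obtain P1 where P1: "P1 \<in> \<P>" using nonempty by blast
  obtain \<mu>1 where \<mu>1: "\<And>F. 0 \<le> \<Psi> \<mu>1 P1 F" using admissible_exists by blast
  define c where "c = \<mu>1 - lfun P1"
  define C where "C = c / (1 - \<kappa>)"
  define A where "A = {(\<mu>, P). P \<in> \<P> \<and> (\<forall>F. 0 \<le> \<Psi> \<mu> P F) \<and> \<mu> - lfun P \<le> c}"
  define Box where "Box = {0..C} \<times> {P :: 'z \<Rightarrow> complex. \<forall>x. cmod (P x) \<le> C}"
  have cBox: "compact Box" unfolding Box_def by (intro compact_Times compact_box compact_Icc)
  have coord: "continuous_on S (\<lambda>y::real \<times> ('z \<Rightarrow> complex). snd y x)" for S x
    by (rule continuous_on_product_then_coordinatewise) (intro continuous_intros)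
  have "closed {y. 0 \<le> \<Psi> (fst y) (snd y) F}" for F
    unfolding \<Psi>_def B_def kquad_def[of "hadamard _ _"] kform_def hadamard_def
    by (intro closed_Collect_le continuous_intros coord)
  then have 1: "closed {y. \<forall>F. 0 \<le> \<Psi> (fst y) (snd y) F}" by (rule closed_Collect_all)
  have 2: "closed {y. fst y - lfun (snd y) \<le> c}"
    unfolding lfun_def by (intro closed_Collect_le continuous_intros coord)
  have 3: "closed (UNIV \<times> \<P> :: (real \<times> ('z \<Rightarrow> complex)) set)" by (intro closed_Times closed closed_UNIV)
  have sub: "A \<subseteq> Box"
  proof
    fix y assume "y \<in> A"
    then obtain \<mu> P where y: "y = (\<mu>, P)" "P \<in> \<P>" "\<And>F. 0 \<le> \<Psi> \<mu> P F" "\<mu> - lfun P \<le> c"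
      by (auto simp: A_def)
    have "lfun P \<le> \<kappa> * \<mu>" unfolding lfun_def
    proof (rule coercive[OF y(2)])
      show "kquad (hadamard J (\<lambda>z w. P (e z w))) Y F + \<epsilon> * (cmod (F x0))\<^sup>2 \<le> \<mu> * kquad J Y F" for F
        using y(3)[of F] by (simp add: \<Psi>_def B_def)
    qed
    then have "(1 - \<kappa>) * \<mu> \<le> c" using y(4) by (simp add: algebra_simps)
    then have C: "\<mu> \<le> C" using kappa by (simp add: C_def field_simps)
    have "cmod (P x) \<le> C" for x
      using admissible_bounds(2)[OF y(2,3), of x] C by simp
    then show "y \<in> Box" using C admissible_bounds(1)[OF y(2,3)] by (simp add: y(1) Box_def)
  qed
  have "A = Box \<inter> (UNIV \<times> \<P>) \<inter> {y. \<forall>F. 0 \<le> \<Psi> (fst y) (snd y) F} \<inter> {y. fst y - lfun (snd y) \<le> c}"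
    using sub by (auto simp: A_def)
  then have cA: "compact A" by (simp only:) (intro compact_Int_closed cBox 1 2 3)
  have neA: "A \<noteq> {}" using P1 \<mu>1 by (auto simp: A_def c_def)
  have "continuous_on A (\<lambda>y. fst y - lfun (snd y))"
    unfolding lfun_def by (intro continuous_intros coord)
  from continuous_attains_inf[OF cA neA this] obtain y where
    y: "y \<in> A" "\<And>y'. y' \<in> A \<Longrightarrow> fst y - lfun (snd y) \<le> fst y' - lfun (snd y')" by blast
  show ?thesis
  proof (intro exI[of _ "fst y"] exI[of _ "snd y"] conjI allI impI)
    show "snd y \<in> \<P>" "\<And>F. 0 \<le> \<Psi> (fst y) (snd y) F" using y(1) by (auto simp: A_def)
    fix \<mu>' P' assume P': "P' \<in> \<P>" "\<forall>F. 0 \<le> \<Psi> \<mu>' P' F"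
    show "fst y - lfun (snd y) \<le> \<mu>' - lfun P'"
    proof (cases "\<mu>' - lfun P' \<le> c")
      case True
      then have "(\<mu>', P') \<in> A" using P' by (simp add: A_def)
      from y(2)[OF this] show ?thesis by simp
    next
      case False
      then show ?thesis using y(1) by (auto simp: A_def)
    qed
  qed
qed

text \<open>The first order condition at a minimizer: since the null vector is unique up to a
  unimodular factor, the optimal value is differentiable along segments.\<close>

theorem extremal_function:
  "\<exists>\<mu> P F. P \<in> \<P> \<and> (\<forall>G. B P G \<le> \<mu> * kquad J Y G) \<and> kquad J Y F = 1 \<and> (\<forall>z\<in>Y. F z \<noteq> 0) \<and>
    B P F = \<mu> - \<epsilon> * (cmod (F x0))\<^sup>2 \<and> (\<forall>Q\<in>\<P>. B P F - lfun P \<le> B Q F - lfun Q)"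
proof -
  obtain \<mu> P where P: "P \<in> \<P>" and adm: "\<And>F. 0 \<le> \<Psi> \<mu> P F"
    and min: "\<And>\<mu>' P'. P' \<in> \<P> \<Longrightarrow> (\<forall>F. 0 \<le> \<Psi> \<mu>' P' F) \<Longrightarrow> \<mu> - lfun P \<le> \<mu>' - lfun P'"
    using minimizer by (elim exE conjE) blast
  obtain N :: nat and p :: "nat \<Rightarrow> 'x \<Rightarrow> complex" where p: "\<And>F. B P F = (\<Sum>n<N. kquad J Y (\<lambda>z. p n z * F z))" using gram[OF P] by blast
  have "(\<Sum>n<N. kquad J Y (\<lambda>z. p n z * f z)) + \<epsilon> * (cmod (f x0))\<^sup>2 \<le> \<mu> * kquad J Y f" for f
    using adm[of f] by (simp add: \<Psi>_def p)
  then interpret E: extremal_form k J Y N p \<mu> \<epsilon> x0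
    by unfold_locales (use x0 eps in auto)
  have E\<Phi>: "E.\<Phi> F = \<Psi> \<mu> P F" for F by (simp add: E.\<Phi>_def \<Psi>_def p)
  \<comment> \<open>Otherwise \<Psi> would have a positive minimum on the compact sphere, and \<mu>
    could be lowered by it.\<close>
  have "\<exists>F\<in>sphere. \<Psi> \<mu> P F = 0"
  proof (rule ccontr)
    assume no: "\<not> (\<exists>F\<in>sphere. \<Psi> \<mu> P F = 0)"
    obtain G where G: "G \<in> sphere" "\<And>F. F \<in> sphere \<Longrightarrow> \<Psi> \<mu> P G \<le> \<Psi> \<mu> P F"
      using continuous_attains_inf[OF compact_sphere sphere_nonempty continuous_\<Psi>] by blast
    define m where "m = \<Psi> \<mu> P G"
    have m: "m > 0" using no G(1) adm[of G] unfolding m_def by (metis order_le_less)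
    have "0 \<le> \<Psi> (\<mu> - m) P F" if "F \<in> sphere" for F
      using G(2)[OF that] that by (simp add: \<Psi>_def sphere_def m_def)
    then have "\<forall>F. 0 \<le> \<Psi> (\<mu> - m) P F" using \<Psi>_nonneg_iff by blast
    from min[OF P this] m show False by simp
  qed
  then obtain F where F: "F \<in> sphere" "\<Psi> \<mu> P F = 0" by blast
  have F1: "kquad J Y F = 1" using F(1) by (simp add: sphere_def)
  have Fnz: "F z \<noteq> 0" if z: "z \<in> Y" for z
  proof
    assume "F z = 0"
    then have "F w = 0" if "w \<in> Y" for w using E.null_vanishing[of F z w] F(2) z that by (simp add: E\<Phi>)
    then have "kform J Y F F = 0" by (rule kform_zero_left)
    then show False using F1 by (simp add: kquad_def)
  qed
  have BF: "B P F = \<mu> - \<epsilon> * (cmod (F x0))\<^sup>2" using F(2) F1 by (simp add: \<Psi>_def)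
  have var: "B P F - lfun P \<le> B Q F - lfun Q" if Q: "Q \<in> \<P>" for Q
  proof (rule ccontr)
    assume neg: "\<not> B P F - lfun P \<le> B Q F - lfun Q"
    \<comment> \<open>Half of the gap. The objective is to be lowered at rate \<eta> while moving
      from \<open>P\<close> towards \<open>Q\<close>, and a margin is left at \<open>F\<close>,
      where \<omega> equals \<open>- \<eta>\<close>.\<close>
    define \<eta> where "\<eta> = ((B P F - lfun P) - (B Q F - lfun Q)) / 2"
    have \<eta>: "\<eta> > 0" using neg by (simp add: \<eta>_def)
    define \<omega> where "\<omega> G = B Q G - B P G - lfun Q + lfun P + \<eta>" for G
    have \<omega>F: "\<omega> F < 0" using neg by (simp add: \<omega>_def \<eta>_def field_simps)
    have c\<omega>: "continuous_on S \<omega>" for S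
      unfolding \<omega>_def[abs_def] B_def by (intro continuous_intros continuous_on_kquad)
    \<comment> \<open>Off \<open>D\<close> the move keeps \<Psi> nonnegative since \<omega> is
      negative. On \<open>D\<close>, which contains no multiple of \<open>F\<close>, uniqueness of
      the null vector gives a positive lower bound \<open>m\<close>.\<close>
    define D where "D = sphere \<inter> {G. 0 \<le> \<omega> G}"
    have "closed {G. 0 \<le> \<omega> G}" by (intro closed_Collect_le c\<omega> continuous_intros)
    then have cD: "compact D" unfolding D_def by (intro compact_Int_closed compact_sphere)
    have posD: "0 < \<Psi> \<mu> P G" if G: "G \<in> D" for G
    proof -
      have "\<Psi> \<mu> P G \<noteq> 0"
      proof
        assume z: "\<Psi> \<mu> P G = 0"
        have "kquad J Y G = 1" using G by (simp add: D_def sphere_def)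
        then obtain c where c: "cmod c = 1" "\<And>z. z \<in> Y \<Longrightarrow> G z = c * F z"
          using E.null_unique[of F G] F(2) F1 z by (auto simp: E\<Phi>)
        have "B X G = B X F" for X
          unfolding B_def using kquad_cong[of Y G "\<lambda>z. c * F z"] c by (simp add: kquad_scale)
        then have "\<omega> G = \<omega> F" by (simp add: \<omega>_def)
        then show False using G \<omega>F by (simp add: D_def)
      qed
      then show ?thesis using adm[of G] by simp
    qed
    have "\<exists>m>0. \<forall>G\<in>D. m \<le> \<Psi> \<mu> P G"
    proof (cases "D = {}")
      case False
      then obtain G where "G \<in> D" "\<And>H. H \<in> D \<Longrightarrow> \<Psi> \<mu> P G \<le> \<Psi> \<mu> P H"
        using continuous_attains_inf[OF cD False continuous_\<Psi>] by blast
      then show ?thesis using posD by blast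
    qed (auto intro: exI[of _ 1])
    then obtain m where m: "m > 0" "\<And>G. G \<in> D \<Longrightarrow> m \<le> \<Psi> \<mu> P G" by blast
    obtain Gs where "\<And>H. H \<in> sphere \<Longrightarrow> \<omega> H \<le> \<omega> Gs"
      using continuous_attains_sup[OF compact_sphere sphere_nonempty c\<omega>] by blast
    then have "0 < max 1 (\<omega> Gs)" "\<And>H. H \<in> sphere \<Longrightarrow> \<omega> H \<le> max 1 (\<omega> Gs)" by fastforce+
    then obtain b where b: "b > 0" "\<And>H. H \<in> sphere \<Longrightarrow> \<omega> H \<le> b" by blast
    \<comment> \<open>Small enough that the loss on \<open>D\<close>, at most \<open>t * b\<close>,
      stays within \<open>m\<close>.\<close>
    define t where "t = min 1 (m / b)"
    have t: "0 < t" "t \<le> 1" "t \<le> m / b" using m b by (auto simp: t_def)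
    define Pt where "Pt x = complex_of_real (1 - t) * P x + complex_of_real t * Q x" for x
    define \<mu>t where "\<mu>t = \<mu> + t * (lfun Q - lfun P) - t * \<eta>"
    have Pt: "Pt \<in> \<P>" unfolding Pt_def[abs_def] using convex[OF P Q] t by simp
    have lfun_t: "lfun Pt = (1 - t) * lfun P + t * lfun Q" unfolding Pt_def[abs_def] by (rule lfun_lin)
    have Bt: "B Pt G = (1 - t) * B P G + t * B Q G" for G
      unfolding B_def Pt_def[abs_def] by (rule kquad_hadamard_lin)
    have "\<mu>t - lfun Pt < \<mu> - lfun P" using t \<eta> by (simp add: \<mu>t_def lfun_t algebra_simps)
    then have "\<not> (\<forall>G. 0 \<le> \<Psi> \<mu>t Pt G)" using min[OF Pt, of \<mu>t] by fastforce
    then obtain G where G: "G \<in> sphere" "\<Psi> \<mu>t Pt G < 0" using \<Psi>_nonneg_iff by fastforce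
    have "\<Psi> \<mu>t Pt G = \<Psi> \<mu> P G - t * \<omega> G"
      using G(1) by (simp add: \<Psi>_def sphere_def Bt \<mu>t_def \<omega>_def algebra_simps)
    then have lt: "\<Psi> \<mu> P G < t * \<omega> G" using G(2) by simp
    then have "0 < t * \<omega> G" using adm[of G] by simp
    then have "0 < \<omega> G" using t by (simp add: zero_less_mult_iff)
    then have "G \<in> D" using G(1) by (simp add: D_def)
    then have "m < t * \<omega> G" using m(2) lt by fastforce
    also have "\<dots> \<le> t * b" using b(2)[OF G(1)] t by simp
    also have "\<dots> \<le> m" using t(3) b(1) by (simp add: field_simps)
    finally show False by simp
  qed
  have "B P G \<le> \<mu> * kquad J Y G" for G
    using adm[of G] eps unfolding \<Psi>_def by (smt (verit) mult_nonneg_nonneg zero_le_power2)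
  then show ?thesis using P F1 Fnz BF var by blast
qed

end

section \<open>The column-row property\<close>

lemma kquad_lin:
  "kquad (\<lambda>z w. complex_of_real s * P z w + complex_of_real t * Q z w) Y F = s * kquad P Y F + t * kquad Q Y F"
proof -
  have "kform (\<lambda>z w. of_real s * P z w + of_real t * Q z w) Y F F
    = of_real s * kform P Y F F + of_real t * kform Q Y F F"
    by (simp add: kform_def sum_distrib_left algebra_simps sum.distrib)
  then show ?thesis by (simp add: kquad_def)
qed

lemma pos_kernel_lin:
  assumes "pos_kernel P Y" "pos_kernel Q Y" "0 \<le> s" "0 \<le> t"
  shows "pos_kernel (\<lambda>z w. complex_of_real s * P z w + complex_of_real t * Q z w) Y"
proof -
  interpret P: pos_kernel P Y by fact
  interpret Q: pos_kernel Q Y by fact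
  show ?thesis
  proof
    show "finite Y" by (rule P.fin)
    show "complex_of_real s * P w z + complex_of_real t * Q w z = cnj (complex_of_real s * P z w + complex_of_real t * Q z w)"
      if "z \<in> Y" "w \<in> Y" for z w using P.herm[OF that] Q.herm[OF that] by simp
    show "0 \<le> kquad (\<lambda>z w. complex_of_real s * P z w + complex_of_real t * Q z w) Y h" for h
      unfolding kquad_lin using assms P.nonneg Q.nonneg by simp
  qed
qed

lemma closed_Collect_imp_const: "(a \<Longrightarrow> closed {x. Q x}) \<Longrightarrow> closed {x. a \<longrightarrow> Q x}"
  by (cases a) auto

lemma closed_pos_kernel:
  assumes "finite Y"
  shows "closed {P :: 'z \<Rightarrow> complex. pos_kernel (\<lambda>z w. P (e z w)) Y}"
proof -
  have "{P :: 'z \<Rightarrow> complex. pos_kernel (\<lambda>z w. P (e z w)) Y}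
     = {P. \<forall>z. z \<in> Y \<longrightarrow> (\<forall>w. w \<in> Y \<longrightarrow> P (e w z) = cnj (P (e z w)))} \<inter> {P. \<forall>h. 0 \<le> kquad (\<lambda>z w. P (e z w)) Y h}"
    using assms by (auto simp: pos_kernel_def)
  moreover have "closed {P :: 'z \<Rightarrow> complex. \<forall>z. z \<in> Y \<longrightarrow> (\<forall>w. w \<in> Y \<longrightarrow> P (e w z) = cnj (P (e z w)))}"
    by (intro closed_Collect_all closed_Collect_imp_const closed_Collect_eq continuous_intros continuous_on_coordinate)
  moreover have "closed {P :: 'z \<Rightarrow> complex. \<forall>h. 0 \<le> kquad (\<lambda>z w. P (e z w)) Y h}"
    unfolding kquad_def kform_def
    by (intro closed_Collect_all closed_Collect_le continuous_intros continuous_on_coordinate)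
  ultimately show ?thesis by (simp add: closed_Int)
qed

lemma pos_kernel_rank_one: "finite Y \<Longrightarrow> pos_kernel (\<lambda>z w. v z * cnj (v w)) Y"
  by unfold_locales (auto simp: kquad_rank_one)

lemma kquad_tendsto:
  assumes "\<And>z w. z \<in> Y \<Longrightarrow> w \<in> Y \<Longrightarrow> (\<lambda>n. P n z w) \<longlonglongrightarrow> P' z w"
  shows "(\<lambda>n. kquad (P n) Y h) \<longlonglongrightarrow> kquad P' Y h"
  unfolding kquad_def kform_def by (intro tendsto_intros assms)

section \<open>Factorization of vectors of functions\<close>

context dual_pick
begin

text \<open>The feasible set is the cone of all positive semidefinite matrices, and the linear term
  adds the forms at the \<open>u i\<close>, divided by \<sigma>. Adding the rank one matrix of
  \<open>v\<close> to the minimizer gives a competitor, for which the first order condition is the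
  claim. Coercivity holds with \<tau> / \<sigma>. The conclusion does not mention \<mu>, so the
  perturbation may be as large as 1.\<close>

lemma dominating_function:
  fixes N :: nat
  assumes x0: "x0 \<in> Y" and \<sigma>: "(\<Sum>i<N. kquad J Y (u i)) < \<sigma>"
  shows "\<exists>F. kquad J Y F = 1 \<and> (\<forall>z\<in>Y. F z \<noteq> 0) \<and>
    (\<forall>v. (\<Sum>i<N. kquad J Y (\<lambda>z. v z * u i z)) \<le> \<sigma> * kquad J Y (\<lambda>z. v z * F z))"
proof -
  define \<tau> where "\<tau> = (\<Sum>i<N. kquad J Y (u i))"
  have \<tau>: "0 \<le> \<tau>" "\<tau> < \<sigma>" using \<sigma> by (auto simp: \<tau>_def intro!: sum_nonneg J.nonneg)
  then have \<sigma>0: "\<sigma> > 0" by simp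
  define \<P> where "\<P> = {P :: 'x \<times> 'x \<Rightarrow> complex. (\<forall>x. x \<notin> Y \<times> Y \<longrightarrow> P x = 0) \<and> pos_kernel (\<lambda>z w. P (z, w)) Y}"
  define L where "L z w = J z w * (\<Sum>i<N. u i z * cnj (u i w)) / of_real \<sigma>" for z w
  have lf: "Re (\<Sum>z\<in>Y. \<Sum>w\<in>Y. L z w * P (z, w)) = (\<Sum>i<N. kquad (hadamard J (\<lambda>z w. P (z, w))) Y (u i)) / \<sigma>" for P
  proof -
    have "(\<Sum>z\<in>Y. \<Sum>w\<in>Y. L z w * P (z, w)) = kform (\<lambda>z w. hadamard J (\<lambda>z w. P (z, w)) z w * (\<Sum>i<N. u i z * cnj (u i w))) Y (\<lambda>_. 1) (\<lambda>_. 1) / of_real \<sigma>"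
      by (simp add: L_def kform_def hadamard_def sum_divide_distrib algebra_simps)
    then show ?thesis using kquad_schur_sum[of "hadamard J (\<lambda>z w. P (z, w))" u "{..<N}" Y "\<lambda>_. 1"]
      by (simp add: kquad_def)
  qed
  have psd: "pos_kernel (\<lambda>z w. P (z, w)) Y" if "P \<in> \<P>" for P using that by (simp add: \<P>_def)
  interpret E: extremal_problem k J Y \<P> Pair L 1 "\<tau> / \<sigma>" x0
  proof (rule extremal_problem.intro[OF dual_pick_axioms], rule extremal_problem_axioms.intro)
    show "x0 \<in> Y" by fact
    show "\<tau> / \<sigma> < 1" using \<tau> by simp
    have "pos_kernel (\<lambda>z w. 0 :: complex) Y" using pos_kernel_rank_one[OF k.fin, of "\<lambda>_. 0"] by simp
    then have "(\<lambda>_. 0) \<in> \<P>" by (simp add: \<P>_def)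
    then show "\<P> \<noteq> {}" by blast
    have "closed {P :: 'x \<times> 'x \<Rightarrow> complex. \<forall>x. x \<notin> Y \<times> Y \<longrightarrow> P x = 0}"
      by (intro closed_Collect_all closed_Collect_imp_const closed_Collect_eq continuous_intros continuous_on_coordinate)
    then show "closed \<P>" unfolding \<P>_def by (intro closed_Collect_conj closed_pos_kernel k.fin)
    show "(\<lambda>x. complex_of_real (1 - t) * P x + complex_of_real t * Q x) \<in> \<P>"
      if "P \<in> \<P>" "Q \<in> \<P>" "0 \<le> t" "t \<le> 1" for P Q t
      using that pos_kernel_lin[OF psd psd, of P Q "1 - t" t] by (simp add: \<P>_def)
    show "pos_kernel (\<lambda>z w. P (z, w)) Y" if "P \<in> \<P>" for P using that by (rule psd)
    show "cmod (P x) \<le> \<mu>" if P: "P \<in> \<P>" and b: "\<And>z. z \<in> Y \<Longrightarrow> Re (P (z, z)) \<le> \<mu>" for P \<mu> x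
    proof -
      interpret Pk: pos_kernel "\<lambda>z w. P (z, w)" Y by (rule psd[OF P])
      show ?thesis
      proof (cases "x \<in> Y \<times> Y")
        case True
        then show ?thesis using Pk.entry_le[OF b, of "fst x" "snd x"] by auto
      next
        case False
        then have "P x = 0" using P unfolding \<P>_def by blast
        then show ?thesis using b[OF x0] Pk.diag_nonneg[OF x0] by simp
      qed
    qed
    show "Re (\<Sum>z\<in>Y. \<Sum>w\<in>Y. L z w * P (z, w)) \<le> \<tau> / \<sigma> * \<mu>"
      if "P \<in> \<P>" and le: "\<And>F. kquad (hadamard J (\<lambda>z w. P (z, w))) Y F + 1 * (cmod (F x0))\<^sup>2 \<le> \<mu> * kquad J Y F" for P \<mu>
    proof -
      have "kquad (hadamard J (\<lambda>z w. P (z, w))) Y (u i) \<le> \<mu> * kquad J Y (u i)" for i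
        using le[of "u i"] zero_le_power2[of "cmod (u i x0)"] by linarith
      then have "(\<Sum>i<N. kquad (hadamard J (\<lambda>z w. P (z, w))) Y (u i)) \<le> \<mu> * \<tau>"
        unfolding \<tau>_def sum_distrib_left by (intro sum_mono)
      then show ?thesis unfolding lf using \<sigma>0 by (simp add: divide_right_mono mult.commute)
    qed
  qed auto
  obtain \<mu> P F where P: "P \<in> \<P>" and F: "kquad J Y F = 1" "\<forall>z\<in>Y. F z \<noteq> 0"
    and var: "\<forall>Q\<in>\<P>. E.B P F - E.lfun P \<le> E.B Q F - E.lfun Q"
    using E.extremal_function by blast
  have "(\<Sum>i<N. kquad J Y (\<lambda>z. v z * u i z)) \<le> \<sigma> * kquad J Y (\<lambda>z. v z * F z)" for v
  proof -
    define V where "V x = (if x \<in> Y \<times> Y then v (fst x) * cnj (v (snd x)) else 0)" for x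
    define Q where "Q x = complex_of_real 1 * P x + complex_of_real 1 * V x" for x
    have V: "kquad (hadamard J (\<lambda>z w. V (z, w))) Y G = kquad J Y (\<lambda>z. v z * G z)" for G
      using kquad_hadamard_gram[of Y "\<lambda>z w. V (z, w)" "\<lambda>_::nat. v" "{0}" J G] by (simp add: V_def)
    have "pos_kernel (\<lambda>z w. V (z, w)) Y"
    proof -
      have "pos_kernel (\<lambda>z w. v z * cnj (v w)) Y" by (rule pos_kernel_rank_one[OF k.fin])
      moreover have "kquad (\<lambda>z w. V (z, w)) Y h = kquad (\<lambda>z w. v z * cnj (v w)) Y h" for h
        unfolding kquad_def by (rule arg_cong[where f=Re], rule kform_cong) (auto simp: V_def)
      ultimately show ?thesis by (auto simp: pos_kernel_def V_def)
    qed
    then have "Q \<in> \<P>"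
      using pos_kernel_lin[OF psd[OF P], of "\<lambda>z w. V (z, w)" 1 1] P by (simp add: \<P>_def Q_def V_def)
    then have "E.B P F - E.lfun P \<le> E.B Q F - E.lfun Q" using var by blast
    moreover have "E.B Q F = E.B P F + kquad J Y (\<lambda>z. v z * F z)"
      unfolding E.B_def Q_def using kquad_hadamard_lin[of J 1 "\<lambda>z w. P (z, w)" 1 "\<lambda>z w. V (z, w)" Y F] by (simp add: V)
    moreover have "E.lfun Q = E.lfun P + (\<Sum>i<N. kquad J Y (\<lambda>z. v z * u i z)) / \<sigma>"
      unfolding Q_def[abs_def] using E.lfun_lin[of 1 P 1 V] lf[of V] by (simp add: E.lfun_def V)
    ultimately have "(\<Sum>i<N. kquad J Y (\<lambda>z. v z * u i z)) / \<sigma> \<le> kquad J Y (\<lambda>z. v z * F z)" by simp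
    then show ?thesis using \<sigma>0 by (simp add: field_simps)
  qed
  then show ?thesis using F by blast
qed

lemma approx_factorization: "approx_factorization k Y"
  unfolding approx_factorization_def
proof (intro allI impI)
  fix N :: nat and f and \<rho> :: real assume \<rho>: "0 < \<rho>" "\<rho> < 1"
  define \<tau> where "\<tau> = (\<Sum>i<N. kquad k Y (f i))"
  have \<tau>0: "0 \<le> \<tau>" by (auto simp: \<tau>_def intro!: sum_nonneg k.nonneg)
  show "\<exists>y. col_contr k Y N y \<and> \<rho> * (\<Sum>i<N. kquad k Y (f i)) \<le> kquad k Y (\<lambda>z. \<Sum>i<N. y i z * f i z)"
  proof (cases "\<tau> = 0")
    case True
    have "col_contr k Y N (\<lambda>i z. 0)"
      by (auto simp: col_contr_def kquad_def kform_zero_left intro!: sum_nonneg k.nonneg[unfolded kquad_def])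
    then show ?thesis using True k.nonneg[of "\<lambda>_. 0"] unfolding \<tau>_def by (intro exI[of _ "\<lambda>i z. 0"]) auto
  next
    case False
    then have \<tau>p: "\<tau> > 0" using \<tau>0 by simp
    then obtain x0 where x0: "x0 \<in> Y"
      by (cases "Y = {}") (auto simp: \<tau>_def kquad_def kform_def)
    define \<sigma> where "\<sigma> = \<tau> / \<rho>"
    have \<sigma>: "\<tau> < \<sigma>" "\<sigma> > 0" using \<rho> \<tau>p by (auto simp: \<sigma>_def field_simps)
    define u where "u i = kapply k Y (f i)" for i
    have "(\<Sum>i<N. kquad J Y (u i)) < \<sigma>" using \<sigma> by (simp add: u_def dual_quad_apply \<tau>_def)
    from dominating_function[OF x0 this] obtain F where F: "kquad J Y F = 1" "\<And>z. z \<in> Y \<Longrightarrow> F z \<noteq> 0"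
      and dom: "\<And>v. (\<Sum>i<N. kquad J Y (\<lambda>z. v z * u i z)) \<le> \<sigma> * kquad J Y (\<lambda>z. v z * F z)"
      by blast
    \<comment> \<open>On \<open>Y\<close> this factors \<open>u i\<close> as
      \<open>sqrt \<sigma> * y i * F\<close>; domination with \<open>v = g / F\<close> says that the
      column \<open>y\<close> is contractive.\<close>
    define y where "y i z = u i z / (of_real (sqrt \<sigma>) * F z)" for i z
    have s: "complex_of_real (sqrt \<sigma>) \<noteq> 0" "(cmod (complex_of_real (1 / sqrt \<sigma>)))\<^sup>2 = 1 / \<sigma>"
      using \<sigma> by (auto simp: power_divide norm_divide)
    have "col_contr k Y N y"
    proof (rule col_contr_if_dual)
      fix g
      define v where "v z = g z / F z" for z
      have "(\<Sum>i<N. kquad J Y (\<lambda>z. y i z * g z)) = (\<Sum>i<N. kquad J Y (\<lambda>z. of_real (1 / sqrt \<sigma>) * (v z * u i z)))"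
        by (intro sum.cong refl kquad_cong) (simp add: y_def v_def)
      also have "\<dots> = (\<Sum>i<N. kquad J Y (\<lambda>z. v z * u i z)) / \<sigma>"
        unfolding kquad_scale s sum_divide_distrib by simp
      also have "\<dots> \<le> kquad J Y (\<lambda>z. v z * F z)" using dom[of v] \<sigma> by (simp add: field_simps)
      also have "\<dots> = kquad J Y g" by (rule kquad_cong) (simp add: v_def F)
      finally show "(\<Sum>i<N. kquad J Y (\<lambda>z. y i z * g z)) \<le> kquad J Y g" .
    qed
    \<comment> \<open>Pairing with the unit vector \<open>F\<close> already recovers
      \<open>\<tau> / sqrt \<sigma>\<close>, whose square is \<open>\<rho> * \<tau>\<close> by the
      choice of \<sigma>.\<close>
    moreover have "\<rho> * \<tau> \<le> kquad k Y (\<lambda>z. \<Sum>i<N. y i z * f i z)"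
    proof -
      have "(\<Sum>z\<in>Y. F z * (\<Sum>i<N. y i z * f i z)) = (\<Sum>z\<in>Y. \<Sum>i<N. f i z * u i z / of_real (sqrt \<sigma>))"
        unfolding sum_distrib_left using F(2) by (intro sum.cong refl) (simp add: y_def)
      also have "\<dots> = (\<Sum>i<N. (\<Sum>z\<in>Y. f i z * u i z)) / of_real (sqrt \<sigma>)"
        by (subst sum.swap) (simp add: sum_divide_distrib)
      also have "(\<Sum>i<N. (\<Sum>z\<in>Y. f i z * u i z)) = of_real \<tau>"
        unfolding u_def kform_kapply[symmetric] k.kform_self \<tau>_def by simp
      finally have "cmod (\<Sum>z\<in>Y. F z * (\<Sum>i<N. y i z * f i z)) = \<tau> / sqrt \<sigma>"
        using \<tau>0 \<sigma> by (simp add: norm_divide)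
      then have "(\<tau> / sqrt \<sigma>)\<^sup>2 \<le> kquad k Y (\<lambda>z. \<Sum>i<N. y i z * f i z)"
        using pairing[of F "\<lambda>z. \<Sum>i<N. y i z * f i z"] F(1) by simp
      moreover have "(\<tau> / sqrt \<sigma>)\<^sup>2 = \<rho> * \<tau>"
        using \<sigma>(2) \<tau>p \<rho> by (simp add: power_divide \<sigma>_def power2_eq_square)
      ultimately show ?thesis by simp
    qed
    ultimately show ?thesis unfolding \<tau>_def by blast
  qed
qed

end

lemma (in pd_kernel) pd_subset: "Y' \<subseteq> Y \<Longrightarrow> pd_kernel k Y'"
proof -
  assume Y': "Y' \<subseteq> Y"
  interpret Y': pos_kernel k Y' by (rule subset[OF Y'])
  show ?thesis
  proof
    fix h z assume h: "kquad k Y' h = 0" "z \<in> Y'"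
    have "kquad k Y (\<lambda>z. if z \<in> Y' then h z else 0) = 0"
      using h(1) by (simp add: kquad_def kform_extend[OF fin Y', of k h h])
    from definite[OF this, of z] show "h z = 0" using h(2) Y' by auto
  qed
qed

theorem column_row_property:
  assumes "pd_kernel k Y" "pick_kernel k Y"
  shows "column_row k Y"
proof (rule column_row_if_factorization[OF assms(2)])
  fix Z assume Z: "Z \<subseteq> Y"
  interpret pd: pd_kernel k Z by (rule pd_kernel.pd_subset[OF assms(1) Z])
  interpret pi: pick_kernel k Z by (rule pick_kernel.pick_subset[OF assms(2) Z])
  obtain J where "dual_kernels k J Z" using pd.dual_exists by blast
  then interpret dual_pick k J Z by (intro dual_pick.intro pi.pick_kernel_axioms)
  show "approx_factorization k Z" by (rule approx_factorization)
qed

section \<open>Multipliers of the weak product over a finite set\<close>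

text \<open>The matrix of the vectors \<open>(p n, cnj (q n))\<close> and \<open>(q n, cnj (p n))\<close>, indexed by two copies of the point set;
  its off-diagonal block records the products \<open>p n z * q n z\<close>.\<close>

definition pair_vec :: "(nat \<Rightarrow> 'x \<Rightarrow> complex) \<Rightarrow> (nat \<Rightarrow> 'x \<Rightarrow> complex) \<Rightarrow> nat \<Rightarrow> 'x \<times> bool \<Rightarrow> complex" where
  "pair_vec p q n x = (if snd x then cnj (q n (fst x)) else p n (fst x))"

definition pair_term :: "(nat \<Rightarrow> 'x \<Rightarrow> complex) \<Rightarrow> (nat \<Rightarrow> 'x \<Rightarrow> complex) \<Rightarrow> nat \<Rightarrow> 'x \<times> bool \<Rightarrow> 'x \<times> bool \<Rightarrow> complex" where
  "pair_term p q n x y = (pair_vec p q n x * cnj (pair_vec p q n y) + pair_vec q p n x * cnj (pair_vec q p n y)) / 2"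

definition pair_gram :: "'x set \<Rightarrow> (nat \<Rightarrow> 'x \<Rightarrow> complex) \<Rightarrow> (nat \<Rightarrow> 'x \<Rightarrow> complex) \<Rightarrow> ('x \<times> bool) \<times> ('x \<times> bool) \<Rightarrow> complex" where
  "pair_gram Y p q xy = (if xy \<in> (Y \<times> UNIV) \<times> (Y \<times> UNIV) then (\<Sum>n. pair_term p q n (fst xy) (snd xy)) else 0)"

text \<open>Only the diagonal of the off-diagonal block is prescribed. The last condition makes the
  two diagonal blocks conjugate, so that a bound on the first block controls both columns; the
  average over both orders in \<open>pair_term\<close> fulfils it.\<close>

definition product_matrices :: "'x set \<Rightarrow> ('x \<Rightarrow> complex) \<Rightarrow> (('x \<times> bool) \<times> ('x \<times> bool) \<Rightarrow> complex) set" where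
  "product_matrices Y \<phi> = {Z. (\<forall>x. x \<notin> (Y \<times> UNIV) \<times> (Y \<times> UNIV) \<longrightarrow> Z x = 0) \<and>
     pos_kernel (\<lambda>u v. Z (u, v)) (Y \<times> UNIV) \<and>
     (\<forall>z\<in>Y. Z ((z, False), (z, True)) = \<phi> z) \<and>
     (\<forall>z\<in>Y. \<forall>w\<in>Y. Z ((z, True), (w, True)) = cnj (Z ((z, False), (w, False))))}"

lemma pair_term_rank_one:
  "pair_term p q n x y = complex_of_real (1/2) * (pair_vec p q n x * cnj (pair_vec p q n y))
     + complex_of_real (1/2) * (pair_vec q p n x * cnj (pair_vec q p n y))"
  by (simp add: pair_term_def add_divide_distrib)

lemma pos_kernel_pair_term: "finite X \<Longrightarrow> pos_kernel (pair_term p q n) X"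
  unfolding pair_term_rank_one[abs_def] by (intro pos_kernel_lin pos_kernel_rank_one) auto

lemma pos_kernel_sum_pair_term:
  assumes "finite X"
  shows "pos_kernel (\<lambda>x y. \<Sum>n<m. pair_term p q n x y) X"
proof (induction m)
  case 0
  show ?case using pos_kernel_rank_one[OF assms, of "\<lambda>_. 0"] by simp
next
  case (Suc m)
  show ?case using pos_kernel_lin[OF Suc pos_kernel_pair_term[OF assms, of p q m], of 1 1] by simp
qed

lemma summable_mult_of_squares:
  fixes u v :: "nat \<Rightarrow> complex"
  assumes "summable (\<lambda>n. (cmod (u n))\<^sup>2)" "summable (\<lambda>n. (cmod (v n))\<^sup>2)"
  shows "summable (\<lambda>n. u n * v n)"
proof (rule summable_comparison_test')
  show "summable (\<lambda>n. (cmod (u n))\<^sup>2 + (cmod (v n))\<^sup>2)" by (rule summable_add[OF assms])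
  show "norm (u n * v n) \<le> (cmod (u n))\<^sup>2 + (cmod (v n))\<^sup>2" for n
  proof -
    have "0 \<le> cmod (u n) * cmod (v n)" by simp
    then show ?thesis using sum_squares_bound[of "cmod (u n)" "cmod (v n)"] unfolding norm_mult by linarith
  qed
qed

context
  fixes Y :: "'x set" and p q :: "nat \<Rightarrow> 'x \<Rightarrow> complex"
  assumes fin: "finite Y"
    and sp: "\<And>z. z \<in> Y \<Longrightarrow> summable (\<lambda>n. (cmod (p n z))\<^sup>2)"
    and sq: "\<And>z. z \<in> Y \<Longrightarrow> summable (\<lambda>n. (cmod (q n z))\<^sup>2)"
begin

lemma pair_gram_sums:
  assumes "x \<in> Y \<times> UNIV" "y \<in> Y \<times> UNIV"
  shows "(\<lambda>n. pair_term p q n x y) sums pair_gram Y p q (x, y)"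
proof -
  have s: "summable (\<lambda>n. (cmod (pair_vec p q n x))\<^sup>2)" "summable (\<lambda>n. (cmod (pair_vec q p n x))\<^sup>2)"
    if xY: "x \<in> Y \<times> UNIV" for x
  proof -
    obtain z b where x: "x = (z, b)" "z \<in> Y" using xY by auto
    show "summable (\<lambda>n. (cmod (pair_vec p q n x))\<^sup>2)" "summable (\<lambda>n. (cmod (pair_vec q p n x))\<^sup>2)"
      using sp[OF x(2)] sq[OF x(2)] by (cases b; simp add: x(1) pair_vec_def)+
  qed
  have "summable (\<lambda>n. pair_term p q n x y)"
    unfolding pair_term_def
    by (intro summable_divide summable_add summable_mult_of_squares) (use s assms in auto)
  then show ?thesis using assms by (simp add: pair_gram_def summable_sums)
qed

lemma pair_gram_mem:
  assumes prod: "\<And>z. z \<in> Y \<Longrightarrow> (\<lambda>n. p n z * q n z) sums \<phi> z"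
  shows "pair_gram Y p q \<in> product_matrices Y \<phi>"
  unfolding product_matrices_def
proof (intro CollectI conjI allI ballI impI)
  show "pair_gram Y p q x = 0" if "x \<notin> (Y \<times> UNIV) \<times> (Y \<times> UNIV)" for x
    unfolding pair_gram_def using that by (simp only: if_False)
  have fX: "finite (Y \<times> (UNIV :: bool set))" using fin by simp
  have lim: "(\<lambda>m. \<Sum>n<m. pair_term p q n x y) \<longlonglongrightarrow> pair_gram Y p q (x, y)"
    if "x \<in> Y \<times> UNIV" "y \<in> Y \<times> UNIV" for x y
    using pair_gram_sums[OF that] by (simp add: sums_def)
  show "pos_kernel (\<lambda>u v. pair_gram Y p q (u, v)) (Y \<times> UNIV)"
  proof
    show "finite (Y \<times> (UNIV :: bool set))" by (rule fX)
    show "pair_gram Y p q (w, z) = cnj (pair_gram Y p q (z, w))" if zw: "z \<in> Y \<times> UNIV" "w \<in> Y \<times> UNIV" for z w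
    proof (rule LIMSEQ_unique[OF lim[OF zw(2,1)]])
      have "(\<lambda>m. cnj (\<Sum>n<m. pair_term p q n z w)) \<longlonglongrightarrow> cnj (pair_gram Y p q (z, w))"
        by (intro tendsto_cnj lim zw)
      moreover have "cnj (\<Sum>n<m. pair_term p q n z w) = (\<Sum>n<m. pair_term p q n w z)" for m
        by (simp add: pair_term_def algebra_simps)
      ultimately show "(\<lambda>m. \<Sum>n<m. pair_term p q n w z) \<longlonglongrightarrow> cnj (pair_gram Y p q (z, w))" by simp
    qed
    show "0 \<le> kquad (\<lambda>u v. pair_gram Y p q (u, v)) (Y \<times> UNIV) h" for h
      using kquad_tendsto[of "Y \<times> UNIV" "\<lambda>m x y. \<Sum>n<m. pair_term p q n x y", OF lim, of h]
      by (rule LIMSEQ_le_const) (use pos_kernel.nonneg[OF pos_kernel_sum_pair_term[OF fX]] in auto)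
  qed
  show "pair_gram Y p q ((z, False), (z, True)) = \<phi> z" if "z \<in> Y" for z
  proof (rule sums_unique2)
    show "(\<lambda>n. pair_term p q n (z, False) (z, True)) sums pair_gram Y p q ((z, False), (z, True))"
      using that by (intro pair_gram_sums) auto
    show "(\<lambda>n. pair_term p q n (z, False) (z, True)) sums \<phi> z"
      using prod[OF that] by (simp add: pair_term_def pair_vec_def mult.commute)
  qed
  show "pair_gram Y p q ((z, True), (w, True)) = cnj (pair_gram Y p q ((z, False), (w, False)))"
    if "z \<in> Y" "w \<in> Y" for z w
  proof (rule sums_unique2)
    show "(\<lambda>n. pair_term p q n (z, True) (w, True)) sums pair_gram Y p q ((z, True), (w, True))"
      using that by (intro pair_gram_sums) auto
    have "(\<lambda>n. cnj (pair_term p q n (z, False) (w, False))) sums cnj (pair_gram Y p q ((z, False), (w, False)))"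
      using that by (subst sums_cnj) (auto intro!: pair_gram_sums)
    then show "(\<lambda>n. pair_term p q n (z, True) (w, True)) sums cnj (pair_gram Y p q ((z, False), (w, False)))"
      by (simp add: pair_term_def pair_vec_def add.commute)
  qed
qed

text \<open>By the symmetrization the first diagonal block is the average of the Gram matrices of
  \<open>p\<close> and \<open>q\<close>, so each partial sum of its form is the average of two sums
  that are at most \<open>c\<close>.\<close>

lemma pair_gram_kquad_le:
  assumes J: "pos_kernel J Y"
    and p: "summable (\<lambda>n. kquad J Y (\<lambda>z. p n z * F z))" "(\<Sum>n. kquad J Y (\<lambda>z. p n z * F z)) \<le> c"
    and q: "summable (\<lambda>n. kquad J Y (\<lambda>z. q n z * F z))" "(\<Sum>n. kquad J Y (\<lambda>z. q n z * F z)) \<le> c"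
  shows "kquad (hadamard J (\<lambda>z w. pair_gram Y p q ((z, False), (w, False)))) Y F \<le> c"
proof -
  interpret J: pos_kernel J Y by fact
  have part: "kquad (hadamard J (\<lambda>z w. \<Sum>n<m. pair_term p q n (z, False) (w, False))) Y F
     = (\<Sum>n<m. kquad J Y (\<lambda>z. p n z * F z)) / 2 + (\<Sum>n<m. kquad J Y (\<lambda>z. q n z * F z)) / 2" for m
  proof (induction m)
    case 0
    show ?case by (simp add: kquad_def kform_def hadamard_def)
  next
    case (Suc m)
    have one: "kquad (hadamard J (\<lambda>z w. v z * cnj (v w))) Y F = kquad J Y (\<lambda>z. v z * F z)" for v
      using kquad_hadamard_gram[of Y "\<lambda>z w. v z * cnj (v w)" "\<lambda>_::nat. v" "{0}" J F] by simp
    have "kquad (hadamard J (\<lambda>z w. pair_term p q m (z, False) (w, False))) Y F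
       = kquad J Y (\<lambda>z. p m z * F z) / 2 + kquad J Y (\<lambda>z. q m z * F z) / 2"
      unfolding pair_term_rank_one kquad_hadamard_lin
      by (simp add: pair_vec_def one)
    moreover have "kquad (hadamard J (\<lambda>z w. \<Sum>n<Suc m. pair_term p q n (z, False) (w, False))) Y F
       = kquad (hadamard J (\<lambda>z w. \<Sum>n<m. pair_term p q n (z, False) (w, False))) Y F
         + kquad (hadamard J (\<lambda>z w. pair_term p q m (z, False) (w, False))) Y F"
      using kquad_hadamard_lin[of J 1 "\<lambda>z w. \<Sum>n<m. pair_term p q n (z, False) (w, False)" 1
          "\<lambda>z w. pair_term p q m (z, False) (w, False)" Y F] by simp
    ultimately show ?case using Suc by (simp add: add_divide_distrib)
  qed
  have le: "(\<Sum>n<m. kquad J Y (\<lambda>z. p n z * F z)) / 2 + (\<Sum>n<m. kquad J Y (\<lambda>z. q n z * F z)) / 2 \<le> c" for m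
  proof -
    have "(\<Sum>n<m. kquad J Y (\<lambda>z. p n z * F z)) \<le> c"
      by (rule order_trans[OF sum_le_suminf[OF p(1)] p(2)]) (auto simp: J.nonneg)
    moreover have "(\<Sum>n<m. kquad J Y (\<lambda>z. q n z * F z)) \<le> c"
      by (rule order_trans[OF sum_le_suminf[OF q(1)] q(2)]) (auto simp: J.nonneg)
    ultimately show ?thesis by simp
  qed
  have "(\<lambda>m. kquad (hadamard J (\<lambda>z w. \<Sum>n<m. pair_term p q n (z, False) (w, False))) Y F)
     \<longlonglongrightarrow> kquad (hadamard J (\<lambda>z w. pair_gram Y p q ((z, False), (w, False)))) Y F"
    unfolding hadamard_def using pair_gram_sums unfolding sums_def
    by (intro kquad_tendsto tendsto_mult tendsto_const) auto
  then show ?thesis unfolding part by (rule LIMSEQ_le_const2) (use le in auto)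
qed

end

text \<open>The extremal matrix writes \<open>\<phi>\<close> as \<open>\<nu>\<close> times the sum of the products \<open>\<beta> n * \<alpha> n\<close> for two
  contractive columns, and the column-row property makes one of them a row.\<close>

lemma (in dual_pick) weak_product_multiplier_bound:
  assumes c: "0 \<le> c"
    and hyp: "\<And>F c'. c < c' \<Longrightarrow> kquad J Y F = 1 \<Longrightarrow>
      \<exists>f g. summable (\<lambda>n. kquad J Y (f n)) \<and> (\<Sum>n. kquad J Y (f n)) \<le> c' \<and>
        summable (\<lambda>n. kquad J Y (g n)) \<and> (\<Sum>n. kquad J Y (g n)) \<le> c' \<and>
        (\<forall>z\<in>Y. (\<lambda>n. f n z * g n z) sums (\<phi> z * (F z)\<^sup>2))"
  shows "kquad k Y (\<lambda>z. \<phi> z * h z) \<le> c\<^sup>2 * kquad k Y h"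
proof (cases "Y = {}")
  case True
  then show ?thesis by (simp add: kquad_def kform_def)
next
  case False
  then obtain x0 where x0: "x0 \<in> Y" by blast
  define M where "M = Re (k x0 x0)"
  have M: "M > 0" using P.diag[OF x0] by (simp add: M_def)
  define e where "e z w = ((z :: 'x, False), (w :: 'x, False))" for z w
  define \<P> where "\<P> = product_matrices Y \<phi>"
  have fX: "finite (Y \<times> (UNIV :: bool set))" using k.fin by simp
  have ent: "pos_kernel (\<lambda>u v. Z (u, v)) (Y \<times> UNIV)" if "Z \<in> \<P>" for Z
    using that by (simp add: \<P>_def product_matrices_def)
  have psd: "pos_kernel (\<lambda>z w. Z (e z w)) Y" if Z: "Z \<in> \<P>" for Z
  proof -
    interpret Z: pos_kernel "\<lambda>u v. Z (u, v)" "Y \<times> UNIV" by (rule ent[OF Z])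
    show ?thesis
    proof
      show "finite Y" by (rule k.fin)
      show "Z (e w z) = cnj (Z (e z w))" if "z \<in> Y" "w \<in> Y" for z w
        unfolding e_def using that by (intro Z.herm) auto
      show "0 \<le> kquad (\<lambda>z w. Z (e z w)) Y h" for h
      proof -
        define h' where "h' x = (if snd x then 0 else h (fst x))" for x :: "'x \<times> bool"
        have "kform (\<lambda>u v. Z (u, v)) (Y \<times> UNIV) h' h' = kform (\<lambda>u v. Z (u, v)) (Y \<times> {False}) h' h'"
          by (rule kform_supp[OF fX]) (auto simp: h'_def)
        also have "\<dots> = kform (\<lambda>z w. Z (e z w)) Y h h"
        proof -
          have "(\<Sum>x\<in>Y \<times> {False}. f x) = (\<Sum>z\<in>Y. f (z, False))" for f :: "'x \<times> bool \<Rightarrow> complex"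
            by (rule sum.reindex_bij_witness[of _ "\<lambda>z. (z, False)" fst]) auto
          then show ?thesis unfolding kform_def by (simp add: h'_def e_def)
        qed
        finally show ?thesis using Z.nonneg[of h'] by (simp add: kquad_def)
      qed
    qed
  qed
  have bound: "kquad k Y (\<lambda>z. \<phi> z * h z) \<le> (c' + \<epsilon> * M)\<^sup>2 * kquad k Y h" if c': "c < c'" and eps: "0 < \<epsilon>" for c' \<epsilon>
  proof -
    \<comment> \<open>With linear term 0 the minimized quantity is the perturbed norm \<mu> itself,
      and coercivity is trivial with \<open>\<kappa> = 0\<close>.\<close>
    interpret E: extremal_problem k J Y \<P> e "\<lambda>_ _. 0" \<epsilon> 0 x0
    proof (rule extremal_problem.intro[OF dual_pick_axioms], rule extremal_problem_axioms.intro)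
      show "x0 \<in> Y" "\<epsilon> > 0" by fact+
      \<comment> \<open>The product of 1 and \<phi>, as a single term, shows that the feasible set
        is not empty.\<close>
      define p :: "nat \<Rightarrow> 'x \<Rightarrow> complex" where "p n z = (if n = 0 then 1 else 0)" for n z
      define q :: "nat \<Rightarrow> 'x \<Rightarrow> complex" where "q n z = (if n = 0 then \<phi> z else 0)" for n z
      have "(\<lambda>n. (cmod (p n z))\<^sup>2) = (\<lambda>n. if n = 0 then 1 else 0)" "(\<lambda>n. (cmod (q n z))\<^sup>2) = (\<lambda>n. if n = 0 then (cmod (\<phi> z))\<^sup>2 else 0)"
        "(\<lambda>n. p n z * q n z) = (\<lambda>n. if n = 0 then \<phi> z else 0)" for z
        by (auto simp: p_def q_def)
      then have "pair_gram Y p q \<in> \<P>" unfolding \<P>_def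
        using sums_single[of 0 "\<lambda>_. \<phi> z" for z] by (intro pair_gram_mem k.fin) simp_all
      then show "\<P> \<noteq> {}" by blast
      show "closed \<P>" unfolding \<P>_def product_matrices_def Ball_def
        by (intro closed_Collect_conj closed_Collect_all closed_Collect_imp_const closed_Collect_eq
            closed_pos_kernel fX continuous_intros continuous_on_coordinate)
      show "(\<lambda>x. complex_of_real (1 - t) * P x + complex_of_real t * Q x) \<in> \<P>"
        if "P \<in> \<P>" "Q \<in> \<P>" "0 \<le> t" "t \<le> 1" for P Q t
      proof -
        have "pos_kernel (\<lambda>u v. complex_of_real (1 - t) * P (u, v) + complex_of_real t * Q (u, v)) (Y \<times> UNIV)"
          using that by (intro pos_kernel_lin ent) auto
        then show ?thesis using that by (simp add: \<P>_def product_matrices_def algebra_simps)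
      qed
      show "pos_kernel (\<lambda>z w. P (e z w)) Y" if "P \<in> \<P>" for P by (rule psd[OF that])
      show "cmod (P x) \<le> \<mu>" if P: "P \<in> \<P>" and b: "\<And>z. z \<in> Y \<Longrightarrow> Re (P (e z z)) \<le> \<mu>" for P \<mu> x
      proof -
        interpret Z: pos_kernel "\<lambda>u v. P (u, v)" "Y \<times> UNIV" by (rule ent[OF P])
        show ?thesis
        proof (cases "x \<in> (Y \<times> UNIV) \<times> (Y \<times> UNIV)")
          case True
          have "Re (P (u, u)) \<le> \<mu>" if uY: "u \<in> Y \<times> UNIV" for u
          proof -
            obtain z s where u: "u = (z, s)" "z \<in> Y" using uY by auto
            have "P ((z, True), (z, True)) = cnj (P ((z, False), (z, False)))"
              using P u(2) by (simp add: \<P>_def product_matrices_def)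
            then show ?thesis using b[OF u(2)] u by (cases s) (auto simp: e_def)
          qed
          then show ?thesis using Z.entry_le[of \<mu> "fst x" "snd x"] True by auto
        next
          case False
          then have "P x = 0" using P unfolding \<P>_def product_matrices_def by blast
          then show ?thesis using b[OF x0] pos_kernel.diag_nonneg[OF psd[OF P] x0] by simp
        qed
      qed
    qed simp_all
    obtain \<mu> P F where P: "P \<in> \<P>" and BP: "\<And>G. E.B P G \<le> \<mu> * kquad J Y G"
      and F: "kquad J Y F = 1" "\<And>z. z \<in> Y \<Longrightarrow> F z \<noteq> 0" and BF: "E.B P F = \<mu> - \<epsilon> * (cmod (F x0))\<^sup>2"
      and var: "\<And>Q. Q \<in> \<P> \<Longrightarrow> E.B P F - E.lfun P \<le> E.B Q F - E.lfun Q"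
      using E.extremal_function by blast
    obtain f g where fg: "summable (\<lambda>n. kquad J Y (f n))" "(\<Sum>n. kquad J Y (f n)) \<le> c'"
        "summable (\<lambda>n. kquad J Y (g n))" "(\<Sum>n. kquad J Y (g n)) \<le> c'"
        "\<And>z. z \<in> Y \<Longrightarrow> (\<lambda>n. f n z * g n z) sums (\<phi> z * (F z)\<^sup>2)"
      using hyp[OF c' F(1)] by blast
    \<comment> \<open>Division by the zero free \<open>F\<close> turns the factorization of
      \<open>\<phi> z * (F z)\<^sup>2\<close> into one of \<phi>, hence into a competitor whose form
      at \<open>F\<close> is at most \<open>c'\<close>.\<close>
    define p where "p n z = f n z / F z" for n z
    define q where "q n z = g n z / F z" for n z
    have pf: "kquad J Y (\<lambda>z. p n z * F z) = kquad J Y (f n)" for n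
      by (rule kquad_cong) (simp add: p_def F)
    have qg: "kquad J Y (\<lambda>z. q n z * F z) = kquad J Y (g n)" for n
      by (rule kquad_cong) (simp add: q_def F)
    have sm: "summable (\<lambda>n. (cmod (u n z / F z))\<^sup>2)" if "summable (\<lambda>n. kquad J Y (u n))" "z \<in> Y" for u z
    proof -
      have "summable (\<lambda>n. (cmod (u n z))\<^sup>2)"
      proof (rule summable_comparison_test')
        show "summable (\<lambda>n. Re (k z z) * kquad J Y (u n))" by (rule summable_mult[OF that(1)])
        show "norm ((cmod (u n z))\<^sup>2) \<le> Re (k z z) * kquad J Y (u n)" for n
          using point_bound[OF that(2), of "u n"] by simp
      qed
      then show ?thesis unfolding norm_divide power_divide by (rule summable_divide)
    qed
    have smp: "summable (\<lambda>n. (cmod (p n z))\<^sup>2)" and smq: "summable (\<lambda>n. (cmod (q n z))\<^sup>2)"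
      if "z \<in> Y" for z
      unfolding p_def q_def using sm that fg by blast+
    have mem: "pair_gram Y p q \<in> \<P>" unfolding \<P>_def
    proof (rule pair_gram_mem)
      show "(\<lambda>n. p n z * q n z) sums \<phi> z" if z: "z \<in> Y" for z
        using sums_divide[OF fg(5)[OF z], of "(F z)\<^sup>2"] F(2)[OF z]
        by (simp add: p_def q_def power2_eq_square)
    qed (use k.fin smp smq in auto)
    have "E.B (pair_gram Y p q) F \<le> c'" unfolding E.B_def e_def
      by (rule pair_gram_kquad_le) (use k.fin J.pos_kernel_axioms smp smq fg in \<open>auto simp: pf qg\<close>)
    \<comment> \<open>At \<open>F\<close> the matrix \<open>P\<close> attains \<mu> up to the
      perturbation, and by the first order condition the competitor does no better there.\<close>
    with var[OF mem] BF have "\<mu> - \<epsilon> * (cmod (F x0))\<^sup>2 \<le> c'" by (simp add: E.lfun_def)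
    moreover have "\<epsilon> * (cmod (F x0))\<^sup>2 \<le> \<epsilon> * M"
      using point_bound[OF x0, of F] F(1) eps by (simp add: M_def)
    ultimately have \<mu>: "\<mu> \<le> c' + \<epsilon> * M" by simp
    define \<nu> where "\<nu> = c' + \<epsilon> * M"
    have \<nu>: "\<nu> > 0" using c c' eps M by (simp add: \<nu>_def add_pos_pos)
    have BP': "E.B P G \<le> \<nu> * kquad J Y G" for G
      using BP[of G] \<mu> J.nonneg[of G] unfolding \<nu>_def by (meson mult_right_mono order_trans)
    obtain N :: nat and v where v: "\<And>x y. x \<in> Y \<times> UNIV \<Longrightarrow> y \<in> Y \<times> UNIV \<Longrightarrow> P (x, y) = (\<Sum>n<N. v n x * cnj (v n y))"
      using pos_kernel_gram[OF fX ent[OF P]] by blast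
    define s where "s = complex_of_real (1 / sqrt \<nu>)"
    have s: "(cmod s)\<^sup>2 = 1 / \<nu>" using \<nu> by (simp add: s_def power_divide norm_divide)
    \<comment> \<open>The two halves of the Gram vectors, scaled to contractive columns. The second
      half is conjugated because its diagonal block is the conjugate of the first.\<close>
    define \<alpha> where "\<alpha> n z = s * v n (z, False)" for n z
    define \<beta> where "\<beta> n z = s * cnj (v n (z, True))" for n z
    have eq1: "P (e z w) = (\<Sum>n<N. v n (z, False) * cnj (v n (w, False)))" if "z \<in> Y" "w \<in> Y" for z w
      unfolding e_def using that by (intro v) auto
    have eq2: "P (e z w) = (\<Sum>n<N. cnj (v n (z, True)) * cnj (cnj (v n (w, True))))" if zw: "z \<in> Y" "w \<in> Y" for z w
    proof -
      have "P (e z w) = cnj (P ((z, True), (w, True)))"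
        using P zw by (simp add: \<P>_def product_matrices_def e_def)
      also have "\<dots> = cnj (\<Sum>n<N. v n (z, True) * cnj (v n (w, True)))" using zw by (subst v) auto
      finally show ?thesis by simp
    qed
    have sc: "(\<Sum>n<N. kquad J Y (\<lambda>z. s * u n z * G z)) \<le> kquad J Y G"
      if "\<And>z w. z \<in> Y \<Longrightarrow> w \<in> Y \<Longrightarrow> P (e z w) = (\<Sum>n<N. u n z * cnj (u n w))" for u G
    proof -
      have "(\<Sum>n<N. kquad J Y (\<lambda>z. u n z * G z)) \<le> kquad J Y G * \<nu>"
        unfolding mult.commute[of _ \<nu>] using BP'[of G] kquad_hadamard_gram[of Y "\<lambda>z w. P (e z w)" u "{..<N}" J G, OF that] by (simp add: E.B_def)
      moreover have "(\<Sum>n<N. kquad J Y (\<lambda>z. s * u n z * G z)) = (\<Sum>n<N. kquad J Y (\<lambda>z. u n z * G z)) / \<nu>"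
        unfolding mult.assoc kquad_scale s by (simp add: sum_divide_distrib)
      ultimately show ?thesis using \<nu> by (simp only: pos_divide_le_eq)
    qed
    have col\<alpha>: "col_contr k Y N \<alpha>" unfolding \<alpha>_def by (rule col_contr_if_dual, rule sc[OF eq1])
    have col\<beta>: "col_contr k Y N \<beta>" unfolding \<beta>_def by (rule col_contr_if_dual, rule sc[OF eq2])
    have "column_row k Y" by (rule column_row_property[OF k.pd_kernel_axioms P.pick_kernel_axioms])
    then have row\<alpha>: "row_contr k Y N \<alpha>" using col\<alpha> by (simp add: column_row_def)
    have \<phi>: "\<phi> z = of_real \<nu> * (\<Sum>n<N. \<beta> n z * \<alpha> n z)" if z: "z \<in> Y" for z
    proof -
      have "\<phi> z = P ((z, False), (z, True))" using P z by (simp add: \<P>_def product_matrices_def)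
      also have "\<dots> = (\<Sum>n<N. v n (z, False) * cnj (v n (z, True)))" using z by (intro v) auto
      finally have "\<phi> z = (\<Sum>n<N. v n (z, False) * cnj (v n (z, True)))" .
      moreover have "s * s = of_real (1 / \<nu>)" using \<nu> by (simp add: s_def flip: of_real_mult)
      then have "of_real \<nu> * (\<beta> n z * \<alpha> n z) = v n (z, False) * cnj (v n (z, True))" for n
      proof -
        assume "s * s = of_real (1 / \<nu>)"
        have "of_real \<nu> * (\<beta> n z * \<alpha> n z) = of_real \<nu> * (s * s) * (v n (z, False) * cnj (v n (z, True)))"
          by (simp add: \<alpha>_def \<beta>_def)
        also have "of_real \<nu> * (s * s) = 1" unfolding \<open>s * s = of_real (1 / \<nu>)\<close> using \<nu> by simp
        finally show ?thesis by simp
      qed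
      ultimately show ?thesis by (simp add: sum_distrib_left)
    qed
    have "kquad k Y (\<lambda>z. \<phi> z * h z) = kquad k Y (\<lambda>z. of_real \<nu> * (\<Sum>n<N. \<beta> n z * (\<alpha> n z * h z)))"
      by (rule kquad_cong) (simp add: \<phi> sum_distrib_right mult.assoc)
    also have "\<dots> = \<nu>\<^sup>2 * kquad k Y (\<lambda>z. \<Sum>n<N. \<beta> n z * (\<alpha> n z * h z))" unfolding kquad_scale by simp
    also have "kquad k Y (\<lambda>z. \<Sum>n<N. \<beta> n z * (\<alpha> n z * h z)) \<le> (\<Sum>n<N. kquad k Y (\<lambda>z. \<alpha> n z * h z))"
      by (rule col_contrD[OF col\<beta>])
    also have "\<dots> \<le> kquad k Y h" by (rule row_contrD[OF row\<alpha>])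
    finally show ?thesis unfolding \<nu>_def by (simp add: mult_left_mono)
  qed
  \<comment> \<open>The excess of \<open>c'\<close> over \<open>c\<close> and the perturbation
    \<epsilon> tend to 0 together.\<close>
  have "(\<lambda>n. (c + 1 / real (Suc n) + 1 / real (Suc n) * M)\<^sup>2 * kquad k Y h) \<longlonglongrightarrow> (c + 0 + 0 * M)\<^sup>2 * kquad k Y h"
    by (intro tendsto_intros LIMSEQ_Suc[OF lim_1_over_n])
  moreover have "kquad k Y (\<lambda>z. \<phi> z * h z) \<le> (c + 1 / real (Suc n) + 1 / real (Suc n) * M)\<^sup>2 * kquad k Y h" for n
    by (rule bound) auto
  ultimately have "kquad k Y (\<lambda>z. \<phi> z * h z) \<le> (c + 0 + 0 * M)\<^sup>2 * kquad k Y h"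
    by (intro LIMSEQ_le_const) blast+
  then show ?thesis by simp
qed

section \<open>Complete Pick kernels\<close>

text \<open>By the decomposition at \<open>p\<close>, a null vector \<open>h\<close> has all
  products \<open>b j z * h z\<close> null, and these live on \<open>Y\<close>, where the kernel is
  definite. So on \<open>Y\<close> the vector can be nonzero only where every \<open>b j\<close>
  vanishes, and there Cauchy-Schwarz for the pair with \<open>p\<close> would be an
  equality.\<close>

lemma pd_kernel_if_separated:
  assumes "finite Y" and "pick_kernel k Y"
    and "\<And>z w. z \<in> Y \<Longrightarrow> w \<in> Y \<Longrightarrow> z \<noteq> w \<Longrightarrow> (cmod (k z w))\<^sup>2 \<noteq> Re (k z z) * Re (k w w)"
  shows "pd_kernel k Y"
  using assms
proof (induction Y rule: finite_induct)
  case empty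
  then interpret pick_kernel k "{}" by simp
  show ?case by unfold_locales simp
next
  case (insert p Y)
  interpret P: pick_kernel k "insert p Y" by fact
  have "pick_kernel k Y" by (rule P.pick_subset) auto
  then interpret Y: pd_kernel k Y using insert.IH insert.prems(2) by blast
  obtain m :: nat and b where
    dec: "\<And>z w. z \<in> insert p Y \<Longrightarrow> w \<in> insert p Y \<Longrightarrow> k z w = k z p * k p w / k p p + k z w * (\<Sum>j<m. b j z * cnj (b j w))"
    and quad: "\<And>h. kquad k (insert p Y) h = (cmod (\<Sum>z\<in>insert p Y. k z p * h z))\<^sup>2 / Re (k p p)
        + (\<Sum>j<m. kquad k (insert p Y) (\<lambda>z. b j z * h z))"
    and bp: "\<And>j. j < m \<Longrightarrow> b j p = 0"
    using P.pick_decomposition[OF insertI1] by blast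
  have supp: "kquad k (insert p Y) h = kquad k Y h" if "h p = 0" for h
    unfolding kquad_def by (subst kform_supp[OF P.fin, of Y h h k]) (use that in auto)
  show ?case
  proof
    fix h z assume h: "kquad k (insert p Y) h = 0" and z: "z \<in> insert p Y"
    have nn: "0 \<le> (cmod (\<Sum>z\<in>insert p Y. k z p * h z))\<^sup>2 / Re (k p p)" using P.diag(2)[of p] by simp
    have nn2: "0 \<le> (\<Sum>j<m. kquad k (insert p Y) (\<lambda>z. b j z * h z))" by (intro sum_nonneg P.nonneg)
    have "(\<Sum>j<m. kquad k (insert p Y) (\<lambda>z. b j z * h z)) = 0"
      using quad[of h] h nn nn2 by linarith
    then have q0: "kquad k (insert p Y) (\<lambda>z. b j z * h z) = 0" if "j < m" for j
      using that P.nonneg by (simp add: sum_nonneg_eq_0_iff)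
    have hY: "h w = 0" if w: "w \<in> Y" for w
    proof (rule ccontr)
      assume hw: "h w \<noteq> 0"
      have "b j w = 0" if j: "j < m" for j
      proof -
        have "kquad k Y (\<lambda>z. b j z * h z) = 0" using q0[OF j] supp[of "\<lambda>z. b j z * h z"] bp[OF j] by simp
        then have "b j w * h w = 0" using Y.definite w by blast
        then show ?thesis using hw by simp
      qed
      then have "k w w = k w p * k p w / k p p" using dec[of w w] w by simp
      moreover have "k p w = cnj (k w p)" using P.herm[of w p] w by simp
      ultimately have "k w w * k p p = of_real ((cmod (k w p))\<^sup>2)"
        using P.nonzero[of p p] unfolding complex_norm_square by simp
      moreover have "k w w = of_real (Re (k w w))" "k p p = of_real (Re (k p p))"
        using P.diag(1)[of w] P.diag(1)[of p] w by auto
      ultimately have "complex_of_real (Re (k w w) * Re (k p p)) = of_real ((cmod (k w p))\<^sup>2)"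
        by (metis of_real_mult)
      then have "(cmod (k w p))\<^sup>2 = Re (k w w) * Re (k p p)" unfolding of_real_eq_iff by simp
      then show False using insert.prems(2)[of w p] w insert.hyps by blast
    qed
    have "kquad k (insert p Y) h = kquad k (insert p Y) (\<lambda>w. h w * (if w = p then 1 else 0))"
      by (rule kquad_cong) (use hY in auto)
    then have "(cmod (h p))\<^sup>2 * Re (k p p) = 0" using h kquad_single[OF P.fin, of p k h 1] by simp
    then have "h p = 0" using P.diag(2)[of p] by simp
    then show "h z = 0" using z hY by blast
  qed
qed

lemma unit_ball_summable: "u \<in> unit_ball d \<Longrightarrow> summable (\<lambda>n. (cmod (u n))\<^sup>2)"
  by (simp add: unit_ball_def)

lemma l2_inner_summable:
  assumes "u \<in> unit_ball d" "v \<in> unit_ball d"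
  shows "summable (\<lambda>n. u n * cnj (v n))"
  using summable_mult_of_squares[of u "\<lambda>n. cnj (v n)"] assms by (simp add: unit_ball_summable)

lemma cmod_l2_inner_less:
  assumes u: "u \<in> unit_ball d" and v: "v \<in> unit_ball d"
  shows "cmod (l2_inner u v) < 1"
proof -
  have su: "summable (\<lambda>n. (cmod (u n))\<^sup>2)" and sv: "summable (\<lambda>n. (cmod (v n))\<^sup>2)"
    using u v by (simp_all add: unit_ball_summable)
  have le: "cmod (u n * cnj (v n)) \<le> ((cmod (u n))\<^sup>2 + (cmod (v n))\<^sup>2) / 2" for n
    using sum_squares_bound[of "cmod (u n)" "cmod (v n)"] by (simp add: norm_mult)
  have s: "summable (\<lambda>n. ((cmod (u n))\<^sup>2 + (cmod (v n))\<^sup>2) / 2)" by (intro summable_divide summable_add su sv)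
  have sn: "summable (\<lambda>n. cmod (u n * cnj (v n)))" by (rule summable_comparison_test'[OF s]) (use le in simp)
  have "cmod (l2_inner u v) \<le> (\<Sum>n. cmod (u n * cnj (v n)))"
    unfolding l2_inner_def by (rule summable_norm[OF sn])
  also have "\<dots> \<le> (\<Sum>n. ((cmod (u n))\<^sup>2 + (cmod (v n))\<^sup>2) / 2)" by (rule suminf_le[OF le sn s])
  also have "\<dots> = ((\<Sum>n. (cmod (u n))\<^sup>2) + (\<Sum>n. (cmod (v n))\<^sup>2)) / 2"
    using suminf_divide[OF summable_add[OF su sv], of 2] suminf_add[OF su sv] by simp
  also have "\<dots> < 1" using u v by (simp add: unit_ball_def)
  finally show ?thesis .
qed

lemma pos_kernel_l2_inner:
  assumes Y: "finite Y" and b: "\<And>z. z \<in> Y \<Longrightarrow> b z \<in> unit_ball d"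
  shows "pos_kernel (\<lambda>z w. l2_inner (b z) (b w)) Y"
proof
  show "finite Y" by fact
  have sums: "(\<lambda>n. b z n * cnj (b w n)) sums l2_inner (b z) (b w)" if "z \<in> Y" "w \<in> Y" for z w
    unfolding l2_inner_def by (rule summable_sums[OF l2_inner_summable[OF b b]]) fact+
  show "l2_inner (b w) (b z) = cnj (l2_inner (b z) (b w))" if "z \<in> Y" "w \<in> Y" for z w
  proof (rule sums_unique2[OF sums[OF that(2,1)]])
    have "(\<lambda>n. cnj (b z n * cnj (b w n))) sums cnj (l2_inner (b z) (b w))"
      unfolding sums_cnj by (rule sums[OF that])
    then show "(\<lambda>n. b w n * cnj (b z n)) sums cnj (l2_inner (b z) (b w))" by (simp add: mult.commute)
  qed
  fix h
  have part: "0 \<le> kquad (\<lambda>z w. \<Sum>n<m. b z n * cnj (b w n)) Y h" for m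
  proof -
    have "kquad (\<lambda>z w. \<Sum>n<m. b z n * cnj (b w n)) Y h = (\<Sum>n<m. kquad (\<lambda>z w. 1) Y (\<lambda>z. b z n * h z))"
      using kquad_schur_sum[of "\<lambda>z w. 1" "\<lambda>n z. b z n" "{..<m}" Y h] by simp
    also have "\<dots> = (\<Sum>n<m. (cmod (\<Sum>z\<in>Y. b z n * h z))\<^sup>2)"
      using kquad_rank_one[of "\<lambda>_. 1" Y] by simp
    finally show ?thesis by (simp add: sum_nonneg)
  qed
  have "(\<lambda>m. kquad (\<lambda>z w. \<Sum>n<m. b z n * cnj (b w n)) Y h) \<longlonglongrightarrow> kquad (\<lambda>z w. l2_inner (b z) (b w)) Y h"
    by (rule kquad_tendsto) (use sums in \<open>simp add: sums_def\<close>)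
  then show "0 \<le> kquad (\<lambda>z w. l2_inner (b z) (b w)) Y h"
    by (rule LIMSEQ_le_const) (use part in blast)
qed

text \<open>Positivity of the numerator after moving the base point of \<open>1 / (1 - \<beta>)\<close> to \<open>p\<close>.\<close>

lemma pos_kernel_change_base:
  assumes \<beta>: "pos_kernel \<beta> Y" and p: "p \<in> Y" and le: "Re (\<beta> p p) \<le> 1"
  shows "pos_kernel (\<lambda>z w. (1 - \<beta> z p) * (1 - \<beta> p w) - (1 - \<beta> z w) * (1 - \<beta> p p)) Y"
    (is "pos_kernel ?N Y")
proof -
  interpret \<beta>: pos_kernel \<beta> Y by fact
  define r where "r = Re (\<beta> p p)"
  have pp: "\<beta> p p = of_real r" using \<beta>.herm[OF p p] by (simp add: r_def complex_eq_iff)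
  have r: "0 \<le> r" "r \<le> 1" using \<beta>.diag_nonneg[OF p] le by (auto simp: r_def)
  define u where "u z = 1 - \<beta> z p" for z
  have pw: "1 - \<beta> p w = cnj (u w)" if "w \<in> Y" for w using \<beta>.herm[OF that p] by (simp add: u_def)
  show ?thesis
  proof
    show "finite Y" by (rule \<beta>.fin)
    show "(1 - \<beta> w p) * (1 - \<beta> p z) - (1 - \<beta> w z) * (1 - \<beta> p p) =
        cnj ((1 - \<beta> z p) * (1 - \<beta> p w) - (1 - \<beta> z w) * (1 - \<beta> p p))" if "z \<in> Y" "w \<in> Y" for z w
      using \<beta>.herm[OF that] unfolding pw[OF that(1)] pw[OF that(2)] by (simp add: u_def pp mult.commute)
    fix h :: "_ \<Rightarrow> complex"
    define A where "A = (\<Sum>z\<in>Y. h z)"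
    define L where "L = (\<Sum>z\<in>Y. \<beta> z p * h z)"
    define B where "B = kquad \<beta> Y h"
    have B: "(cmod L)\<^sup>2 \<le> r * B"
      using \<beta>.kform_cauchy[of h "\<lambda>w. if w = p then 1 else 0"] kform_delta_right[OF \<beta>.fin p, of \<beta> h] kform_delta[OF \<beta>.fin p p, of \<beta>]
      by (simp add: L_def B_def r_def kquad_def mult.commute)
    have B0: "0 \<le> B" unfolding B_def by (rule \<beta>.nonneg)
    have "kquad ?N Y h
       = kquad (\<lambda>z w. of_real 1 * (u z * cnj (u w)) + of_real (1 - r) * (of_real (-1) * (1 * cnj 1) + of_real 1 * \<beta> z w)) Y h"
      unfolding kquad_def
    proof (intro arg_cong[where f = Re] kform_cong refl)
      fix z w assume "z \<in> Y" "w \<in> Y"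
      then show "(1 - \<beta> z p) * (1 - \<beta> p w) - (1 - \<beta> z w) * (1 - \<beta> p p) =
         of_real 1 * (u z * cnj (u w)) + of_real (1 - r) * (of_real (-1) * (1 * cnj 1) + of_real 1 * \<beta> z w)"
        unfolding pw[OF \<open>w \<in> Y\<close>] pp by (simp add: u_def algebra_simps)
    qed
    also have "\<dots> = (cmod (\<Sum>z\<in>Y. u z * h z))\<^sup>2 + (1 - r) * (B - (cmod A)\<^sup>2)"
      unfolding kquad_lin kquad_rank_one by (simp add: B_def A_def)
    also have "(\<Sum>z\<in>Y. u z * h z) = A - L"
      by (simp add: u_def A_def L_def left_diff_distrib sum_subtractf)
    finally have eq: "kquad ?N Y h
      = (cmod (A - L))\<^sup>2 + (1 - r) * (B - (cmod A)\<^sup>2)" .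
    show "0 \<le> kquad ?N Y h"
      unfolding eq
    proof (cases "r = 0")
      case True
      then have "L = 0" using B by simp
      then show "0 \<le> (cmod (A - L))\<^sup>2 + (1 - r) * (B - (cmod A)\<^sup>2)" using True B0 by simp
    next
      case False
      \<comment> \<open>Completing the square: \<open>r\<close> times the form is the squared
        modulus of \<open>r * A - L\<close> plus a nonnegative multiple of the slack in the bound
        \<open>B\<close> for \<open>L\<close>.\<close>
      have "r * (cmod (A - L))\<^sup>2 - (1 - r) * r * (cmod A)\<^sup>2 + (1 - r) * (cmod L)\<^sup>2 = (cmod (of_real r * A - L))\<^sup>2"
        unfolding cmod_power2 by (simp add: power2_eq_square algebra_simps)
      moreover have "(1 - r) * (cmod L)\<^sup>2 \<le> (1 - r) * (r * B)" using B r by (intro mult_left_mono) auto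
      moreover have "0 \<le> (cmod (of_real r * A - L))\<^sup>2" by simp
      moreover have "r * ((cmod (A - L))\<^sup>2 + (1 - r) * (B - (cmod A)\<^sup>2)) =
          (r * (cmod (A - L))\<^sup>2 - (1 - r) * r * (cmod A)\<^sup>2 + (1 - r) * (cmod L)\<^sup>2)
          + ((1 - r) * (r * B) - (1 - r) * (cmod L)\<^sup>2)" by (simp add: algebra_simps)
      ultimately have "0 \<le> r * ((cmod (A - L))\<^sup>2 + (1 - r) * (B - (cmod A)\<^sup>2))" by linarith
      then show "0 \<le> (cmod (A - L))\<^sup>2 + (1 - r) * (B - (cmod A)\<^sup>2)" using r False by (simp add: zero_le_mult_iff)
    qed
  qed
qed

text \<open>The Pick identity is needed at every \<open>p\<close>, not only at the point where
  \<open>b\<close> vanishes. There \<open>1 - K z p * K p w / (K p p * K z w)\<close> is the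
  numerator of \<open>pos_kernel_change_base\<close> with rows and columns rescaled by kernel
  values, hence positive and a Gram matrix.\<close>

lemma pick_kernel_of_l2_inner:
  assumes K: "pos_kernel K Y" and b: "\<And>z. z \<in> Y \<Longrightarrow> b z \<in> unit_ball d"
    and eq: "\<And>z w. z \<in> Y \<Longrightarrow> w \<in> Y \<Longrightarrow> K z w = 1 / (1 - l2_inner (b z) (b w))"
  shows "pick_kernel K Y"
proof -
  interpret K: pos_kernel K Y by fact
  define \<beta> where "\<beta> z w = l2_inner (b z) (b w)" for z w
  interpret \<beta>: pos_kernel \<beta> Y unfolding \<beta>_def by (rule pos_kernel_l2_inner[OF K.fin b])
  have lt: "cmod (\<beta> z w) < 1" if "z \<in> Y" "w \<in> Y" for z w unfolding \<beta>_def by (rule cmod_l2_inner_less[OF b b]) fact+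
  have ne: "1 - \<beta> z w \<noteq> 0" if "z \<in> Y" "w \<in> Y" for z w
  proof
    assume "1 - \<beta> z w = 0"
    then have "\<beta> z w = 1" by simp
    then show False using lt[OF that] by simp
  qed
  have Keq: "K z w = 1 / (1 - \<beta> z w)" if "z \<in> Y" "w \<in> Y" for z w unfolding \<beta>_def by (rule eq) fact+
  show ?thesis
  proof
    show "K z w \<noteq> 0" if "z \<in> Y" "w \<in> Y" for z w using Keq[OF that] ne[OF that] by simp
    fix p assume p: "p \<in> Y"
    define N where "N z w = (1 - \<beta> z p) * (1 - \<beta> p w) - (1 - \<beta> z w) * (1 - \<beta> p p)" for z w
    interpret N: pos_kernel N Y
      unfolding N_def using lt[OF p p] complex_Re_le_cmod[of "\<beta> p p"]
      by (intro pos_kernel_change_base \<beta>.pos_kernel_axioms p) simp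
    define E where "E z w = N z w * (K z p * cnj (K w p))" for z w
    have "pos_kernel E Y"
    proof
      show "finite Y" by (rule K.fin)
      show "E w z = cnj (E z w)" if "z \<in> Y" "w \<in> Y" for z w
        unfolding E_def using N.herm[OF that] by (simp add: mult.commute)
      show "0 \<le> kquad E Y h" for h unfolding E_def kquad_schur by (rule N.nonneg)
    qed
    from pos_kernel_gram[OF K.fin this] obtain m :: nat and v where
      v: "\<And>z w. z \<in> Y \<Longrightarrow> w \<in> Y \<Longrightarrow> E z w = (\<Sum>j<m. v j z * cnj (v j w))" by blast
    have "K z w = K z p * K p w / K p p + K z w * (\<Sum>j<m. v j z * cnj (v j w))" if zw: "z \<in> Y" "w \<in> Y" for z w
    proof -
      have "cnj (K w p) = K p w" using K.herm[OF zw(2) p] by simp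
      then have "E z w = N z w / ((1 - \<beta> z p) * (1 - \<beta> p w))"
        unfolding E_def by (simp add: Keq zw p)
      also have "\<dots> = 1 - (1 - \<beta> z w) * (1 - \<beta> p p) / ((1 - \<beta> z p) * (1 - \<beta> p w))"
        unfolding N_def using ne[OF zw(1) p] ne[OF p zw(2)] by (simp add: diff_divide_distrib)
      finally have E: "E z w = 1 - (1 - \<beta> z w) * (1 - \<beta> p p) / ((1 - \<beta> z p) * (1 - \<beta> p w))" .
      have "K z w * E z w = K z w - K z p * K p w / K p p"
      proof -
        have "1 / a * (1 - a * d / (b * c)) = 1 / a - 1 / b * (1 / c) / (1 / d)" if "a \<noteq> 0" for a b c d :: complex
          using that by (simp add: right_diff_distrib)
        from this[OF ne[OF zw]] show ?thesis unfolding E Keq[OF zw] Keq[OF zw(1) p] Keq[OF p zw(2)] Keq[OF p p] .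
      qed
      then show ?thesis using v[OF zw] by simp
    qed
    then show "\<exists>(m::nat) b. \<forall>z\<in>Y. \<forall>w\<in>Y. K z w = K z p * K p w / K p p + K z w * (\<Sum>j<m. b j z * cnj (b j w))"
      by blast
  qed
qed

section \<open>Bounded multiplication operators\<close>

text \<open>The signs are chosen so that each partial sum is already large for \<open>W n\<close>; the tail is too small to
  undo this.\<close>

lemma gliding_hump:
  fixes W :: "nat \<Rightarrow> ('x \<Rightarrow> complex) \<Rightarrow> real \<Rightarrow> bool" and u :: "nat \<Rightarrow> 'x \<Rightarrow> complex" and C :: "nat \<Rightarrow> real"
  assumes mono: "\<And>n a c d. W n a c \<Longrightarrow> c \<le> d \<Longrightarrow> W n a d"
    and diff: "\<And>n a b c d. W n a c \<Longrightarrow> W n b d \<Longrightarrow> W n (\<lambda>x. a x - b x) (c + d)"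
    and scale: "\<And>n a c t. W n a c \<Longrightarrow> 0 < t \<Longrightarrow> W n (\<lambda>x. complex_of_real t * a x) (t * c)"
    and big: "\<And>n. 4 ^ n \<le> C n"
    and hump: "\<And>n. \<not> W n (u n) (9/10 * C n)"
    and summ: "\<And>x. summable (\<lambda>m. (1/3) ^ m * cmod (u m x))"
    and tail: "\<And>n s. (\<And>m. cmod (s m) = (1/3) ^ m) \<Longrightarrow>
      W n (\<lambda>x. \<Sum>m. s (m + Suc n) * u (m + Suc n) x) (C n * (1/3) ^ n / 2)"
  shows "\<exists>s :: nat \<Rightarrow> complex. (\<forall>m. cmod (s m) = (1/3) ^ m) \<and>
    (\<forall>c. \<exists>n. \<not> W n (\<lambda>x. \<Sum>m. s m * u m x) c)"
proof -
  define v where "v n x = (1/3) ^ n * u n x" for n x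
  define c0 where "c0 n = 9/10 * C n * (1/3) ^ n" for n
  \<comment> \<open>At least one sign leaves the partial sum above \<open>c0 n\<close>: the two
    choices differ by \<open>2 * v n\<close>, and \<open>u n\<close> exceeds
    \<open>9/10 * C n\<close>.\<close>
  define step :: "nat \<Rightarrow> ('x \<Rightarrow> complex) \<Rightarrow> complex" where
    "step n p = (if W n (\<lambda>x. p x + v n x) (c0 n) then - ((1/3) ^ n) else (1/3) ^ n)" for n p
  define P where "P = rec_nat (\<lambda>x. 0) (\<lambda>n p x. p x + step n p * u n x)"
  have P0: "P 0 x = 0" for x by (simp add: P_def)
  have PS: "P (Suc n) x = P n x + step n (P n) * u n x" for n x by (simp add: P_def)
  define s where "s n = step n (P n)" for n
  have s: "cmod (s m) = (1/3) ^ m" for m by (simp add: s_def step_def norm_power norm_divide)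
  have not_small: "\<not> W n (P (Suc n)) (c0 n)" for n
  proof (cases "W n (\<lambda>x. P n x + v n x) (c0 n)")
    case False
    then have "P (Suc n) = (\<lambda>x. P n x + v n x)" by (simp add: fun_eq_iff PS step_def v_def)
    then show ?thesis using False by simp
  next
    case True
    then have eq: "P (Suc n) = (\<lambda>x. P n x - v n x)" by (simp add: fun_eq_iff PS step_def v_def)
    show ?thesis
    proof
      assume "W n (P (Suc n)) (c0 n)"
      then have "W n (\<lambda>x. (P n x + v n x) - (P n x - v n x)) (c0 n + c0 n)"
        using diff[OF True] unfolding eq by blast
      then have "W n (\<lambda>x. complex_of_real (3 ^ n / 2) * ((P n x + v n x) - (P n x - v n x))) (3 ^ n / 2 * (c0 n + c0 n))"
        by (rule scale) simp
      moreover have "(\<lambda>x. complex_of_real (3 ^ n / 2) * ((P n x + v n x) - (P n x - v n x))) = u n"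
        by (simp add: fun_eq_iff v_def power_one_over)
      moreover have "3 ^ n / 2 * (c0 n + c0 n) = 9/10 * C n" by (simp add: c0_def power_one_over)
      ultimately have "W n (u n) (9/10 * C n)" by (simp only:)
      then show False using hump by blast
    qed
  qed
  define h where "h x = (\<Sum>m. s m * u m x)" for x
  have sm: "summable (\<lambda>m. s m * u m x)" for x
  proof (rule summable_comparison_test'[OF summ[of x]])
    show "norm (s m * u m x) \<le> (1/3) ^ m * cmod (u m x)" for m
      by (simp add: norm_mult s)
  qed
  have Psum: "P n x = (\<Sum>m<n. s m * u m x)" for n x
    by (induction n) (simp_all add: P0 PS s_def)
  have "\<exists>n. \<not> W n h c" for c
  proof (rule ccontr)
    assume "\<not> (\<exists>n. \<not> W n h c)"
    then have Wh: "W n h c" for n by blast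
    \<comment> \<open>The tail takes away half of \<open>C n * (1/3) ^ n\<close>, so
      \<open>9/10 - 1/2 = 2/5\<close> of it remains. This is at least
      \<open>2/5 * (4/3) ^ n\<close>, which exceeds \<open>c\<close> for this
      \<open>n\<close>.\<close>
    obtain n where n: "5/2 * c < (4/3) ^ n" using real_arch_pow[of "4/3" "5/2 * c"] by auto
    have "W n (\<lambda>x. h x - (\<Sum>m. s (m + Suc n) * u (m + Suc n) x)) (c + C n * (1/3) ^ n / 2)"
      by (rule diff[OF Wh tail[OF s]])
    moreover have "(\<lambda>x. h x - (\<Sum>m. s (m + Suc n) * u (m + Suc n) x)) = P (Suc n)"
      unfolding h_def suminf_split_initial_segment[OF sm, where k = "Suc n"] Psum by (simp add: fun_eq_iff)
    ultimately have "W n (P (Suc n)) (c + C n * (1/3) ^ n / 2)" by simp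
    moreover have "c + C n * (1/3) ^ n / 2 \<le> c0 n"
    proof -
      have "(4/3) ^ n = 4 ^ n * (1/3 :: real) ^ n" by (simp add: power_divide)
      also have "\<dots> \<le> C n * (1/3) ^ n" using big[of n] by (intro mult_right_mono) auto
      finally show ?thesis using n by (simp add: c0_def)
    qed
    ultimately show False using mono not_small by blast
  qed
  then show ?thesis using s unfolding h_def[abs_def] by blast
qed

text \<open>For \<open>N = Suc n\<close> the total weight is \<open>(1/3) ^ n / 2\<close>, which is
  the tail allowed in \<open>gliding_hump\<close>.\<close>

lemma geometric_third: "(\<lambda>m. (1/3 :: real) ^ (m + N)) sums ((1/3) ^ N * (3/2))"
proof -
  have "(\<lambda>m. (1/3 :: real) ^ N * (1/3) ^ m) sums ((1/3) ^ N * (1 / (1 - 1/3)))"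
    by (intro sums_mult geometric_sums) simp
  then show ?thesis by (simp add: power_add mult.commute)
qed

section \<open>Hilbert space geometry and evaluation functionals\<close>

context separable_rkhs
begin

abbreviation nrm :: "('x \<Rightarrow> complex) \<Rightarrow> real" where "nrm \<equiv> ip_norm ip"

lemma diff_mem: "f \<in> H \<Longrightarrow> g \<in> H \<Longrightarrow> (\<lambda>x. f x - g x) \<in> H"
  using add_mem[of f "\<lambda>x. (-1) * g x"] scale_mem[of g "-1"] by simp

lemma ip_add_right: "f \<in> H \<Longrightarrow> g \<in> H \<Longrightarrow> h \<in> H \<Longrightarrow> ip h (\<lambda>x. f x + g x) = ip h f + ip h g"
  using ip_cnj[of "\<lambda>x. f x + g x" h] ip_cnj[of f h] ip_cnj[of g h] ip_add[of f g h] add_mem by simp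

lemma ip_scale_right: "f \<in> H \<Longrightarrow> h \<in> H \<Longrightarrow> ip h (\<lambda>x. c * f x) = cnj c * ip h f"
  using ip_cnj[of "\<lambda>x. c * f x" h] ip_cnj[of f h] ip_scale[of f h c] scale_mem by simp

lemma nrm_nonneg: "f \<in> H \<Longrightarrow> 0 \<le> nrm f"
  using ip_nonneg by (simp add: ip_norm_def)

lemma nrm_sq: "f \<in> H \<Longrightarrow> (nrm f)\<^sup>2 = Re (ip f f)"
  using ip_nonneg by (simp add: ip_norm_def)

lemma nrm_add_sq:
  assumes "f \<in> H" "g \<in> H"
  shows "(nrm (\<lambda>x. f x + c * g x))\<^sup>2 = (nrm f)\<^sup>2 + 2 * Re (cnj c * ip f g) + (cmod c)\<^sup>2 * (nrm g)\<^sup>2"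
proof -
  have cg: "(\<lambda>x. c * g x) \<in> H" using assms scale_mem by blast
  have s: "(\<lambda>x. f x + c * g x) \<in> H" using assms cg add_mem by blast
  have "ip (\<lambda>x. f x + c * g x) (\<lambda>x. f x + c * g x) = ip f f + cnj c * ip f g + cnj (cnj c * ip f g) + (c * cnj c) * ip g g"
    using assms cg s ip_cnj[of f g]
    by (simp add: ip_add ip_add_right ip_scale ip_scale_right)
  then have "Re (ip (\<lambda>x. f x + c * g x) (\<lambda>x. f x + c * g x)) = Re (ip f f) + 2 * Re (cnj c * ip f g) + (cmod c)\<^sup>2 * Re (ip g g)"
    unfolding complex_norm_square[symmetric] by simp
  then show ?thesis using assms s by (simp add: nrm_sq)
qed

lemma ip_cauchy:
  assumes "f \<in> H" "g \<in> H"
  shows "(cmod (ip f g))\<^sup>2 \<le> (nrm f)\<^sup>2 * (nrm g)\<^sup>2"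
proof (rule discriminant_bound)
  fix t :: complex
  show "0 \<le> (nrm f)\<^sup>2 + 2 * Re (t * ip f g) + (cmod t)\<^sup>2 * (nrm g)\<^sup>2"
    using nrm_add_sq[OF assms, of "cnj t"] by (metis complex_cnj_cnj complex_mod_cnj zero_le_power2)
qed auto

lemma ip_le:
  assumes "f \<in> H" "g \<in> H"
  shows "cmod (ip f g) \<le> nrm f * nrm g"
proof (rule power2_le_imp_le)
  show "(cmod (ip f g))\<^sup>2 \<le> (nrm f * nrm g)\<^sup>2"
    unfolding power_mult_distrib by (rule ip_cauchy[OF assms])
qed (use assms nrm_nonneg in simp)

lemma nrm_scale: "f \<in> H \<Longrightarrow> nrm (\<lambda>x. c * f x) = cmod c * nrm f"
proof -
  assume f: "f \<in> H"
  have "ip (\<lambda>x. c * f x) (\<lambda>x. c * f x) = (c * cnj c) * ip f f"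
    using f scale_mem by (simp add: ip_scale ip_scale_right)
  then have "(nrm (\<lambda>x. c * f x))\<^sup>2 = (cmod c * nrm f)\<^sup>2"
    unfolding complex_norm_square[symmetric] using f scale_mem by (simp add: nrm_sq power_mult_distrib)
  then show ?thesis using nrm_nonneg f scale_mem by (simp add: power2_eq_iff_nonneg)
qed

lemma nrm_triangle:
  assumes "f \<in> H" "g \<in> H"
  shows "nrm (\<lambda>x. f x + g x) \<le> nrm f + nrm g"
proof (rule power2_le_imp_le)
  have "Re (ip f g) \<le> nrm f * nrm g" using ip_le[OF assms] complex_Re_le_cmod[of "ip f g"] by linarith
  then show "(nrm (\<lambda>x. f x + g x))\<^sup>2 \<le> (nrm f + nrm g)\<^sup>2"
    using nrm_add_sq[OF assms, of 1] by (simp add: power2_sum)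
qed (use assms nrm_nonneg in simp)

lemma nrm_diff_commute: "f \<in> H \<Longrightarrow> g \<in> H \<Longrightarrow> nrm (\<lambda>x. f x - g x) = nrm (\<lambda>x. g x - f x)"
  using nrm_scale[OF diff_mem[of f g], of "-1"] by simp

lemma nrm_diff_sq:
  assumes "f \<in> H" "g \<in> H" "ip f g = of_real ((nrm g)\<^sup>2)"
  shows "(nrm (\<lambda>x. f x - g x))\<^sup>2 = (nrm f)\<^sup>2 - (nrm g)\<^sup>2"
  using nrm_add_sq[OF assms(1,2), of "-1"] assms(3) by simp

lemma nrm_zero: "nrm (\<lambda>x. 0) = 0"
  using nrm_scale[OF zero_mem, of 0] by simp

lemma kernel_nrm_sq: "(nrm (\<lambda>z. K z x))\<^sup>2 = Re (K x x)"
  using nrm_sq[OF kernel_mem, of x] reproducing[OF kernel_mem, of x x] by simp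

lemma eval_le: "f \<in> H \<Longrightarrow> cmod (f x) \<le> nrm f * nrm (\<lambda>z. K z x)"
  using ip_le[OF _ kernel_mem, of f x] reproducing[of f x] by simp

lemma kernel_cnj: "K y x = cnj (K x y)"
  using reproducing[OF kernel_mem, of x y] reproducing[OF kernel_mem, of y x] ip_cnj[OF kernel_mem kernel_mem, of x y] by simp

lemma kapply_mem: "finite Y \<Longrightarrow> kapply K Y a \<in> H"
proof (induction Y rule: finite_induct)
  case empty
  show ?case using zero_mem by (simp add: kapply_def[abs_def])
next
  case (insert p Y)
  have "(\<lambda>z. cnj (a p) * K z p + kapply K Y a z) \<in> H"
    by (intro add_mem scale_mem kernel_mem insert.IH)
  moreover have "(\<lambda>z. cnj (a p) * K z p + kapply K Y a z) = kapply K (insert p Y) a"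
    using insert.hyps by (simp add: kapply_insert fun_eq_iff mult.commute)
  ultimately show ?case by simp
qed

lemma ip_kapply: "finite Y \<Longrightarrow> f \<in> H \<Longrightarrow> ip f (kapply K Y a) = (\<Sum>w\<in>Y. f w * a w)"
proof (induction Y rule: finite_induct)
  case empty
  have "ip f (\<lambda>x. 0) = 0" using ip_scale_right[OF zero_mem empty, of 0] by simp
  then show ?case by (simp add: kapply_def[abs_def])
next
  case (insert p Y)
  have "kapply K (insert p Y) a = (\<lambda>z. cnj (a p) * K z p + kapply K Y a z)"
    using insert.hyps by (simp add: kapply_insert fun_eq_iff mult.commute)
  then have "ip f (kapply K (insert p Y) a) = a p * ip f (\<lambda>z. K z p) + ip f (kapply K Y a)"
    using insert.prems insert.hyps kapply_mem scale_mem kernel_mem by (simp add: ip_add_right ip_scale_right)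
  then show ?case using insert by (simp add: reproducing[symmetric] mult.commute)
qed

lemma kapply_nrm_sq:
  assumes "finite Y"
  shows "(nrm (kapply K Y a))\<^sup>2 = kquad K Y a"
  using ip_kapply[OF assms kapply_mem[OF assms], of a a] nrm_sq[OF kapply_mem[OF assms], of a]
  by (simp add: kquad_def kform_kapply mult.commute)

lemma pos_kernel_K: "finite Y \<Longrightarrow> pos_kernel K Y"
proof
  assume Y: "finite Y"
  show "0 \<le> kquad K Y h" for h unfolding kapply_nrm_sq[OF Y, symmetric] by simp
qed (auto intro: kernel_cnj)

lemma sum_eval_le:
  assumes "finite Y" "f \<in> H"
  shows "(cmod (\<Sum>w\<in>Y. f w * a w))\<^sup>2 \<le> (nrm f)\<^sup>2 * kquad K Y a"
  using ip_cauchy[OF assms(2) kapply_mem[OF assms(1), of a]] assms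
  by (simp add: ip_kapply kapply_nrm_sq)

lemma nrm_limit_eval:
  assumes F: "\<And>n. F n \<in> H" and f: "f \<in> H" and lim: "(\<lambda>n. nrm (\<lambda>x. F n x - f x)) \<longlonglongrightarrow> 0"
  shows "(\<lambda>n. F n x) \<longlonglongrightarrow> f x"
proof -
  have "(\<lambda>n. nrm (\<lambda>x. F n x - f x) * nrm (\<lambda>z. K z x)) \<longlonglongrightarrow> 0 * nrm (\<lambda>z. K z x)"
    by (intro tendsto_intros lim)
  then have lim0: "(\<lambda>n. nrm (\<lambda>x. F n x - f x) * nrm (\<lambda>z. K z x)) \<longlonglongrightarrow> 0"
    unfolding mult_zero_left .
  have "(\<lambda>n. F n x - f x) \<longlonglongrightarrow> 0"
    by (rule Lim_null_comparison[OF always_eventually lim0]) (intro allI eval_le[OF diff_mem[OF F f]])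
  then show ?thesis by (rule LIM_zero_cancel)
qed

lemma nrm_limit_le:
  assumes F: "\<And>n. F n \<in> H" and f: "f \<in> H" and lim: "(\<lambda>n. nrm (\<lambda>x. F n x - f x)) \<longlonglongrightarrow> 0"
    and le: "\<And>n. nrm (F n) \<le> c"
  shows "nrm f \<le> c"
proof -
  have "nrm f \<le> nrm (\<lambda>x. F n x - f x) + c" for n
    using nrm_triangle[OF diff_mem[OF f F, of n] F[of n]] le[of n] nrm_diff_commute[OF F[of n] f] by simp
  moreover have "(\<lambda>n. nrm (\<lambda>x. F n x - f x) + c) \<longlonglongrightarrow> 0 + c" by (intro tendsto_intros lim)
  ultimately have "nrm f \<le> 0 + c" by (intro LIMSEQ_le_const) blast+
  then show ?thesis by simp
qed

lemma partial_sum_mem: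
  assumes F: "\<And>n. F n \<in> H" and "finite I"
  shows "(\<lambda>x. \<Sum>n\<in>I. F n x) \<in> H"
  using assms(2)
proof (induction I rule: finite_induct)
  case empty
  show ?case using zero_mem by simp
next
  case (insert i I)
  then show ?case using add_mem[OF F[of i] insert.IH] by simp
qed

lemma partial_sum_nrm:
  assumes F: "\<And>n. F n \<in> H" and "finite I"
  shows "nrm (\<lambda>x. \<Sum>n\<in>I. F n x) \<le> (\<Sum>n\<in>I. nrm (F n))"
  using assms(2)
proof (induction I rule: finite_induct)
  case empty
  then show ?case by (simp add: nrm_zero)
next
  case (insert i I)
  have "nrm (\<lambda>x. F i x + (\<Sum>n\<in>I. F n x)) \<le> nrm (F i) + nrm (\<lambda>x. \<Sum>n\<in>I. F n x)"
    by (rule nrm_triangle[OF F partial_sum_mem[OF F insert.hyps(1)]])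
  then show ?case using insert by simp
qed

lemma absolutely_convergent_series:
  assumes F: "\<And>n. F n \<in> H" and s: "summable (\<lambda>n. nrm (F n))"
  shows "\<exists>f\<in>H. (\<forall>x. (\<lambda>n. F n x) sums f x) \<and> nrm f \<le> (\<Sum>n. nrm (F n))"
proof -
  define S where "S m x = (\<Sum>n<m. F n x)" for m x
  have S: "S m \<in> H" for m unfolding S_def[abs_def] using F by (intro partial_sum_mem) auto
  have "\<exists>M. \<forall>m\<ge>M. \<forall>n\<ge>M. nrm (\<lambda>x. S m x - S n x) < e" if e: "e > 0" for e
  proof -
    obtain M where M: "\<And>m n. M \<le> m \<Longrightarrow> norm (\<Sum>i\<in>{m..<n}. nrm (F i)) < e"
      using s e unfolding summable_Cauchy by blast
    have le: "nrm (\<lambda>x. S n x - S m x) < e" if mn: "M \<le> m" "m \<le> n" for m n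
    proof -
      have "(\<lambda>x. S n x - S m x) = (\<lambda>x. \<Sum>i\<in>{m..<n}. F i x)"
        unfolding S_def lessThan_atLeast0 using mn by (auto simp: sum_diff_nat_ivl fun_eq_iff)
      then have "nrm (\<lambda>x. S n x - S m x) \<le> (\<Sum>i\<in>{m..<n}. nrm (F i))" using partial_sum_nrm[of F "{m..<n}"] F by simp
      also have "\<dots> < e" using M[OF mn(1), of n] by simp
      finally show ?thesis .
    qed
    have "nrm (\<lambda>x. S m x - S n x) < e" if "M \<le> m" "M \<le> n" for m n
      using le[of m n] le[of n m] nrm_diff_commute[OF S S, of m n] that by (cases "m \<le> n") auto
    then show ?thesis by blast
  qed
  then obtain f where f: "f \<in> H" "(\<lambda>m. nrm (\<lambda>x. S m x - f x)) \<longlonglongrightarrow> 0"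
    using complete[of S] S by blast
  have "(\<lambda>n. F n x) sums f x" for x
    using nrm_limit_eval[OF S f, of x] by (simp add: sums_def S_def)
  moreover have "nrm f \<le> (\<Sum>n. nrm (F n))"
  proof (rule nrm_limit_le[OF S f])
    fix m
    have "nrm (S m) \<le> (\<Sum>n<m. nrm (F n))" unfolding S_def[abs_def] using F by (intro partial_sum_nrm) auto
    also have "\<dots> \<le> (\<Sum>n. nrm (F n))" using nrm_nonneg[OF F] by (intro sum_le_suminf s) auto
    finally show "nrm (S m) \<le> (\<Sum>n. nrm (F n))" .
  qed
  ultimately show ?thesis using f by blast
qed

text \<open>The minimal norm interpolants on the finite subsets form a Cauchy net.\<close>

lemma interpolation_from_bound:
  assumes c: "0 \<le> c"
    and bd: "\<And>Y h. finite Y \<Longrightarrow> Y \<subseteq> X0 \<Longrightarrow> (cmod (\<Sum>w\<in>Y. g w * h w))\<^sup>2 \<le> c\<^sup>2 * kquad K Y h"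
  shows "\<exists>f\<in>H. (\<forall>x\<in>X0. f x = g x) \<and> nrm f \<le> c"
proof -
  have sol: "\<exists>a. \<forall>z\<in>Y. kapply K Y a z = g z" if Y: "finite Y" "Y \<subseteq> X0" for Y
  proof (rule kapply_solvable[OF Y(1) pos_kernel_K[OF Y(1)]])
    show "(\<Sum>z\<in>Y. g z * h z) = 0" if "kquad K Y h = 0" for h using bd[OF Y, of h] that by simp
  qed
  define a where "a Y = (SOME a. \<forall>z\<in>Y. kapply K Y a z = g z)" for Y
  have a: "kapply K Y (a Y) z = g z" if "finite Y" "Y \<subseteq> X0" "z \<in> Y" for Y z
    using someI_ex[OF sol[OF that(1,2)]] that(3) unfolding a_def by blast
  define G where "G Y = kapply K Y (a Y)" for Y
  define ok where "ok Y \<longleftrightarrow> finite Y \<and> Y \<subseteq> X0" for Y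
  have G: "G Y \<in> H" if "ok Y" for Y using that unfolding G_def ok_def by (intro kapply_mem) auto
  have Gz: "G Y z = g z" if "ok Y" "z \<in> Y" for Y z using that a by (simp add: G_def ok_def)
  \<comment> \<open>The smaller interpolant is a combination of kernel functions of
    \<open>Y\<close>, so the pairing only involves values on \<open>Y\<close>, where both
    interpolants equal \<open>g\<close>. Their difference is thus orthogonal to the smaller
    one.\<close>
  have ipG: "ip (G Y') (G Y) = of_real ((nrm (G Y))\<^sup>2)" if "ok Y" "ok Y'" "Y \<subseteq> Y'" for Y Y'
  proof -
    have fY: "finite Y" using that by (simp add: ok_def)
    interpret Y: pos_kernel K Y by (rule pos_kernel_K[OF fY])
    have "ip (G Y') (G Y) = (\<Sum>w\<in>Y. G Y' w * a Y w)"
      unfolding G_def[of Y] by (rule ip_kapply[OF fY G[OF that(2)]])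
    also have "\<dots> = (\<Sum>w\<in>Y. a Y w * G Y w)"
      using that Gz[OF that(1)] Gz[OF that(2)] by (intro sum.cong refl) auto
    also have "\<dots> = of_real (kquad K Y (a Y))"
      unfolding G_def by (simp only: kform_kapply[symmetric] Y.kform_self)
    finally show ?thesis unfolding G_def[of Y] kapply_nrm_sq[OF fY] .
  qed
  have Gc: "nrm (G Y) \<le> c" if "ok Y" for Y
  proof -
    have fY: "finite Y" using that by (simp add: ok_def)
    interpret Y: pos_kernel K Y by (rule pos_kernel_K[OF fY])
    have q: "kquad K Y (a Y) = (nrm (G Y))\<^sup>2" unfolding G_def kapply_nrm_sq[OF fY] ..
    have "(\<Sum>w\<in>Y. g w * a Y w) = (\<Sum>w\<in>Y. a Y w * G Y w)"
      using Gz[OF that] by (intro sum.cong refl) auto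
    also have "\<dots> = of_real (kquad K Y (a Y))"
      unfolding G_def by (simp only: kform_kapply[symmetric] Y.kform_self)
    finally have sum: "(\<Sum>w\<in>Y. g w * a Y w) = of_real (kquad K Y (a Y))" .
    define t where "t = kquad K Y (a Y)"
    have "(cmod (\<Sum>w\<in>Y. g w * a Y w))\<^sup>2 \<le> c\<^sup>2 * t"
      using bd[of Y "a Y"] that unfolding t_def ok_def by blast
    then have "t * t \<le> c\<^sup>2 * t" unfolding sum t_def[symmetric] by (simp add: power2_eq_square)
    moreover have "0 \<le> t" unfolding t_def by (rule Y.nonneg)
    ultimately have "t \<le> c\<^sup>2" by (cases "t = 0") auto
    then show ?thesis using c unfolding t_def q by (rule power2_le_imp_le)
  qed
  have Gd: "(nrm (\<lambda>x. G Y' x - G Y x))\<^sup>2 = (nrm (G Y'))\<^sup>2 - (nrm (G Y))\<^sup>2"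
    if "ok Y" "ok Y'" "Y \<subseteq> Y'" for Y Y'
    by (rule nrm_diff_sq[OF G[OF that(2)] G[OF that(1)] ipG[OF that]])
  have mono: "(nrm (G Y))\<^sup>2 \<le> (nrm (G Y'))\<^sup>2" if "ok Y" "ok Y'" "Y \<subseteq> Y'" for Y Y'
    using Gd[OF that] zero_le_power2[of "nrm (\<lambda>x. G Y' x - G Y x)"] by simp
  define A where "A = {(nrm (G Y))\<^sup>2 | Y. ok Y}"
  define s where "s = Sup A"
  have bA: "bdd_above A"
    unfolding A_def using Gc G nrm_nonneg by (intro bdd_aboveI[of _ "c\<^sup>2"]) (auto intro!: power_mono)
  have neA: "A \<noteq> {}" unfolding A_def ok_def by blast
  have le_s: "(nrm (G Y))\<^sup>2 \<le> s" if "ok Y" for Y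
    unfolding s_def using that bA by (intro cSup_upper) (auto simp: A_def)
  have ex: "\<exists>Y. ok Y \<and> s - 1 / real (Suc n) < (nrm (G Y))\<^sup>2" for n
  proof -
    have "s - 1 / real (Suc n) < Sup A" by (simp add: s_def)
    then show ?thesis using less_cSup_iff[OF neA bA] by (auto simp: A_def)
  qed
  have "\<forall>n. \<exists>Y. ok Y \<and> s - 1 / real (Suc n) < (nrm (G Y))\<^sup>2" by (intro allI ex)
  from choice[OF this] obtain Y where
    Y: "\<And>n. ok (Y n)" "\<And>n. s - 1 / real (Suc n) < (nrm (G (Y n)))\<^sup>2" by blast
  define Z where "Z n = (\<Union>m\<le>n. Y m)" for n
  have Z: "ok (Z n)" for n using Y(1) unfolding Z_def ok_def by auto
  have Zmono: "Z m \<subseteq> Z n" if "m \<le> n" for m n using that by (force simp: Z_def)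
  have Zs: "s - 1 / real (Suc n) < (nrm (G (Z n)))\<^sup>2" for n
    using Y(2)[of n] mono[OF Y(1) Z, of n n] by (force simp: Z_def)
  have close: "(nrm (\<lambda>x. G W x - G (Z n) x))\<^sup>2 \<le> 1 / real (Suc n)" if "ok W" "Z n \<subseteq> W" for W n
    using Gd[OF Z that] le_s[OF that(1)] Zs[of n] by simp
  have "\<exists>M. \<forall>m\<ge>M. \<forall>n\<ge>M. nrm (\<lambda>x. G (Z m) x - G (Z n) x) < e" if e: "e > 0" for e
  proof -
    obtain M where M: "1 / real (Suc M) < e\<^sup>2" using e nat_approx_posE[of "e\<^sup>2"] by (metis zero_less_power)
    have le: "nrm (\<lambda>x. G (Z n) x - G (Z m) x) < e" if mn: "M \<le> m" "m \<le> n" for m n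
    proof (rule power2_less_imp_less)
      have "(nrm (\<lambda>x. G (Z n) x - G (Z m) x))\<^sup>2 \<le> 1 / real (Suc m)" by (rule close[OF Z Zmono[OF mn(2)]])
      also have "\<dots> \<le> 1 / real (Suc M)" using mn by (simp add: frac_le)
      finally show "(nrm (\<lambda>x. G (Z n) x - G (Z m) x))\<^sup>2 < e\<^sup>2" using M by simp
    qed (use e in simp)
    have "nrm (\<lambda>x. G (Z m) x - G (Z n) x) < e" if "M \<le> m" "M \<le> n" for m n
      using le[of m n] le[of n m] nrm_diff_commute[OF G[OF Z] G[OF Z], of m n] that by (cases "m \<le> n") auto
    then show ?thesis by blast
  qed
  then obtain f where f: "f \<in> H" "(\<lambda>n. nrm (\<lambda>x. G (Z n) x - f x)) \<longlonglongrightarrow> 0"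
    using complete[of "\<lambda>n. G (Z n)"] G[OF Z] by blast
  have "f x = g x" if x: "x \<in> X0" for x
  proof (rule LIMSEQ_unique[OF nrm_limit_eval[OF G[OF Z] f]])
    have bound: "norm (G (Z n) x - g x) \<le> sqrt (1 / real (Suc n)) * nrm (\<lambda>z. K z x)" for n
    proof -
      \<comment> \<open>A point that lies in none of the \<open>Z n\<close> is reached by adding it:
        the interpolant on the enlarged set has the right value at \<open>x\<close> and is close to
        the one on \<open>Z n\<close>.\<close>
      have W: "ok (insert x (Z n))" using Z[of n] x by (simp add: ok_def)
      have "cmod (G (insert x (Z n)) x - G (Z n) x) \<le> nrm (\<lambda>y. G (insert x (Z n)) y - G (Z n) y) * nrm (\<lambda>z. K z x)"
        by (rule eval_le[OF diff_mem[OF G[OF W] G[OF Z]]])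
      also have "\<dots> \<le> sqrt (1 / real (Suc n)) * nrm (\<lambda>z. K z x)"
        using close[OF W, of n] nrm_nonneg[OF kernel_mem] by (intro mult_right_mono real_le_rsqrt) auto
      finally show ?thesis using Gz[OF W, of x] by (simp add: norm_minus_commute)
    qed
    have "(\<lambda>n. sqrt (1 / real (Suc n)) * nrm (\<lambda>z. K z x)) \<longlonglongrightarrow> sqrt 0 * nrm (\<lambda>z. K z x)"
      by (intro tendsto_intros LIMSEQ_Suc[OF lim_1_over_n])
    then have lim: "(\<lambda>n. sqrt (1 / real (Suc n)) * nrm (\<lambda>z. K z x)) \<longlonglongrightarrow> 0"
      unfolding real_sqrt_zero mult_zero_left .
    have "(\<lambda>n. G (Z n) x - g x) \<longlonglongrightarrow> 0"
      by (rule Lim_null_comparison[OF always_eventually lim]) (intro allI bound)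
    then show "(\<lambda>n. G (Z n) x) \<longlonglongrightarrow> g x" by (rule LIM_zero_cancel)
  qed
  moreover have "nrm f \<le> c" by (rule nrm_limit_le[OF G[OF Z] f Gc[OF Z]])
  ultimately show ?thesis using f by blast
qed

section \<open>Automatic boundedness of multipliers of \<open>H\<close>\<close>

lemma scaled_series:
  assumes u: "\<And>m. u m \<in> H" "\<And>m. nrm (u m) \<le> 1" and s: "\<And>m. cmod (s m) = (1/3) ^ m"
  shows "(\<lambda>x. \<Sum>m. s (m + N) * u (m + N) x) \<in> H"
    "nrm (\<lambda>x. \<Sum>m. s (m + N) * u (m + N) x) \<le> (1/3) ^ N * (3/2)"
proof -
  define F where "F m x = s (m + N) * u (m + N) x" for m x
  have F: "F m \<in> H" for m unfolding F_def[abs_def] by (rule scale_mem[OF u(1)])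
  have le: "nrm (F m) \<le> (1/3) ^ (m + N)" for m
  proof -
    have "nrm (F m) = (1/3) ^ (m + N) * nrm (u (m + N))"
      unfolding F_def[abs_def] nrm_scale[OF u(1)] s ..
    also have "(1/3) ^ (m + N) * nrm (u (m + N)) \<le> (1/3) ^ (m + N) * 1"
      by (intro mult_left_mono u(2)) simp
    finally show ?thesis by simp
  qed
  have geo: "summable (\<lambda>m. (1/3 :: real) ^ (m + N))" "(\<Sum>m. (1/3 :: real) ^ (m + N)) = (1/3) ^ N * (3/2)"
    using geometric_third[of N] by (simp_all add: sums_iff)
  have sm: "summable (\<lambda>m. nrm (F m))"
    by (rule summable_comparison_test'[OF geo(1)]) (use le nrm_nonneg[OF F] in simp)
  have le': "(\<Sum>m. nrm (F m)) \<le> (1/3) ^ N * (3/2)" unfolding geo(2)[symmetric] by (rule suminf_le[OF le sm geo(1)])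
  obtain f where f: "f \<in> H" "\<And>x. (\<lambda>n. F n x) sums f x" "nrm f \<le> (\<Sum>n. nrm (F n))"
    using absolutely_convergent_series[OF F sm] by blast
  have "f = (\<lambda>x. \<Sum>m. F m x)" using f(2) by (simp add: fun_eq_iff sums_iff)
  then show "(\<lambda>x. \<Sum>m. s (m + N) * u (m + N) x) \<in> H"
    "nrm (\<lambda>x. \<Sum>m. s (m + N) * u (m + N) x) \<le> (1/3) ^ N * (3/2)"
    using f le' by (simp_all add: F_def)
qed

text \<open>A closed graph argument by hand. An unbounded adjoint yields functionals
  \<open>T n\<close>, represented by \<open>w n\<close>, of norm above \<open>4 ^ n * q n\<close>.
  For each fixed \<open>f\<close>, however, \<open>Tle\<close> bounds \<open>T n f\<close> by a
  constant times \<open>q n\<close> for all \<open>n\<close>; the gliding hump builds an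
  \<open>f\<close> that violates this.\<close>

lemma multiplier_adjoint_bounded:
  assumes \<phi>: "\<phi> \<in> Mult H"
  shows "\<exists>c\<ge>0. \<forall>Y a. finite Y \<longrightarrow> kquad K Y (\<lambda>z. \<phi> z * a z) \<le> c\<^sup>2 * kquad K Y a"
proof (rule ccontr)
  assume no: "\<not> (\<exists>c\<ge>0. \<forall>Y a. finite Y \<longrightarrow> kquad K Y (\<lambda>z. \<phi> z * a z) \<le> c\<^sup>2 * kquad K Y a)"
  have "\<forall>n. \<exists>Ya. finite (fst Ya) \<and> (4 ^ n)\<^sup>2 * kquad K (fst Ya) (snd Ya) < kquad K (fst Ya) (\<lambda>z. \<phi> z * snd Ya z)"
  proof
    fix n :: nat
    have "\<not> (\<forall>Y a. finite Y \<longrightarrow> kquad K Y (\<lambda>z. \<phi> z * a z) \<le> (4 ^ n)\<^sup>2 * kquad K Y a)"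
    proof
      assume "\<forall>Y a. finite Y \<longrightarrow> kquad K Y (\<lambda>z. \<phi> z * a z) \<le> (4 ^ n)\<^sup>2 * kquad K Y a"
      moreover have "(0::real) \<le> 4 ^ n" by simp
      ultimately show False using no by blast
    qed
    then show "\<exists>Ya. finite (fst Ya) \<and> (4 ^ n)\<^sup>2 * kquad K (fst Ya) (snd Ya) < kquad K (fst Ya) (\<lambda>z. \<phi> z * snd Ya z)"
      by (auto simp: not_le)
  qed
  from choice[OF this] obtain Ya where
    Ya: "\<And>n. finite (fst (Ya n))" "\<And>n. (4 ^ n)\<^sup>2 * kquad K (fst (Ya n)) (snd (Ya n)) < kquad K (fst (Ya n)) (\<lambda>z. \<phi> z * snd (Ya n) z)"
    by blast
  define Y where "Y n = fst (Ya n)" for n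
  define a where "a n = snd (Ya n)" for n
  define w where "w n = kapply K (Y n) (\<lambda>z. \<phi> z * a n z)" for n
  have fY: "finite (Y n)" for n using Ya(1) by (simp add: Y_def)
  have w: "w n \<in> H" for n unfolding w_def by (rule kapply_mem[OF fY])
  have wsq: "(nrm (w n))\<^sup>2 = kquad K (Y n) (\<lambda>z. \<phi> z * a n z)" for n unfolding w_def by (rule kapply_nrm_sq[OF fY])
  have big: "(4 ^ n)\<^sup>2 * kquad K (Y n) (a n) < (nrm (w n))\<^sup>2" for n
    using Ya(2)[of n] unfolding wsq Y_def a_def .
  have an: "0 \<le> kquad K (Y n) (a n)" for n by (rule pos_kernel.nonneg[OF pos_kernel_K[OF fY]])
  have wpos: "nrm (w n) > 0" for n
  proof -
    have "0 < (nrm (w n))\<^sup>2" using big[of n] an[of n] by (smt (verit) mult_nonneg_nonneg zero_le_power2)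
    then show ?thesis using nrm_nonneg[OF w[of n]] by (cases "nrm (w n) = 0") auto
  qed
  define T where "T n f = (\<Sum>z\<in>Y n. f z * (\<phi> z * a n z))" for n f
  have T: "T n f = ip f (w n)" if "f \<in> H" for n f
    unfolding T_def w_def by (rule ip_kapply[OF fY that, symmetric])
  define q where "q n = sqrt (kquad K (Y n) (a n))" for n
  have Tle: "cmod (T n f) \<le> nrm (\<lambda>x. \<phi> x * f x) * q n" if f: "f \<in> H" for n f
  proof (rule power2_le_imp_le)
    have \<phi>f: "(\<lambda>x. \<phi> x * f x) \<in> H" using \<phi> f by (simp add: Mult_def)
    have "T n f = (\<Sum>z\<in>Y n. (\<phi> z * f z) * a n z)" unfolding T_def by (simp add: algebra_simps)
    then show "(cmod (T n f))\<^sup>2 \<le> (nrm (\<lambda>x. \<phi> x * f x) * q n)\<^sup>2"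
      using sum_eval_le[OF fY[of n] \<phi>f, of "a n"] an[of n] by (simp add: power_mult_distrib q_def)
    show "0 \<le> nrm (\<lambda>x. \<phi> x * f x) * q n" using nrm_nonneg[OF \<phi>f] an[of n] by (simp add: q_def)
  qed
  have qpos: "q n > 0" for n
  proof (rule ccontr)
    assume "\<not> q n > 0"
    then have "q n = 0" using an[of n] by (simp add: q_def)
    then have "T n (w n) = 0" using Tle[OF w[of n], of n] by simp
    then have "Re (ip (w n) (w n)) = 0" using T[OF w[of n], of n] by simp
    then show False using wpos[of n] nrm_sq[OF w[of n]] by simp
  qed
  define C where "C n = nrm (w n) / q n" for n
  have C: "4 ^ n \<le> C n" for n
  proof -
    have "(4 ^ n * q n)\<^sup>2 \<le> (nrm (w n))\<^sup>2" using big[of n] an[of n] by (simp add: q_def power_mult_distrib)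
    then have "4 ^ n * q n \<le> nrm (w n)" using wpos[of n] by (meson less_imp_le power2_le_imp_le)
    then show ?thesis using qpos[of n] by (simp add: C_def pos_le_divide_eq)
  qed
  \<comment> \<open>The normalized representers, at which \<open>T n\<close> attains its norm
    \<open>C n * q n\<close>.\<close>
  define u where "u n x = complex_of_real (1 / nrm (w n)) * w n x" for n x
  have u: "u n \<in> H" for n unfolding u_def[abs_def] by (rule scale_mem[OF w])
  have u1: "nrm (u n) \<le> 1" for n
  proof -
    have "nrm (u n) = cmod (complex_of_real (1 / nrm (w n))) * nrm (w n)"
      unfolding u_def[abs_def] by (rule nrm_scale[OF w])
    then show ?thesis using wpos[of n] by (simp add: norm_divide)
  qed
  define W where "W n f c \<longleftrightarrow> cmod (T n f) \<le> c * q n" for n f c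
  have "\<exists>s :: nat \<Rightarrow> complex. (\<forall>m. cmod (s m) = (1/3) ^ m) \<and>
    (\<forall>c. \<exists>n. \<not> W n (\<lambda>x. \<Sum>m. s m * u m x) c)"
  proof (rule gliding_hump[where C = C])
    show "W n f d" if "W n f c" "c \<le> d" for n f c d
      using that qpos[of n] unfolding W_def by (meson less_imp_le mult_right_mono order_trans)
    show "W n (\<lambda>x. f x - g x) (c + d)" if "W n f c" "W n g d" for n f g c d
    proof -
      have eq: "T n (\<lambda>x. f x - g x) = T n f - T n g" by (simp add: T_def algebra_simps sum_subtractf)
      show ?thesis using that norm_triangle_ineq4[of "T n f" "T n g"] unfolding W_def eq distrib_right by linarith
    qed
    show "W n (\<lambda>x. complex_of_real t * f x) (t * c)" if "W n f c" "0 < t" for n f c t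
    proof -
      have "T n (\<lambda>x. complex_of_real t * f x) = of_real t * T n f" by (simp add: T_def sum_distrib_left mult.assoc)
      then show ?thesis using that unfolding W_def by (simp add: norm_mult mult.assoc)
    qed
    show "4 ^ n \<le> C n" for n by (rule C)
    show "\<not> W n (u n) (9/10 * C n)" for n
    proof -
      have "T n (u n) = ip (u n) (w n)" by (rule T[OF u])
      also have "\<dots> = of_real (1 / nrm (w n)) * ip (w n) (w n)"
        unfolding u_def[abs_def] by (rule ip_scale[OF w w])
      also have "ip (w n) (w n) = of_real ((nrm (w n))\<^sup>2)"
        using nrm_sq[OF w[of n]] ip_cnj[OF w[of n] w[of n]] by (simp add: complex_eq_iff)
      finally have "cmod (T n (u n)) = nrm (w n)" using wpos[of n] by (simp add: norm_mult norm_divide power2_eq_square)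
      then show ?thesis using wpos[of n] qpos[of n] by (simp add: W_def C_def)
    qed
    show "summable (\<lambda>m. (1/3) ^ m * cmod (u m x))" for x
    proof (rule summable_comparison_test')
      show "summable (\<lambda>m. (1/3) ^ m * nrm (\<lambda>z. K z x))" by (intro summable_mult2 summable_geometric) simp
      show "norm ((1/3) ^ m * cmod (u m x)) \<le> (1/3) ^ m * nrm (\<lambda>z. K z x)" for m
      proof -
        have "cmod (u m x) \<le> nrm (u m) * nrm (\<lambda>z. K z x)" by (rule eval_le[OF u])
        also have "\<dots> \<le> 1 * nrm (\<lambda>z. K z x)" by (intro mult_right_mono u1 nrm_nonneg kernel_mem)
        finally show ?thesis by (simp add: mult_left_mono)
      qed
    qed
    show "W n (\<lambda>x. \<Sum>m. s (m + Suc n) * u (m + Suc n) x) (C n * (1/3) ^ n / 2)"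
      if s: "\<And>m. cmod (s m) = (1/3) ^ m" for n s
    proof -
      define f where "f x = (\<Sum>m. s (m + Suc n) * u (m + Suc n) x)" for x
      have f: "f \<in> H" "nrm f \<le> (1/3) ^ n / 2"
        using scaled_series[of u s "Suc n", OF u u1 s] unfolding f_def[abs_def] by simp_all
      have "cmod (T n f) \<le> nrm f * nrm (w n)" unfolding T[OF f(1)] by (rule ip_le[OF f(1) w])
      also have "\<dots> \<le> (1/3) ^ n / 2 * nrm (w n)" by (intro mult_right_mono f(2) nrm_nonneg w)
      also have "\<dots> = C n * (1/3) ^ n / 2 * q n" using qpos[of n] by (simp add: C_def)
      finally show ?thesis unfolding W_def f_def .
    qed
  qed
  then obtain s :: "nat \<Rightarrow> complex" where s: "\<And>m. cmod (s m) = (1/3) ^ m"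
    and un: "\<And>c. \<exists>n. \<not> W n (\<lambda>x. \<Sum>m. s m * u m x) c" by blast
  define h where "h x = (\<Sum>m. s m * u m x)" for x
  have h: "h \<in> H" using scaled_series(1)[of u s 0, OF u u1 s] unfolding h_def[abs_def] by simp
  obtain n where "\<not> W n h (nrm (\<lambda>x. \<phi> x * h x))" using un unfolding h_def[abs_def] by blast
  then show False using Tle[OF h, of n] by (simp add: W_def)
qed

text \<open>Moving \<phi> from \<open>f\<close> to the coefficients turns the adjoint bound into the
  criterion of \<open>interpolation_from_bound\<close>. The set \<open>X0\<close> allows the bound
  to be known only on representatives of the points.\<close>

lemma multiplier_from_adjoint_bound:
  assumes c: "0 \<le> c" and bd: "\<And>Y a. finite Y \<Longrightarrow> Y \<subseteq> X0 \<Longrightarrow> kquad K Y (\<lambda>z. \<phi> z * a z) \<le> c\<^sup>2 * kquad K Y a"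
    and f: "f \<in> H"
  shows "\<exists>g\<in>H. (\<forall>x\<in>X0. g x = \<phi> x * f x) \<and> nrm g \<le> c * nrm f"
proof (rule interpolation_from_bound)
  show "0 \<le> c * nrm f" using c nrm_nonneg[OF f] by simp
  fix Y h assume Y: "finite Y" "Y \<subseteq> X0"
  have "(\<Sum>w\<in>Y. \<phi> w * f w * h w) = (\<Sum>w\<in>Y. f w * (\<phi> w * h w))" by (simp add: algebra_simps)
  then have "(cmod (\<Sum>w\<in>Y. \<phi> w * f w * h w))\<^sup>2 \<le> (nrm f)\<^sup>2 * kquad K Y (\<lambda>w. \<phi> w * h w)"
    using sum_eval_le[OF Y(1) f, of "\<lambda>w. \<phi> w * h w"] by simp
  also have "\<dots> \<le> (nrm f)\<^sup>2 * (c\<^sup>2 * kquad K Y h)" by (intro mult_left_mono bd Y) simp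
  finally show "(cmod (\<Sum>w\<in>Y. \<phi> w * f w * h w))\<^sup>2 \<le> (c * nrm f)\<^sup>2 * kquad K Y h"
    by (simp add: power_mult_distrib mult.assoc mult.left_commute)
qed

lemma multiplier_bounded:
  assumes \<phi>: "\<phi> \<in> Mult H"
  shows "\<exists>c\<ge>0. \<forall>f\<in>H. nrm (\<lambda>x. \<phi> x * f x) \<le> c * nrm f"
proof -
  obtain c where c: "c \<ge> 0" "\<And>Y a. finite Y \<Longrightarrow> kquad K Y (\<lambda>z. \<phi> z * a z) \<le> c\<^sup>2 * kquad K Y a"
    using multiplier_adjoint_bounded[OF \<phi>] by blast
  have "nrm (\<lambda>x. \<phi> x * f x) \<le> c * nrm f" if f: "f \<in> H" for f
  proof -
    obtain g where g: "g \<in> H" "\<And>x. g x = \<phi> x * f x" "nrm g \<le> c * nrm f"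
      using multiplier_from_adjoint_bound[of c UNIV \<phi> f] c f by auto
    then have "g = (\<lambda>x. \<phi> x * f x)" by (simp add: fun_eq_iff)
    then show ?thesis using g by simp
  qed
  then show ?thesis using c by blast
qed

section \<open>Weak products and their multipliers\<close>

text \<open>A bound for the weak product norm of the restriction of \<open>h\<close> to
  \<open>Y\<close>. It is a relation because the infimum need not be attained, and it is relative to
  \<open>Y\<close> because the extremal argument sees finitely many points at a time.\<close>

definition wp_cost :: "'x set \<Rightarrow> ('x \<Rightarrow> complex) \<Rightarrow> real \<Rightarrow> bool" where
  "wp_cost Y h c \<longleftrightarrow> (\<exists>f g. (\<forall>n. f n \<in> H) \<and> (\<forall>n. g n \<in> H) \<and>
     summable (\<lambda>n. nrm (f n) * nrm (g n)) \<and> (\<Sum>n::nat. nrm (f n) * nrm (g n)) \<le> c \<and>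
     (\<forall>x\<in>Y. (\<lambda>n. f n x * g n x) sums h x))"

lemma wp_cost_mono: "wp_cost Y h c \<Longrightarrow> c \<le> d \<Longrightarrow> wp_cost Y h d"
  unfolding wp_cost_def by (meson order_trans)

lemma wp_cost_subset: "wp_cost Y h c \<Longrightarrow> Z \<subseteq> Y \<Longrightarrow> wp_cost Z h c"
  unfolding wp_cost_def by (meson subsetD)

lemma wp_cost_cong:
  assumes "wp_cost Y h c" "\<And>x. x \<in> Y \<Longrightarrow> h x = k x"
  shows "wp_cost Y k c"
  using assms(1) unfolding wp_cost_def by (simp add: assms(2) cong: ball_cong)

lemma wp_cost_product:
  assumes "f \<in> H" "g \<in> H"
  shows "wp_cost Y (\<lambda>x. f x * g x) (nrm f * nrm g)"
  unfolding wp_cost_def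
proof (intro exI conjI allI ballI)
  let ?f = "\<lambda>n::nat. if n = 0 then f else (\<lambda>x. 0)" and ?g = "\<lambda>n::nat. if n = 0 then g else (\<lambda>x. 0)"
  show "?f n \<in> H" "?g n \<in> H" for n using assms zero_mem by simp_all
  have "(\<lambda>n. nrm (?f n) * nrm (?g n)) = (\<lambda>n. if n = 0 then nrm f * nrm g else 0)" by (auto simp: nrm_zero)
  then have s: "(\<lambda>n. nrm (?f n) * nrm (?g n)) sums (nrm f * nrm g)" using sums_single[of 0 "\<lambda>_. nrm f * nrm g"] by simp
  show "summable (\<lambda>n. nrm (?f n) * nrm (?g n))" using s by (rule sums_summable)
  show "(\<Sum>n. nrm (?f n) * nrm (?g n)) \<le> nrm f * nrm g" using sums_unique[OF s] by simp
  have "(\<lambda>n. ?f n x * ?g n x) = (\<lambda>n. if n = 0 then f x * g x else 0)" for x by auto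
  then show "(\<lambda>n. ?f n x * ?g n x) sums (f x * g x)" for x using sums_single[of 0 "\<lambda>_. f x * g x"] by simp
qed

lemma wp_cost_zero: "wp_cost Y (\<lambda>x. 0) 0"
  using wp_cost_product[OF zero_mem zero_mem, of Y] by (simp add: nrm_zero)

lemma wp_cost_scale:
  assumes "wp_cost Y h c"
  shows "wp_cost Y (\<lambda>x. t * h x) (cmod t * c)"
proof -
  obtain f g where f: "\<And>n. f n \<in> H" and g: "\<And>n. g n \<in> H" and s: "summable (\<lambda>n. nrm (f n) * nrm (g n))"
    and c: "(\<Sum>n::nat. nrm (f n) * nrm (g n)) \<le> c" and h: "\<And>x. x \<in> Y \<Longrightarrow> (\<lambda>n. f n x * g n x) sums h x"
    using assms unfolding wp_cost_def by blast
  have tf: "(\<lambda>x. t * f n x) \<in> H" for n by (rule scale_mem[OF f])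
  have n: "nrm (\<lambda>x. t * f n x) * nrm (g n) = cmod t * (nrm (f n) * nrm (g n))" for n
    by (simp add: nrm_scale[OF f])
  show ?thesis unfolding wp_cost_def
  proof (rule exI[of _ "\<lambda>n x. t * f n x"], rule exI[of _ g], intro conjI allI ballI)
    show "summable (\<lambda>n. nrm (\<lambda>x. t * f n x) * nrm (g n))" unfolding n by (rule summable_mult[OF s])
    show "(\<Sum>n. nrm (\<lambda>x. t * f n x) * nrm (g n)) \<le> cmod t * c"
      unfolding n suminf_mult[OF s] by (intro mult_left_mono c) simp
    show "(\<lambda>n. t * f n x * g n x) sums (t * h x)" if "x \<in> Y" for x
      using sums_mult[OF h[OF that], of t] by (simp add: mult.assoc)
  qed (use tf g in blast)+
qed

text \<open>Countable subadditivity takes the place of completeness of the weak product. The double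
  family is enumerated by \<open>prod_decode\<close>; since evaluations are bounded, the pointwise
  values converge absolutely and may be regrouped.\<close>

lemma wp_cost_sums:
  assumes wp: "\<And>m::nat. wp_cost Y (h m) (c m)" and sc: "summable c"
    and k: "\<And>x. x \<in> Y \<Longrightarrow> (\<lambda>m. h m x) sums k x"
  shows "wp_cost Y k (\<Sum>m. c m)"
proof -
  have "\<forall>m. \<exists>fg. (\<forall>n. fst fg n \<in> H) \<and> (\<forall>n. snd fg n \<in> H) \<and>
     summable (\<lambda>n. nrm (fst fg n) * nrm (snd fg n)) \<and> (\<Sum>n::nat. nrm (fst fg n) * nrm (snd fg n)) \<le> c m \<and>
     (\<forall>x\<in>Y. (\<lambda>n. fst fg n x * snd fg n x) sums h m x)"
    using wp unfolding wp_cost_def by simp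
  from choice[OF this] obtain fg where fg: "\<And>m. (\<forall>n. fst (fg m) n \<in> H) \<and> (\<forall>n. snd (fg m) n \<in> H) \<and>
     summable (\<lambda>n. nrm (fst (fg m) n) * nrm (snd (fg m) n)) \<and> (\<Sum>n::nat. nrm (fst (fg m) n) * nrm (snd (fg m) n)) \<le> c m \<and>
     (\<forall>x\<in>Y. (\<lambda>n. fst (fg m) n x * snd (fg m) n x) sums h m x)" by blast
  define f where "f p = fst (fg (fst p)) (snd p)" for p :: "nat \<times> nat"
  define g where "g p = snd (fg (fst p)) (snd p)" for p :: "nat \<times> nat"
  define A where "A p = nrm (f p) * nrm (g p)" for p
  have f: "f p \<in> H" and g: "g p \<in> H" for p using fg[of "fst p"] by (simp_all add: f_def g_def)
  have A0: "0 \<le> A p" for p unfolding A_def by (intro mult_nonneg_nonneg nrm_nonneg f g)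
  have sA: "summable (\<lambda>n. A (m, n))" and cA: "(\<Sum>n. A (m, n)) \<le> c m"
    and hA: "\<And>x. x \<in> Y \<Longrightarrow> (\<lambda>n. f (m, n) x * g (m, n) x) sums h m x" for m
    using fg[of m] by (simp_all add: A_def f_def g_def)
  have c0: "0 \<le> c m" for m using cA[of m] suminf_nonneg[OF sA, of m] A0 by (meson order_trans)
  have part: "(\<Sum>i<l. A (prod_decode i)) \<le> (\<Sum>m. c m)" for l
  proof -
    have inj: "inj_on prod_decode {..<l}" using bij_prod_decode by (meson bij_is_inj inj_on_subset subset_UNIV)
    have "(\<Sum>i<l. A (prod_decode i)) = (\<Sum>p\<in>prod_decode ` {..<l}. A p)"
      by (simp add: sum.reindex[OF inj])
    also have "\<dots> \<le> (\<Sum>p\<in>{..<l} \<times> {..<l}. A p)"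
    proof (rule sum_mono2)
      show "prod_decode ` {..<l} \<subseteq> {..<l} \<times> {..<l}"
      proof
        fix p assume "p \<in> prod_decode ` {..<l}"
        then obtain i where i: "i < l" "p = prod_decode i" by blast
        then have "prod_encode (fst p, snd p) < l" by simp
        then show "p \<in> {..<l} \<times> {..<l}"
          using le_prod_encode_1[of "fst p" "snd p"] le_prod_encode_2[of "snd p" "fst p"] by (cases p) simp
      qed
    qed (use A0 in auto)
    also have "\<dots> = (\<Sum>m<l. \<Sum>n<l. A (m, n))" by (simp add: sum.cartesian_product)
    also have "\<dots> \<le> (\<Sum>m<l. c m)"
    proof (rule sum_mono)
      fix m
      have "(\<Sum>n<l. A (m, n)) \<le> (\<Sum>n. A (m, n))" by (rule sum_le_suminf[OF sA]) (use A0 in auto)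
      then show "(\<Sum>n<l. A (m, n)) \<le> c m" using cA[of m] by simp
    qed
    also have "\<dots> \<le> (\<Sum>m. c m)" by (rule sum_le_suminf[OF sc]) (use c0 in auto)
    finally show ?thesis .
  qed
  have sum: "summable (\<lambda>i. A (prod_decode i))" by (rule summableI_nonneg_bounded[OF A0 part])
  have pt: "(\<lambda>i. f (prod_decode i) x * g (prod_decode i) x) sums k x" if x: "x \<in> Y" for x
  proof -
    define B where "B p = f p x * g p x" for p
    define M where "M = nrm (\<lambda>z. K z x) * nrm (\<lambda>z. K z x)"
    have BA: "cmod (B p) \<le> A p * M" for p
    proof -
      have "cmod (B p) \<le> (nrm (f p) * nrm (\<lambda>z. K z x)) * (nrm (g p) * nrm (\<lambda>z. K z x))"
        unfolding B_def norm_mult by (intro mult_mono eval_le f g mult_nonneg_nonneg nrm_nonneg kernel_mem) simp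
      then show ?thesis by (simp add: A_def M_def mult.assoc mult.left_commute)
    qed
    have s1: "summable (\<lambda>i. cmod (B (prod_decode i)))"
      by (rule summable_comparison_test'[OF summable_mult2[OF sum, of M]]) (simp add: BA)
    then have "(\<lambda>i. B (prod_decode i)) sums (\<Sum>i. B (prod_decode i))"
      by (rule summable_sums[OF summable_norm_cancel])
    then have "((\<lambda>i. B (prod_decode i)) has_sum (\<Sum>i. B (prod_decode i))) UNIV"
      by (rule norm_summable_imp_has_sum[OF s1])
    then have "(B has_sum (\<Sum>i. B (prod_decode i))) (Sigma UNIV (\<lambda>_. UNIV))"
      using has_sum_reindex_bij_betw[of prod_decode UNIV UNIV B] bij_prod_decode by simp
    moreover have "((\<lambda>n. B (m, n)) has_sum h m x) UNIV" for m
    proof (rule norm_summable_imp_has_sum)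
      show "summable (\<lambda>n. cmod (B (m, n)))"
        by (rule summable_comparison_test'[OF summable_mult2[OF sA[of m], of M]]) (simp add: BA)
      show "(\<lambda>n. B (m, n)) sums h m x" unfolding B_def by (rule hA[OF x])
    qed
    ultimately have "((\<lambda>m. h m x) has_sum (\<Sum>i. B (prod_decode i))) UNIV"
      by (rule has_sum_SigmaD)
    then have "(\<lambda>m. h m x) sums (\<Sum>i. B (prod_decode i))" by (rule has_sum_imp_sums)
    then have "(\<Sum>i. B (prod_decode i)) = k x" using k[OF x] by (rule sums_unique2)
    then show ?thesis using \<open>(\<lambda>i. B (prod_decode i)) sums (\<Sum>i. B (prod_decode i))\<close> by (simp add: B_def)
  qed
  show ?thesis unfolding wp_cost_def
  proof (rule exI[of _ "\<lambda>i. f (prod_decode i)"], rule exI[of _ "\<lambda>i. g (prod_decode i)"], intro conjI allI ballI)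
    show "summable (\<lambda>i. nrm (f (prod_decode i)) * nrm (g (prod_decode i)))" using sum by (simp add: A_def)
    show "(\<Sum>i. nrm (f (prod_decode i)) * nrm (g (prod_decode i))) \<le> (\<Sum>m. c m)"
      using suminf_le_const[OF sum part] by (simp add: A_def)
  qed (use f g pt in blast)+
qed

lemma wp_cost_diff:
  assumes a: "wp_cost Y a c" and b: "wp_cost Y b d"
  shows "wp_cost Y (\<lambda>x. a x - b x) (c + d)"
proof -
  define h where "h m = (if m = 0 then a else if m = Suc 0 then (\<lambda>x. (-1) * b x) else (\<lambda>x. 0))" for m :: nat
  define e where "e m = (if m = 0 then c else if m = Suc 0 then d else 0)" for m :: nat
  have b': "wp_cost Y (\<lambda>x. (-1) * b x) d" using wp_cost_scale[OF b, of "-1"] by simp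
  have "wp_cost Y (h m) (e m)" for m
    using a b' wp_cost_zero unfolding h_def e_def by simp
  moreover have "e sums (c + d)" using sums_finite[of "{0, Suc 0}" e] by (simp add: e_def)
  moreover have "(\<lambda>m. h m x) sums (a x - b x)" for x
    using sums_finite[of "{0, Suc 0}" "\<lambda>m. h m x"] by (simp add: h_def)
  ultimately show ?thesis using wp_cost_sums[of Y h e "\<lambda>x. a x - b x"] by (simp add: sums_iff)
qed

lemma weak_product_iff: "h \<in> weak_product H ip \<longleftrightarrow> (\<exists>c. wp_cost UNIV h c)"
  unfolding weak_product_def weak_product_rep_def wp_cost_def by (auto intro: order_refl)

lemma rep_sum_nonneg:
  assumes "weak_product_rep H ip h f g"
  shows "0 \<le> (\<Sum>n. nrm (f n) * nrm (g n))"
proof (rule suminf_nonneg)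
  show "summable (\<lambda>n. nrm (f n) * nrm (g n))" using assms by (simp add: weak_product_rep_def)
  show "0 \<le> nrm (f n) * nrm (g n)" for n
    by (intro mult_nonneg_nonneg nrm_nonneg) (use assms in \<open>simp_all add: weak_product_rep_def\<close>)
qed

lemma weak_product_norm_le:
  assumes "wp_cost UNIV h c"
  shows "weak_product_norm H ip h \<le> c"
proof -
  obtain f g where r: "weak_product_rep H ip h f g" and c: "(\<Sum>n. nrm (f n) * nrm (g n)) \<le> c"
    using assms unfolding wp_cost_def weak_product_rep_def by blast
  have "weak_product_norm H ip h \<le> (\<Sum>n. nrm (f n) * nrm (g n))"
    unfolding weak_product_norm_def
  proof (rule cInf_lower)
    show "bdd_below {(\<Sum>n. nrm (f n) * nrm (g n)) | f g. weak_product_rep H ip h f g}"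
      by (rule bdd_belowI[of _ 0]) (use rep_sum_nonneg in blast)
  qed (use r in blast)
  then show ?thesis using c by simp
qed

lemma wp_cost_if_norm_less:
  assumes "h \<in> weak_product H ip" "weak_product_norm H ip h < c"
  shows "wp_cost UNIV h c"
proof -
  have "{(\<Sum>n. nrm (f n) * nrm (g n)) | f g. weak_product_rep H ip h f g} \<noteq> {}"
    using assms(1) by (auto simp: weak_product_def)
  from cInf_lessD[OF this, of c] obtain f g where "weak_product_rep H ip h f g" "(\<Sum>n. nrm (f n) * nrm (g n)) < c"
    using assms(2) unfolding weak_product_norm_def by blast
  then show ?thesis unfolding wp_cost_def weak_product_rep_def by (meson UNIV_I less_imp_le)
qed

lemma wp_cost_multiplier:
  assumes \<phi>: "\<phi> \<in> Mult H" and c: "0 \<le> c" "\<And>f. f \<in> H \<Longrightarrow> nrm (\<lambda>x. \<phi> x * f x) \<le> c * nrm f"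
    and h: "wp_cost Y h d"
  shows "wp_cost Y (\<lambda>x. \<phi> x * h x) (c * d)"
proof -
  obtain f g where f: "\<And>n. f n \<in> H" and g: "\<And>n. g n \<in> H" and s: "summable (\<lambda>n. nrm (f n) * nrm (g n))"
    and d: "(\<Sum>n::nat. nrm (f n) * nrm (g n)) \<le> d" and h: "\<And>x. x \<in> Y \<Longrightarrow> (\<lambda>n. f n x * g n x) sums h x"
    using h unfolding wp_cost_def by blast
  have pf: "(\<lambda>x. \<phi> x * f n x) \<in> H" for n using \<phi> f by (simp add: Mult_def)
  have le: "nrm (\<lambda>x. \<phi> x * f n x) * nrm (g n) \<le> c * (nrm (f n) * nrm (g n))" for n
    using mult_right_mono[OF c(2)[OF f[of n]] nrm_nonneg[OF g[of n]]] by (simp add: mult.assoc)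
  have s': "summable (\<lambda>n. nrm (\<lambda>x. \<phi> x * f n x) * nrm (g n))"
    by (rule summable_comparison_test'[OF summable_mult[OF s, of c]])
       (use le nrm_nonneg[OF pf] nrm_nonneg[OF g] in simp)
  show ?thesis unfolding wp_cost_def
  proof (rule exI[of _ "\<lambda>n x. \<phi> x * f n x"], rule exI[of _ g], intro conjI allI ballI)
    show "summable (\<lambda>n. nrm (\<lambda>x. \<phi> x * f n x) * nrm (g n))" by (rule s')
    have "(\<Sum>n. nrm (\<lambda>x. \<phi> x * f n x) * nrm (g n)) \<le> (\<Sum>n. c * (nrm (f n) * nrm (g n)))"
      by (rule suminf_le[OF le s' summable_mult[OF s]])
    also have "\<dots> = c * (\<Sum>n. nrm (f n) * nrm (g n))" by (rule suminf_mult[OF s])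
    also have "\<dots> \<le> c * d" by (intro mult_left_mono d c(1))
    finally show "(\<Sum>n. nrm (\<lambda>x. \<phi> x * f n x) * nrm (g n)) \<le> c * d" .
    show "(\<lambda>n. \<phi> x * f n x * g n x) sums (\<phi> x * h x)" if "x \<in> Y" for x
      using sums_mult[OF h[OF that], of "\<phi> x"] by (simp add: mult.assoc)
  qed (use pf g in blast)+
qed

lemma Mult_subset_weak_product: "\<phi> \<in> Mult H \<Longrightarrow> \<phi> \<in> Mult (weak_product H ip)"
proof -
  assume \<phi>: "\<phi> \<in> Mult H"
  obtain c where c: "0 \<le> c" "\<And>f. f \<in> H \<Longrightarrow> nrm (\<lambda>x. \<phi> x * f x) \<le> c * nrm f"
    using multiplier_bounded[OF \<phi>] by blast
  have "(\<lambda>x. \<phi> x * h x) \<in> weak_product H ip" if "h \<in> weak_product H ip" for h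
    using that wp_cost_multiplier[of \<phi> c UNIV h, OF \<phi> c] unfolding weak_product_iff by blast
  then show ?thesis by (simp add: Mult_def)
qed

text \<open>Pairing \<open>f\<close> with its dual coefficients \<open>a\<close> gives
  \<open>t\<close>, whereas Cauchy-Schwarz bounds this by the norm of \<open>f\<close> times the
  square root of \<open>t\<close>.\<close>

lemma nsq_restrict_le:
  assumes "dual_kernels K J Y" and f: "f \<in> H"
  shows "kquad J Y f \<le> (nrm f)\<^sup>2"
proof -
  interpret D: dual_kernels K J Y by fact
  define a where "a = kapply J Y f"
  define t where "t = kquad J Y f"
  have t0: "0 \<le> t" unfolding t_def by (rule D.J.nonneg)
  have "(\<Sum>z\<in>Y. f z * a z) = of_real t"
    unfolding a_def kform_kapply[symmetric] t_def by (rule D.J.kform_self)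
  then have "t\<^sup>2 \<le> (nrm f)\<^sup>2 * kquad K Y a"
    using sum_eval_le[OF D.k.fin f, of a] t0 by simp
  also have "kquad K Y a = t" unfolding a_def t_def by (rule D.dual_quad[symmetric])
  finally have "t * t \<le> (nrm f)\<^sup>2 * t" by (simp add: power2_eq_square)
  then show ?thesis unfolding t_def[symmetric] using t0 by (cases "t = 0") auto
qed

text \<open>Scaling \<open>f n\<close> and \<open>g n\<close> by reciprocal factors equalizes their
  norms, and the sum of products becomes each of the two sums of squares.\<close>

lemma wp_cost_balanced:
  assumes "wp_cost Y h c"
  shows "\<exists>f g. (\<forall>n. f n \<in> H) \<and> (\<forall>n. g n \<in> H) \<and>
     summable (\<lambda>n. (nrm (f n))\<^sup>2) \<and> (\<Sum>n. (nrm (f n))\<^sup>2) \<le> c \<and>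
     summable (\<lambda>n. (nrm (g n))\<^sup>2) \<and> (\<Sum>n. (nrm (g n))\<^sup>2) \<le> c \<and>
     (\<forall>x\<in>Y. (\<lambda>n::nat. f n x * g n x) sums h x)"
proof -
  obtain f g where f: "\<And>n. f n \<in> H" and g: "\<And>n. g n \<in> H" and s: "summable (\<lambda>n. nrm (f n) * nrm (g n))"
    and c: "(\<Sum>n::nat. nrm (f n) * nrm (g n)) \<le> c" and h: "\<And>x. x \<in> Y \<Longrightarrow> (\<lambda>n. f n x * g n x) sums h x"
    using assms unfolding wp_cost_def by blast
  \<comment> \<open>If one norm is 0 the product vanishes identically, and both factors are replaced
    by 0.\<close>
  define t where "t n = (if nrm (f n) = 0 \<or> nrm (g n) = 0 then 0 else sqrt (nrm (g n) / nrm (f n)))" for n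
  define r where "r n = (if nrm (f n) = 0 \<or> nrm (g n) = 0 then 0 else sqrt (nrm (f n) / nrm (g n)))" for n
  have f0: "0 \<le> nrm (f n)" and g0: "0 \<le> nrm (g n)" for n by (rule nrm_nonneg[OF f], rule nrm_nonneg[OF g])
  have t2: "(cmod (of_real (t n)))\<^sup>2 = (if nrm (f n) = 0 \<or> nrm (g n) = 0 then 0 else nrm (g n) / nrm (f n))"
    and r2: "(cmod (of_real (r n)))\<^sup>2 = (if nrm (f n) = 0 \<or> nrm (g n) = 0 then 0 else nrm (f n) / nrm (g n))" for n
    using f0[of n] g0[of n] by (simp_all add: t_def r_def)
  have nf: "(nrm (\<lambda>x. of_real (t n) * f n x))\<^sup>2 = nrm (f n) * nrm (g n)" for n
    unfolding nrm_scale[OF f] power_mult_distrib t2 by (simp add: power2_eq_square)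
  have ng: "(nrm (\<lambda>x. of_real (r n) * g n x))\<^sup>2 = nrm (f n) * nrm (g n)" for n
    unfolding nrm_scale[OF g] power_mult_distrib r2 by (simp add: power2_eq_square)
  have zero: "u x = 0" if "u \<in> H" "nrm u = 0" for u x using eval_le[OF that(1), of x] that(2) by simp
  have prod: "of_real (t n) * f n x * (of_real (r n) * g n x) = f n x * g n x" for n x
  proof (cases "nrm (f n) = 0 \<or> nrm (g n) = 0")
    case True
    then have "f n x * g n x = 0" using zero[OF f] zero[OF g] by auto
    moreover have "t n = 0" using True by (simp add: t_def)
    ultimately show ?thesis by simp
  next
    case False
    then have "t n * r n = 1"
      using f0[of n] g0[of n] by (simp add: t_def r_def real_sqrt_mult[symmetric])
    then have "complex_of_real (t n) * of_real (r n) = 1" by (metis of_real_1 of_real_mult)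
    moreover have "of_real (t n) * f n x * (of_real (r n) * g n x) = (of_real (t n) * of_real (r n)) * (f n x * g n x)"
      by (simp only: mult.assoc mult.left_commute)
    ultimately show ?thesis by simp
  qed
  show ?thesis
  proof (rule exI[of _ "\<lambda>n x. of_real (t n) * f n x"], rule exI[of _ "\<lambda>n x. of_real (r n) * g n x"], intro conjI allI ballI)
    show "(\<lambda>x. of_real (t n) * f n x) \<in> H" for n by (rule scale_mem[OF f])
    show "(\<lambda>x. of_real (r n) * g n x) \<in> H" for n by (rule scale_mem[OF g])
  qed (use s c h in \<open>simp_all add: nf ng prod\<close>)
qed

end

section \<open>Normalized complete Pick spaces: from squares to multipliers\<close>

context normalized_complete_pick_space
begin

text \<open>The kernel is strictly positive only after identifying points with the same kernel function.\<close>

definition rep :: "'a \<Rightarrow> 'a" where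
  "rep x = (SOME y. \<forall>z. K z y = K z x)"

lemma rep: "K z (rep x) = K z x"
proof -
  have "\<exists>y. \<forall>z. K z y = K z x" by blast
  from someI_ex[OF this] show ?thesis unfolding rep_def by (rule spec)
qed

lemma rep_eval: "f \<in> H \<Longrightarrow> f (rep x) = f x"
  using reproducing[of f x] reproducing[of f "rep x"] by (simp add: rep)

lemma rep_eqI: "(\<And>z. K z x = K z y) \<Longrightarrow> rep x = rep y"
  by (simp add: rep_def)

lemma base_point: "\<exists>z0. \<forall>z. K z z0 = 1"
  using normalized_pick_kernel by blast

lemma one_mem: "(\<lambda>x. 1) \<in> H"
proof -
  obtain z0 where "\<And>z. K z z0 = 1" using base_point by blast
  then show ?thesis using kernel_mem[of z0] by simp
qed

lemma MultD: "\<phi> \<in> Mult B \<Longrightarrow> f \<in> B \<Longrightarrow> (\<lambda>x. \<phi> x * f x) \<in> B"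
  by (simp add: Mult_def)

lemma pick_kernel_K: "finite Y \<Longrightarrow> pick_kernel K Y"
proof -
  assume Y: "finite Y"
  obtain d b where b: "\<And>z. b z \<in> unit_ball d" "\<And>z w. K z w = 1 / (1 - l2_inner (b z) (b w))"
    using normalized_pick_kernel by blast
  show ?thesis by (rule pick_kernel_of_l2_inner[OF pos_kernel_K[OF Y] b(1) b(2)])
qed

text \<open>Equality in Cauchy-Schwarz would make two kernel functions proportional. Both take the
  value 1 at the base point, so they would agree and the two points would have the same
  representative.\<close>

lemma pd_kernel_K:
  assumes Y: "finite Y" "Y \<subseteq> range rep"
  shows "pd_kernel K Y"
proof (rule pd_kernel_if_separated[OF Y(1) pick_kernel_K[OF Y(1)]])
  interpret P: pick_kernel K Y by (rule pick_kernel_K[OF Y(1)])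
  fix z w assume zw: "z \<in> Y" "w \<in> Y" "z \<noteq> w"
  show "(cmod (K z w))\<^sup>2 \<noteq> Re (K z z) * Re (K w w)"
  proof
    assume eq: "(cmod (K z w))\<^sup>2 = Re (K z z) * Re (K w w)"
    have pos: "Re (K w w) > 0" by (rule P.diag(2)[OF zw(2)])
    define c where "c = K w z / of_real (Re (K w w))"
    define f where "f x = K x z + (- c) * K x w" for x
    have f: "f \<in> H" unfolding f_def[abs_def] by (intro add_mem scale_mem kernel_mem)
    have ipzw: "ip (\<lambda>x. K x z) (\<lambda>x. K x w) = K w z" using reproducing[OF kernel_mem, of w z] by simp
    have "cnj c = K z w / of_real (Re (K w w))" unfolding c_def using kernel_cnj[of z w] by simp
    then have "cnj c * K w z = (K z w * cnj (K z w)) / of_real (Re (K w w))" using kernel_cnj[of w z] by simp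
    also have "\<dots> = of_real ((cmod (K z w))\<^sup>2 / Re (K w w))"
      unfolding complex_norm_square[symmetric] by simp
    finally have "cnj c * K w z = of_real ((cmod (K z w))\<^sup>2 / Re (K w w))" .
    then have cr: "Re (cnj c * K w z) = (cmod (K z w))\<^sup>2 / Re (K w w)" by (metis Re_complex_of_real)
    have cc: "(cmod c)\<^sup>2 * Re (K w w) = (cmod (K z w))\<^sup>2 / Re (K w w)"
      using pos kernel_cnj[of w z] by (simp add: c_def norm_divide power_divide power2_eq_square)
    have "(nrm f)\<^sup>2 = Re (K z z) + 2 * Re (cnj (- c) * K w z) + (cmod (- c))\<^sup>2 * Re (K w w)"
      unfolding f_def[abs_def] nrm_add_sq[OF kernel_mem kernel_mem] ipzw kernel_nrm_sq ..
    also have "\<dots> = Re (K z z) - (cmod (K z w))\<^sup>2 / Re (K w w)" using cr cc by simp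
    also have "\<dots> = 0" using eq pos by simp
    finally have n0: "nrm f = 0" by simp
    have f0: "f x = 0" for x using eval_le[OF f, of x] n0 by simp
    obtain z0 where z0: "\<And>z. K z z0 = 1" using base_point by blast
    have "K z0 y = 1" for y using kernel_cnj[of z0 y] z0[of y] by simp
    then have "c = 1" using f0[of z0] by (simp add: f_def)
    then have "K x z = K x w" for x using f0[of x] by (simp add: f_def)
    then have "rep z = rep w" by (rule rep_eqI)
    moreover have "rep x = x" if x: "x \<in> Y" for x
    proof -
      obtain y where y: "x = rep y" using x Y(2) by blast
      show ?thesis unfolding y by (rule rep_eqI) (rule rep)
    qed
    ultimately show False using zw by simp
  qed
qed

text \<open>A unit vector \<open>F\<close> on \<open>Y\<close> extends to \<open>Fe\<close> in
  \<open>H\<close> with the same norm. The cost hypothesis factors \<phi> times the square of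
  \<open>Fe\<close>, and restricting the balanced factors to \<open>Y\<close> does not increase
  their norms.\<close>

lemma mult_bound_if_square_cost:
  assumes c: "0 \<le> c" and Y: "finite Y" "Y \<subseteq> range rep"
    and cost: "\<And>f. f \<in> H \<Longrightarrow> nrm f \<le> 1 \<Longrightarrow> wp_cost Y (\<lambda>x. \<phi> x * (f x)\<^sup>2) c"
  shows "kquad K Y (\<lambda>z. \<phi> z * h z) \<le> c\<^sup>2 * kquad K Y h"
proof -
  interpret pd: pd_kernel K Y by (rule pd_kernel_K[OF Y])
  interpret pi: pick_kernel K Y by (rule pick_kernel_K[OF Y(1)])
  obtain J where J: "dual_kernels K J Y" using pd.dual_exists by blast
  then interpret D: dual_pick K J Y by (intro dual_pick.intro pi.pick_kernel_axioms)
  show ?thesis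
  proof (rule D.weak_product_multiplier_bound[OF c])
    fix F c' assume c': "c < c'" and F: "kquad J Y F = 1"
    define Fe where "Fe = kapply K Y (kapply J Y F)"
    have Fe: "Fe \<in> H" unfolding Fe_def by (rule kapply_mem[OF Y(1)])
    have "(nrm Fe)\<^sup>2 = kquad K Y (kapply J Y F)" unfolding Fe_def by (rule kapply_nrm_sq[OF Y(1)])
    also have "\<dots> = 1" using F D.dual_quad[of F] by simp
    finally have "nrm Fe = 1" using nrm_nonneg[OF Fe] power2_eq_iff_nonneg[of "nrm Fe" 1] by simp
    then have "wp_cost Y (\<lambda>x. \<phi> x * (Fe x)\<^sup>2) c" using cost[OF Fe] by simp
    from wp_cost_balanced[OF this] obtain f g where
      f: "\<And>n. f n \<in> H" "summable (\<lambda>n. (nrm (f n))\<^sup>2)" "(\<Sum>n. (nrm (f n))\<^sup>2) \<le> c"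
      and g: "\<And>n. g n \<in> H" "summable (\<lambda>n. (nrm (g n))\<^sup>2)" "(\<Sum>n. (nrm (g n))\<^sup>2) \<le> c"
      and fg: "\<And>x. x \<in> Y \<Longrightarrow> (\<lambda>n::nat. f n x * g n x) sums (\<phi> x * (Fe x)\<^sup>2)" by blast
    have *: "summable (\<lambda>n. kquad J Y (u n)) \<and> (\<Sum>n. kquad J Y (u n)) \<le> c'"
      if u: "\<And>n. u n \<in> H" "summable (\<lambda>n. (nrm (u n))\<^sup>2)" "(\<Sum>n. (nrm (u n))\<^sup>2) \<le> c" for u :: "nat \<Rightarrow> _"
    proof -
      have s: "summable (\<lambda>n. kquad J Y (u n))"
        by (rule summable_comparison_test'[OF u(2)]) (use nsq_restrict_le[OF J u(1)] D.J.nonneg in simp)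
      have "(\<Sum>n. kquad J Y (u n)) \<le> (\<Sum>n. (nrm (u n))\<^sup>2)"
        by (rule suminf_le[OF nsq_restrict_le[OF J u(1)] s u(2)])
      then show ?thesis using s u(3) c' by simp
    qed
    have "Fe z = F z" if "z \<in> Y" for z unfolding Fe_def by (rule D.k_J[OF that])
    then have "\<forall>z\<in>Y. (\<lambda>n. f n z * g n z) sums (\<phi> z * (F z)\<^sup>2)" using fg by simp
    then show "\<exists>f g. summable (\<lambda>n. kquad J Y (f n)) \<and> (\<Sum>n. kquad J Y (f n)) \<le> c' \<and>
        summable (\<lambda>n. kquad J Y (g n)) \<and> (\<Sum>n. kquad J Y (g n)) \<le> c' \<and>
        (\<forall>z\<in>Y. (\<lambda>n. f n z * g n z) sums (\<phi> z * (F z)\<^sup>2))"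
      using *[OF f] *[OF g] by blast
  qed
qed

text \<open>The bounds on finite sets give a function in \<open>H\<close> that is right on the
  representatives. Functions in \<open>H\<close> and, by \<open>r\<close>, \<phi> itself do not
  distinguish a point from its representative.\<close>

lemma multiplier_if_square_cost:
  assumes c: "0 \<le> c" and r: "\<And>x. \<phi> (rep x) = \<phi> x"
    and cost: "\<And>Y f. finite Y \<Longrightarrow> Y \<subseteq> range rep \<Longrightarrow> f \<in> H \<Longrightarrow> nrm f \<le> 1 \<Longrightarrow> wp_cost Y (\<lambda>x. \<phi> x * (f x)\<^sup>2) c"
    and f: "f \<in> H"
  shows "(\<lambda>x. \<phi> x * f x) \<in> H" "nrm (\<lambda>x. \<phi> x * f x) \<le> c * nrm f"
proof -
  obtain g where g: "g \<in> H" "\<And>x. x \<in> range rep \<Longrightarrow> g x = \<phi> x * f x" "nrm g \<le> c * nrm f"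
    using multiplier_from_adjoint_bound[OF c _ f, of "range rep" \<phi>] mult_bound_if_square_cost[OF c _ _ cost] by blast
  have "g x = \<phi> x * f x" for x
    using g(2)[of "rep x"] rep_eval[OF g(1), of x] rep_eval[OF f, of x] r[of x] by simp
  then have "g = (\<lambda>x. \<phi> x * f x)" by (simp add: fun_eq_iff)
  then show "(\<lambda>x. \<phi> x * f x) \<in> H" "nrm (\<lambda>x. \<phi> x * f x) \<le> c * nrm f" using g by simp_all
qed

lemma square_cost: "f \<in> H \<Longrightarrow> nrm f \<le> 1 \<Longrightarrow> wp_cost Y (\<lambda>x. (f x)\<^sup>2) 1"
  using wp_cost_mono[OF wp_cost_product[of f f Y], of 1] nrm_nonneg[of f]
  by (simp add: power2_eq_square mult_le_one)

text \<open>Multiplying the constant 1 shows that \<phi> lies in the weak product, whose elements do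
  not distinguish points with the same kernel function.\<close>

lemma weak_product_multiplier_rep:
  assumes "\<phi> \<in> Mult (weak_product H ip)"
  shows "\<phi> (rep x) = \<phi> x"
proof -
  have "(\<lambda>x. 1) \<in> weak_product H ip"
    using wp_cost_product[OF one_mem one_mem, of UNIV] unfolding weak_product_iff by auto
  from MultD[OF assms this] have "(\<lambda>x. \<phi> x * 1) \<in> weak_product H ip" .
  then obtain f g where f: "\<And>n. f n \<in> H" and g: "\<And>n. g n \<in> H"
    and s: "\<And>x. (\<lambda>n::nat. f n x * g n x) sums \<phi> x"
    unfolding weak_product_def weak_product_rep_def by auto
  have "(\<lambda>n. f n x * g n x) sums \<phi> (rep x)" using s[of "rep x"] by (simp add: rep_eval[OF f] rep_eval[OF g])
  then show ?thesis using s[of x] by (rule sums_unique2)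
qed

text \<open>A crude bound that depends on \<open>Y\<close>: the values \<open>\<phi> z * f z\<close>
  are interpolated by \<open>w\<close> in \<open>H\<close>, with norm controlled through the
  cardinal functions \<open>e z\<close>. It ensures that the infimum in
  \<open>uniform_square_cost\<close> is over a nonempty set.\<close>

lemma local_square_cost:
  assumes Y: "finite Y" "Y \<subseteq> range rep"
  shows "\<exists>c. \<forall>f\<in>H. nrm f \<le> 1 \<longrightarrow> wp_cost Y (\<lambda>x. \<phi> x * (f x)\<^sup>2) c"
proof -
  interpret pd: pd_kernel K Y by (rule pd_kernel_K[OF Y])
  obtain J where J: "dual_kernels K J Y" using pd.dual_exists by blast
  interpret D: dual_kernels K J Y by fact
  define e where "e z = kapply K Y (kapply J Y (\<lambda>w. if w = z then 1 else 0))" for z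
  have e: "e z \<in> H" for z unfolding e_def by (rule kapply_mem[OF Y(1)])
  have ez: "e z w = (if w = z then 1 else 0)" if "w \<in> Y" for z w
    unfolding e_def by (rule D.k_J[OF that])
  define c where "c = (\<Sum>z\<in>Y. cmod (\<phi> z) * nrm (\<lambda>x. K x z) * nrm (e z))"
  have "wp_cost Y (\<lambda>x. \<phi> x * (f x)\<^sup>2) c" if f: "f \<in> H" "nrm f \<le> 1" for f
  proof -
    define w where "w x = (\<Sum>z\<in>Y. (\<phi> z * f z) * e z x)" for x
    have w: "w \<in> H" unfolding w_def[abs_def] by (rule partial_sum_mem[OF scale_mem[OF e] Y(1)])
    have "nrm w \<le> (\<Sum>z\<in>Y. nrm (\<lambda>x. (\<phi> z * f z) * e z x))"
      unfolding w_def[abs_def] by (rule partial_sum_nrm[OF scale_mem[OF e] Y(1)])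
    also have "\<dots> \<le> c" unfolding c_def
    proof (rule sum_mono)
      fix z
      have "cmod (f z) \<le> 1 * nrm (\<lambda>x. K x z)"
        using eval_le[OF f(1), of z] mult_right_mono[OF f(2) nrm_nonneg[OF kernel_mem]] by (rule order_trans)
      then have "cmod (\<phi> z) * cmod (f z) * nrm (e z) \<le> cmod (\<phi> z) * nrm (\<lambda>x. K x z) * nrm (e z)"
        using nrm_nonneg[OF e] by (intro mult_right_mono mult_left_mono) auto
      then show "nrm (\<lambda>x. (\<phi> z * f z) * e z x) \<le> cmod (\<phi> z) * nrm (\<lambda>x. K x z) * nrm (e z)"
        unfolding nrm_scale[OF e] norm_mult .
    qed
    finally have wc: "nrm w \<le> c" .
    have wY: "w x = \<phi> x * f x" if x: "x \<in> Y" for x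
    proof -
      have "w x = (\<Sum>z\<in>Y. (\<phi> z * f z) * (if z = x then 1 else 0))"
        unfolding w_def using ez[OF x] by (intro sum.cong refl) auto
      then show ?thesis using sum_delta_mult[OF Y(1) x, of "\<lambda>z. \<phi> z * f z" 1] by simp
    qed
    have "nrm w * nrm f \<le> c * 1" using wc f(2) nrm_nonneg[OF w] nrm_nonneg[OF f(1)]
      by (intro mult_mono) auto
    then have "wp_cost Y (\<lambda>x. w x * f x) c" using wp_cost_mono[OF wp_cost_product[OF w f(1)]] by simp
    then show ?thesis by (rule wp_cost_cong) (simp add: wY power2_eq_square)
  qed
  then show ?thesis by blast
qed

text \<open>The analogue of a closed graph theorem. Were the best constants unbounded, nearly
  extremal squares on suitable finite sets \<open>Y n\<close> would combine into one
  \<open>h\<close> in the weak product whose product with \<phi> has unbounded cost on these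
  sets.\<close>

lemma uniform_square_cost:
  assumes \<phi>: "\<phi> \<in> Mult (weak_product H ip)"
  shows "\<exists>c\<ge>0. \<forall>Y f. finite Y \<longrightarrow> Y \<subseteq> range rep \<longrightarrow> f \<in> H \<longrightarrow> nrm f \<le> 1 \<longrightarrow> wp_cost Y (\<lambda>x. \<phi> x * (f x)\<^sup>2) c"
proof (rule ccontr)
  assume no: "\<not> ?thesis"
  define good where "good Y c \<longleftrightarrow> (\<forall>f\<in>H. nrm f \<le> 1 \<longrightarrow> wp_cost Y (\<lambda>x. \<phi> x * (f x)\<^sup>2) c)" for Y c
  have good_mono: "good Y d" if "good Y c" "c \<le> d" for Y c d
    unfolding good_def
  proof (intro ballI impI)
    fix f assume f: "f \<in> H" "nrm f \<le> 1"
    have "wp_cost Y (\<lambda>x. \<phi> x * (f x)\<^sup>2) c" using that(1) f unfolding good_def by simp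
    then show "wp_cost Y (\<lambda>x. \<phi> x * (f x)\<^sup>2) d" using that(2) by (rule wp_cost_mono)
  qed
  have no: "\<exists>Y. finite Y \<and> Y \<subseteq> range rep \<and> \<not> good Y c" if c: "0 \<le> c" for c
  proof (rule ccontr)
    assume "\<not> ?thesis"
    then have "\<And>Y. finite Y \<Longrightarrow> Y \<subseteq> range rep \<Longrightarrow> good Y c" by simp
    then have "\<forall>Y f. finite Y \<longrightarrow> Y \<subseteq> range rep \<longrightarrow> f \<in> H \<longrightarrow> nrm f \<le> 1 \<longrightarrow> wp_cost Y (\<lambda>x. \<phi> x * (f x)\<^sup>2) c"
      unfolding good_def by simp
    with c have "\<exists>c\<ge>0. \<forall>Y f. finite Y \<longrightarrow> Y \<subseteq> range rep \<longrightarrow> f \<in> H \<longrightarrow> nrm f \<le> 1 \<longrightarrow> wp_cost Y (\<lambda>x. \<phi> x * (f x)\<^sup>2) c"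
      by (intro exI[of _ c] conjI)
    then show False by (rule notE[OF no])
  qed
  have "\<forall>n. \<exists>P. finite (fst P) \<and> 4 ^ n \<le> fst (snd P) \<and> good (fst P) (fst (snd P)) \<and>
     snd (snd P) \<in> H \<and> nrm (snd (snd P)) \<le> 1 \<and> \<not> wp_cost (fst P) (\<lambda>x. \<phi> x * (snd (snd P) x)\<^sup>2) (9/10 * fst (snd P))"
  proof
    fix n :: nat
    obtain Y where Y: "finite Y" "Y \<subseteq> range rep" "\<not> good Y (4 ^ n)"
      using no[of "4 ^ n"] by auto
    define S where "S = {c. good Y c}"
    have lb: "4 ^ n \<le> c" if "c \<in> S" for c
      using that good_mono[of Y c "4 ^ n"] Y(3) unfolding S_def by fastforce
    have ne: "S \<noteq> {}" using local_square_cost[OF Y(1,2), of \<phi>] unfolding S_def good_def by simp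
    define I where "I = Inf S"
    have I: "4 ^ n \<le> I" unfolding I_def by (rule cInf_greatest[OF ne lb])
    have I0: "0 < I" using I zero_less_power[of "4::real" n] by linarith
    \<comment> \<open>The best constant \<open>I\<close> need not be attained. The factor 21/20 puts
      \<open>C\<close> above it, and \<open>9/10 * 21/20 < 1\<close> puts \<open>9/10 * C\<close>
      below it.\<close>
    define C where "C = 21/20 * I"
    have "I < C" using I0 by (simp add: C_def)
    then obtain c where "c \<in> S" "c < C" using cInf_lessD[OF ne, of C] unfolding I_def by blast
    then have gC: "good Y C" using good_mono[of Y c C] by (simp add: S_def)
    have "9/10 * C \<notin> S"
    proof
      assume "9/10 * C \<in> S"
      then have "I \<le> 9/10 * C" unfolding I_def by (intro cInf_lower bdd_belowI[of _ "4 ^ n"] lb)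
      then show False using I0 by (simp add: C_def)
    qed
    then obtain f where "f \<in> H" "nrm f \<le> 1" "\<not> wp_cost Y (\<lambda>x. \<phi> x * (f x)\<^sup>2) (9/10 * C)"
      unfolding S_def good_def by auto
    moreover have "4 ^ n \<le> C" using I I0 by (simp add: C_def)
    ultimately show "\<exists>P. finite (fst P) \<and> 4 ^ n \<le> fst (snd P) \<and> good (fst P) (fst (snd P)) \<and>
     snd (snd P) \<in> H \<and> nrm (snd (snd P)) \<le> 1 \<and> \<not> wp_cost (fst P) (\<lambda>x. \<phi> x * (snd (snd P) x)\<^sup>2) (9/10 * fst (snd P))"
      using gC Y(1) by (intro exI[of _ "(Y, C, f)"]) simp
  qed
  from choice[OF this] obtain P where P0: "\<forall>n. finite (fst (P n)) \<and> 4 ^ n \<le> fst (snd (P n)) \<and> good (fst (P n)) (fst (snd (P n))) \<and>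
     snd (snd (P n)) \<in> H \<and> nrm (snd (snd (P n))) \<le> 1 \<and>
     \<not> wp_cost (fst (P n)) (\<lambda>x. \<phi> x * (snd (snd (P n)) x)\<^sup>2) (9/10 * fst (snd (P n)))"
    by (rule exE)
  note P = spec[OF P0]
  define Y where "Y n = fst (P n)" for n
  define C where "C n = fst (snd (P n))" for n
  define f where "f n = snd (snd (P n))" for n
  have C: "4 ^ n \<le> C n" and gC: "good (Y n) (C n)" and f: "f n \<in> H" "nrm (f n) \<le> 1"
    and hump: "\<not> wp_cost (Y n) (\<lambda>x. \<phi> x * (f n x)\<^sup>2) (9/10 * C n)" for n
    using P[of n] by (simp_all add: Y_def C_def f_def)
  define u where "u n x = (f n x)\<^sup>2" for n x
  define W where "W n h c \<longleftrightarrow> wp_cost (Y n) (\<lambda>x. \<phi> x * h x) c" for n h c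
  have usum: "summable (\<lambda>m. (1/3) ^ m * cmod (u m x))" for x
  proof (rule summable_comparison_test')
    show "summable (\<lambda>m. (1/3) ^ m * (nrm (\<lambda>z. K z x))\<^sup>2)" by (intro summable_mult2 summable_geometric) simp
    show "norm ((1/3) ^ m * cmod (u m x)) \<le> (1/3) ^ m * (nrm (\<lambda>z. K z x))\<^sup>2" for m
    proof -
      have "cmod (f m x) \<le> 1 * nrm (\<lambda>z. K z x)"
        using eval_le[OF f(1)[of m], of x] mult_right_mono[OF f(2)[of m] nrm_nonneg[OF kernel_mem]] by (rule order_trans)
      then have "cmod (u m x) \<le> (nrm (\<lambda>z. K z x))\<^sup>2" unfolding u_def norm_power by (intro power_mono) auto
      then show ?thesis by (simp add: mult_left_mono)
    qed
  qed
  have ssum: "(\<lambda>m. s (m + N) * u (m + N) x) sums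
      (\<Sum>m. s (m + N) * u (m + N) x)"
    if s: "\<And>m. cmod (s m) = (1/3) ^ m" for s N x
  proof (rule summable_sums, rule summable_comparison_test')
    show "summable (\<lambda>m. (1/3) ^ (m + N) * cmod (u (m + N) x))"
      using usum[of x] summable_iff_shift[of "\<lambda>m. (1/3) ^ m * cmod (u m x)" N] by simp
    show "norm (s (m + N) * u (m + N) x) \<le> (1/3) ^ (m + N) * cmod (u (m + N) x)" for m
      by (simp add: norm_mult s)
  qed
  have scaled: "wp_cost Z (\<lambda>x. q x * (\<Sum>m. s (m + N) * u (m + N) x)) (D * ((1/3) ^ N * (3/2)))"
    if s: "\<And>m. cmod (s m) = (1/3) ^ m" and D: "\<And>m. wp_cost Z (\<lambda>x. q x * u m x) D" for Z q D s N
  proof -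
    define h where "h m x = s (m + N) * (q x * u (m + N) x)" for m x
    define c where "c m = D * (1/3) ^ (m + N)" for m
    have "wp_cost Z (h m) (c m)" for m
      using wp_cost_scale[OF D, of "s (m + N)" "m + N"]
      unfolding h_def[abs_def] c_def s by (simp only: mult.commute)
    moreover have cs: "suminf c = D * ((1/3) ^ N * (3/2))" "summable c"
      using sums_mult[OF geometric_third, of D N] unfolding c_def sums_iff by simp_all
    moreover have "(\<lambda>m. h m x) sums (q x * (\<Sum>m. s (m + N) * u (m + N) x))" for x
      using sums_mult[OF ssum[of s N x, OF s], of "q x"] unfolding h_def by (simp only: mult.left_commute)
    ultimately show ?thesis
      using wp_cost_sums[of Z h c "\<lambda>x. q x * (\<Sum>m. s (m + N) * u (m + N) x)"]
      unfolding cs(1) by simp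
  qed
  have "\<exists>s :: nat \<Rightarrow> complex. (\<forall>m. cmod (s m) = (1/3) ^ m) \<and>
    (\<forall>c. \<exists>n. \<not> W n (\<lambda>x. \<Sum>m. s m * u m x) c)"
  proof (rule gliding_hump[where C = C])
    show "W n h d" if "W n h c" "c \<le> d" for n h c d using that unfolding W_def by (rule wp_cost_mono)
    show "W n (\<lambda>x. a x - b x) (c + d)" if "W n a c" "W n b d" for n a b c d
      using that unfolding W_def right_diff_distrib by (rule wp_cost_diff)
    show "W n (\<lambda>x. complex_of_real t * a x) (t * c)" if "W n a c" "0 < t" for n a c t
    proof -
      have "wp_cost (Y n) (\<lambda>x. complex_of_real t * (\<phi> x * a x)) (cmod (complex_of_real t) * c)"
        using that(1) unfolding W_def by (rule wp_cost_scale)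
      then show ?thesis using that(2) unfolding W_def by (simp add: mult.left_commute)
    qed
    show "4 ^ n \<le> C n" for n by (rule C)
    show "\<not> W n (u n) (9/10 * C n)" for n using hump[of n] unfolding W_def u_def .
    show "summable (\<lambda>m. (1/3) ^ m * cmod (u m x))" for x by (rule usum)
    show "W n (\<lambda>x. \<Sum>m. s (m + Suc n) * u (m + Suc n) x) (C n * (1/3) ^ n / 2)"
      if s: "\<And>m. cmod (s m) = (1/3) ^ m" for n s
    proof -
      have "wp_cost (Y n) (\<lambda>x. \<phi> x * u m x) (C n)" for m
        using gC[of n] f[of m] unfolding good_def u_def by simp
      from scaled[of s "Y n" \<phi> "C n" "Suc n", OF s this] show ?thesis unfolding W_def by simp
    qed
  qed
  then obtain s :: "nat \<Rightarrow> complex" where s: "\<And>m. cmod (s m) = (1/3) ^ m"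
    and un: "\<And>c. \<exists>n. \<not> W n (\<lambda>x. \<Sum>m. s m * u m x) c" by blast
  define h where "h x = (\<Sum>m. s m * u m x)" for x
  \<comment> \<open>Squares of unit ball elements have cost 1, so the geometric series has cost
    \<open>3/2\<close> on all points and \<open>h\<close> lies in the weak product.\<close>
  have "wp_cost UNIV (\<lambda>x. 1 * u m x) 1" for m using square_cost[OF f] unfolding u_def by simp
  from scaled[of s UNIV "\<lambda>_. 1" 1 0, OF s this] have "wp_cost UNIV h (3/2)" unfolding h_def[abs_def] by simp
  then have "h \<in> weak_product H ip" unfolding weak_product_iff by blast
  from MultD[OF \<phi> this] have "(\<lambda>x. \<phi> x * h x) \<in> weak_product H ip" .
  then obtain c where "wp_cost UNIV (\<lambda>x. \<phi> x * h x) c" unfolding weak_product_iff by blast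
  then have "W n h c" for n unfolding W_def by (rule wp_cost_subset) simp
  then show False using un[of c] unfolding h_def[abs_def] by simp
qed

lemma Mult_weak_product_eq: "Mult (weak_product H ip) = Mult H"
proof
  show "Mult H \<subseteq> Mult (weak_product H ip)" using Mult_subset_weak_product by blast
  show "Mult (weak_product H ip) \<subseteq> Mult H"
  proof
    fix \<phi> assume \<phi>: "\<phi> \<in> Mult (weak_product H ip)"
    obtain c where c: "0 \<le> c" "\<And>Y f. finite Y \<Longrightarrow> Y \<subseteq> range rep \<Longrightarrow> f \<in> H \<Longrightarrow> nrm f \<le> 1 \<Longrightarrow> wp_cost Y (\<lambda>x. \<phi> x * (f x)\<^sup>2) c"
      using uniform_square_cost[OF \<phi>] by blast
    have "(\<lambda>x. \<phi> x * f x) \<in> H" if "f \<in> H" for f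
      by (rule multiplier_if_square_cost(1)[OF c(1) weak_product_multiplier_rep[OF \<phi>] c(2) that])
    then show "\<phi> \<in> Mult H" by (simp add: Mult_def)
  qed
qed

text \<open>Multiplying the first factor of every product by \<phi> multiplies the cost by at most
  the norm on \<open>H\<close>. That this norm is finite comes from
  \<open>multiplier_bounded\<close>.\<close>

lemma mult_norm_weak_product_le:
  assumes \<phi>: "\<phi> \<in> Mult H"
  shows "mult_norm (weak_product H ip) (weak_product_norm H ip) \<phi> \<le> mult_norm H nrm \<phi>"
proof -
  obtain c0 where c0: "0 \<le> c0" "\<And>f. f \<in> H \<Longrightarrow> nrm (\<lambda>x. \<phi> x * f x) \<le> c0 * nrm f"
    using multiplier_bounded[OF \<phi>] by blast
  have "mult_norm H nrm \<phi> \<le> ennreal c0"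
    unfolding mult_norm_def
  proof (rule SUP_least)
    fix f assume f: "f \<in> {f \<in> H. nrm f \<le> 1}"
    then have "nrm (\<lambda>x. \<phi> x * f x) \<le> c0 * 1" using c0(2)[of f] mult_left_mono[of "nrm f" 1 c0] c0(1) by simp
    then show "ennreal (nrm (\<lambda>x. \<phi> x * f x)) \<le> ennreal c0" by (simp add: ennreal_leI)
  qed
  then have fin: "mult_norm H nrm \<phi> \<noteq> top" by (auto simp: top_unique)
  define c where "c = enn2real (mult_norm H nrm \<phi>)"
  have c: "0 \<le> c" "mult_norm H nrm \<phi> = ennreal c" using fin by (simp_all add: c_def less_top)
  have unit: "nrm (\<lambda>x. \<phi> x * f x) \<le> c" if f: "f \<in> H" "nrm f \<le> 1" for f
  proof -
    have "ennreal (nrm (\<lambda>x. \<phi> x * f x)) \<le> mult_norm H nrm \<phi>"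
      unfolding mult_norm_def by (rule SUP_upper) (use f in simp)
    then show ?thesis unfolding c(2) using c(1) by (simp add: ennreal_le_iff)
  qed
  have bound: "nrm (\<lambda>x. \<phi> x * f x) \<le> c * nrm f" if f: "f \<in> H" for f
  proof (cases "nrm f = 0")
    case True
    then show ?thesis using c0(2)[OF f] by simp
  next
    case False
    then have n: "nrm f > 0" using nrm_nonneg[OF f] by simp
    define g where "g x = of_real (1 / nrm f) * f x" for x
    have g: "g \<in> H" unfolding g_def[abs_def] by (rule scale_mem[OF f])
    have g1: "nrm g \<le> 1" unfolding g_def[abs_def] nrm_scale[OF f] using n by (simp add: norm_divide)
    have phf: "(\<lambda>x. \<phi> x * f x) \<in> H" by (rule MultD[OF \<phi> f])
    have "(\<lambda>x. \<phi> x * g x) = (\<lambda>x. of_real (1 / nrm f) * (\<phi> x * f x))" by (simp add: g_def fun_eq_iff)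
    then have "nrm (\<lambda>x. \<phi> x * g x) = nrm (\<lambda>x. \<phi> x * f x) / nrm f"
      using nrm_scale[OF phf, of "of_real (1 / nrm f)"] n by (simp add: norm_divide)
    then show ?thesis using unit[OF g g1] n by (simp add: pos_divide_le_eq)
  qed
  show ?thesis unfolding mult_norm_def[of "weak_product H ip"] c(2)
  proof (rule SUP_least)
    fix h assume h: "h \<in> {h \<in> weak_product H ip. weak_product_norm H ip h \<le> 1}"
    \<comment> \<open>A representation of \<open>h\<close> of cost at most 1 need not exist, so any
      \<open>d\<close> above 1 is used.\<close>
    have "weak_product_norm H ip (\<lambda>x. \<phi> x * h x) \<le> c * d" if d: "1 < d" for d
    proof -
      have "wp_cost UNIV h d" using h d by (intro wp_cost_if_norm_less) auto
      from wp_cost_multiplier[OF \<phi> c(1) bound this] show ?thesis by (rule weak_product_norm_le)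
    qed
    then have "weak_product_norm H ip (\<lambda>x. \<phi> x * h x) \<le> c * (1 + 1 / real (Suc n))" for n by simp
    moreover have "(\<lambda>n. c * (1 + 1 / real (Suc n))) \<longlonglongrightarrow> c * (1 + 0)"
      by (intro tendsto_intros LIMSEQ_Suc[OF lim_1_over_n])
    ultimately have "weak_product_norm H ip (\<lambda>x. \<phi> x * h x) \<le> c * (1 + 0)"
      by (intro LIMSEQ_le_const) blast+
    then show "ennreal (weak_product_norm H ip (\<lambda>x. \<phi> x * h x)) \<le> ennreal c" by (simp add: ennreal_leI)
  qed
qed

text \<open>Squares of unit ball elements of \<open>H\<close> lie in the unit ball of the weak
  product. Hence \<phi> times such a square has cost at most any \<open>c'\<close> above the norm
  \<open>c\<close>, and \<open>multiplier_if_square_cost\<close> returns the same \<open>c'\<close>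
  as a bound on \<open>H\<close>.\<close>

lemma mult_norm_le_weak_product:
  assumes \<phi>: "\<phi> \<in> Mult H"
  shows "mult_norm H nrm \<phi> \<le> mult_norm (weak_product H ip) (weak_product_norm H ip) \<phi>"
proof (cases "mult_norm (weak_product H ip) (weak_product_norm H ip) \<phi> = top")
  case False
  define c where "c = enn2real (mult_norm (weak_product H ip) (weak_product_norm H ip) \<phi>)"
  have c: "0 \<le> c" "mult_norm (weak_product H ip) (weak_product_norm H ip) \<phi> = ennreal c"
    using False by (simp_all add: c_def less_top)
  have phw: "\<phi> \<in> Mult (weak_product H ip)" by (rule Mult_subset_weak_product[OF \<phi>])
  have cost: "wp_cost UNIV (\<lambda>x. \<phi> x * (f x)\<^sup>2) c'" if f: "f \<in> H" "nrm f \<le> 1" and c': "c < c'" for f c'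
  proof -
    have sq: "wp_cost UNIV (\<lambda>x. (f x)\<^sup>2) 1" by (rule square_cost[OF f])
    then have mem: "(\<lambda>x. (f x)\<^sup>2) \<in> weak_product H ip" unfolding weak_product_iff by blast
    then have mem': "(\<lambda>x. \<phi> x * (f x)\<^sup>2) \<in> weak_product H ip" by (rule MultD[OF phw])
    have "ennreal (weak_product_norm H ip (\<lambda>x. \<phi> x * (f x)\<^sup>2)) \<le> ennreal c"
      unfolding c(2)[symmetric] mult_norm_def
      by (rule SUP_upper) (use mem weak_product_norm_le[OF sq] in simp)
    then have "weak_product_norm H ip (\<lambda>x. \<phi> x * (f x)\<^sup>2) \<le> c" using c(1) by (simp add: ennreal_le_iff)
    then show ?thesis using c' by (intro wp_cost_if_norm_less[OF mem']) simp
  qed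
  have bound: "nrm (\<lambda>x. \<phi> x * f x) \<le> c' * nrm f" if f: "f \<in> H" and c': "c < c'" for f c'
  proof (rule multiplier_if_square_cost(2)[of c' \<phi> f, OF _ weak_product_multiplier_rep[OF phw] _ f])
    show "0 \<le> c'" using c(1) c' by simp
    show "wp_cost Y (\<lambda>x. \<phi> x * (g x)\<^sup>2) c'" if "g \<in> H" "nrm g \<le> 1" for Y g
      by (rule wp_cost_subset[OF cost[OF that c']]) simp
  qed
  show ?thesis unfolding mult_norm_def[of H] c(2)
  proof (rule SUP_least)
    fix f assume f: "f \<in> {f \<in> H. nrm f \<le> 1}"
    have "nrm (\<lambda>x. \<phi> x * f x) \<le> c + 1 / real (Suc n)" for n
    proof -
      have "nrm (\<lambda>x. \<phi> x * f x) \<le> (c + 1 / real (Suc n)) * nrm f" using f by (intro bound) auto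
      also have "\<dots> \<le> (c + 1 / real (Suc n)) * 1" using f c(1) by (intro mult_left_mono) auto
      finally show ?thesis by simp
    qed
    moreover have "(\<lambda>n. c + 1 / real (Suc n)) \<longlonglongrightarrow> c + 0"
      by (intro tendsto_intros LIMSEQ_Suc[OF lim_1_over_n])
    ultimately have "nrm (\<lambda>x. \<phi> x * f x) \<le> c + 0" by (intro LIMSEQ_le_const) blast+
    then show "ennreal (nrm (\<lambda>x. \<phi> x * f x)) \<le> ennreal c" by (simp add: ennreal_leI)
  qed
qed simp

end

theorem theorem1p4:
  fixes H :: "('x \<Rightarrow> complex) set"
    and ip :: "('x \<Rightarrow> complex) \<Rightarrow> ('x \<Rightarrow> complex) \<Rightarrow> complex"
    and K :: "'x \<Rightarrow> 'x \<Rightarrow> complex"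
  assumes "normalized_complete_pick_space H ip K"
  shows "Mult (weak_product H ip) = Mult H \<and>
    (\<forall>\<phi>\<in>Mult H.
       mult_norm (weak_product H ip) (weak_product_norm H ip) \<phi> = mult_norm H (ip_norm ip) \<phi>)"
proof -
  interpret normalized_complete_pick_space H ip K by fact
  show ?thesis
    by (intro conjI ballI antisym Mult_weak_product_eq mult_norm_weak_product_le mult_norm_le_weak_product)
qed

end
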